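(* Let $(D',\phi')$ and $(D'',\phi'')$ be basic pairs for $U$. Then $$\sum_{D,\phi}\frac{|K_{D,\phi}|}{|U|}\,\xi_{D',\phi'}(z_{D,\phi})\,\overline{\xi_{D'',\phi''}(z_{D,\phi})}=\delta_{D',D''}\,\delta_{\phi',\phi''}\,\langle\xi_{D',\phi'},\xi_{D',\phi'}\rangle,$$ where the sum is over all basic pairs $(D,\phi)$ for $U$.
   Context: Let $p$ be an odd prime, $q=p^{e}$ ($e\ge 1$), $\mathbb{F}_q$ the field with $q$ elements, $\mathbb{F}_q^{\times}=\mathbb{F}_q\setminus\{0\}$, and $n\ge 1$. Let $G$ be one of $Sp_{2n}(q)$, $O_{2n}(q)$, $O_{2n+1}(q)$; put $m=2n$ in the first two cases and $m=2n+1$ in the third. $U_m(q)$ is the group of unipotent upper-triangular $m\times m$ matrices over $\mathbb{F}_q$, and $U=G\cap U_m(q)$. Explicitly, with $J$ the $n\times n$ matrix with $1$'s on the anti-diagonal and $0$'s elsewhere, $U$ consists of all block matrices $\begin{pmatrix} x & xv & xw\\ 0 & I_r & -v^{T}J\\ 0&0&Jx^{-T}J\end{pmatrix}$ with $x\in U_n(q)$, $v$ an $n\times r$ matrix, $w$ an $n\times n$ matrix over $\mathbb{F}_q$, where: $r=0$ and $Jw^T-wJ=0$ if $G=Sp_{2n}(q)$; $r=0$ and $Jw^T+wJ=0$ if $G=O_{2n}(q)$; $r=1$ and $Jw^T+wJ=-vv^T$ if $G=O_{2n+1}(q)$. Characters are complex characters, and $\langle\cdot,\cdot\rangle$ is the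 Frobenius scalar product of class functions on $U$. Indexing. Rows and columns of $m\times m$ matrices are indexed by $1\prec 2\prec\cdots\prec n\prec 0\prec -n\prec\cdots\prec -2\prec -1$ (index $0$ present only if $G=O_{2n+1}(q)$); $e_{i,j}$ denotes a matrix unit. Roots. $\varepsilon_1,\dots,\varepsilon_n$ are formal independent symbols; $\Phi=\{\varepsilon_i\pm\varepsilon_j:1\le i<j\le n\}\cup\Phi'$ with $\Phi'=\{2\varepsilon_i:1\le i\le n\}$ if $G=Sp_{2n}(q)$, $\Phi'=\emptyset$ if $G=O_{2n}(q)$, $\Phi'=\{\varepsilon_i:1\le i\le n\}$ if $G=O_{2n+1}(q)$. For $\alpha\in\Phi$ let $\mathcal{E}(\alpha)$ be: $\{(i,j),(-j,-i)\}$ if $\alpha=\varepsilon_i-\varepsilon_j$; $\{(i,-j),(j,-i)\}$ if $\alpha=\varepsilon_i+\varepsilon_j$ ($i<j$); $\{(i,-i)\}$ if $\alpha=2\varepsilon_i$; $\{(i,0),(0,-i)\}$ if $\alpha=\varepsilon_i$. For $\Psi\subseteq\Phi$, $\mathcal{E}(\Psi)=\bigcup_{\alpha\in\Psi}\mathcal{E}(\alpha)$. Each $\mathcal{E}(\alpha)$ contains exactly one entry $(i,j)$ with $1\le i\le n$ and $i\prec j\preceq -i$; it is called the positive entry of $\alpha$. Basic pairs. $D\subseteq\Phi$ is basic if $\mathcal{E}(D)$ contains at most one entry from each row and at most one from each column. A basic pair for $U$ is $(D,\phi)$ with $D\subseteq\Phi$ basic (possibly empty) and $\phi:D\to\mathbb{F}_q^\times$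 a map. The product $\delta_{D',D''}\delta_{\phi',\phi''}$ is $1$ if $(D',\phi')=(D'',\phi'')$ and $0$ otherwise. Superclasses and representatives. Let $e_\alpha$ be: $e_{i,j}-e_{-j,-i}$ if $\alpha=\varepsilon_i-\varepsilon_j$; $e_{i,-j}+e_{j,-i}$ if $\alpha=\varepsilon_i+\varepsilon_j$ and $G=Sp_{2n}(q)$; $e_{i,-j}-e_{j,-i}$ if $\alpha=\varepsilon_i+\varepsilon_j$ and $G$ is orthogonal; $e_{i,-i}$ if $\alpha=2\varepsilon_i$; $e_{i,0}-e_{0,-i}$ if $\alpha=\varepsilon_i$. Put $e_{D,\phi}=\sum_{\alpha\in D}\phi(\alpha)e_\alpha$ and $K_{D,\phi}=\{x\in U:x-1\in U_m(q)e_{D,\phi}U_m(q)\}$ (the superclasses of $U$). For $z=\begin{pmatrix} x & xv & xw\\ 0 & I_r & -v^{T}J\\ 0&0&Jx^{-T}J\end{pmatrix}\in U$, with $x\in U_n(q)$, $v$ an $n\times r$ matrix and $w$ an $n\times n$ matrix over $\mathbb{F}_q$, let $a_z=\begin{pmatrix} x-1 & v & w'\\ 0&0_r&-v^TJ\\ 0&0&-J(x-1)^TJ\end{pmatrix}$ with $w'=w$ if $r=0$ and $w'=w+\frac12 vv^TJ$ if $r=1$; $z\mapsto a_z$ is a bijection from $U$ onto the $\mathbb{F}_q$-span of $\{e_\alpha:\alpha\in\Phi\}$. $z_{D,\phi}$ is the unique $z\in U$ with $a_z=e_{D,\phi}$; it lies in $K_{D,\phi}$. Supercharacters. Fix a nontrivial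 linear character $\vartheta:\mathbb{F}_q\to\mathbb{C}^\times$ of the additive group of $\mathbb{F}_q$. Define subgroups $U_\alpha\le U$: if $\alpha=\varepsilon_i-\varepsilon_j$, $U_\alpha=\{x\in U:x_{i,k}=0,\ i<k<j\}$; if $\alpha=\varepsilon_i+\varepsilon_j$ ($i<j$), $U_\alpha=\{x\in U:x_{i,k}=x_{j,l}=0,\ i<k\le n,\ j\prec l\preceq 0\}$ (when the index $0$ is absent, $l$ runs over $j<l\le n$); if $\alpha=2\varepsilon_i$ or $\alpha=\varepsilon_i$, $U_\alpha=\{x\in U:x_{i,k}=0,\ i<k\le n\}$. For $r\in\mathbb{F}_q^\times$, $\lambda_{\alpha,r}(x)=\vartheta(r x_{i,j})$, with $(i,j)$ the positive entry of $\alpha$, is a linear character of $U_\alpha$; the elementary character is the induced character $\xi_{\alpha,r}=(\lambda_{\alpha,r})^U$. The supercharacter of a basic pair is $\xi_{D,\phi}=\prod_{\alpha\in D}\xi_{\alpha,\phi(\alpha)}$ (the trivial character $1_U$ if $D=\emptyset$). *)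

theory Defs
  imports
    Complex_Main
    "HOL-Library.FuncSet"
    "HOL-Library.Cardinality"
    "HOL-Computational_Algebra.Primes"
    "HOL-Algebra.Group"
    "Jordan_Normal_Form.Gauss_Jordan_Elimination"
begin

text \<open>The type of the classical group: \<open>Sp\<^sub>2\<^sub>n(q)\<close>, \<open>O\<^sub>2\<^sub>n(q)\<close> or \<open>O\<^sub>2\<^sub>n\<^sub>+\<^sub>1(q)\<close>.  The field with
  \<open>q\<close> elements is a type of classes \<open>field\<close> and \<open>finite\<close> with \<open>CARD('a) = q\<close>.\<close>

datatype group_type = Sp | O_even | O_odd

definition rk :: "group_type \<Rightarrow> nat" where
  "rk c = (if c = O_odd then 1 else 0)"

definition msize :: "group_type \<Rightarrow> nat \<Rightarrow> nat" where
  "msize c n = 2 * n + rk c"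


subsection \<open>Signed indices\<close>

text \<open>Rows and columns carry the labels \<open>1 \<prec> \<dots> \<prec> n \<prec> 0 \<prec> -n \<prec> \<dots> \<prec> -1\<close>; \<open>pos\<close> sends a label to
  the 0-based position used by the matrix library.  The label 0 is meaningful only for
  \<open>O_odd\<close>; for the other types \<open>pos\<close> sends both \<open>0\<close> and \<open>-n\<close> to \<open>n\<close>.\<close>

definition pos :: "group_type \<Rightarrow> nat \<Rightarrow> int \<Rightarrow> nat" where
  "pos c n i = (if i > 0 then nat (i - 1) else if i = 0 then n else nat (int (msize c n) + i))"

definition prec :: "group_type \<Rightarrow> nat \<Rightarrow> int \<Rightarrow> int \<Rightarrow> bool" where
  "prec c n i j \<longleftrightarrow> pos c n i < pos c n j"

definition preceq :: "group_type \<Rightarrow> nat \<Rightarrow> int \<Rightarrow> int \<Rightarrow> bool" where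
  "preceq c n i j \<longleftrightarrow> pos c n i \<le> pos c n j"

definition ent :: "group_type \<Rightarrow> nat \<Rightarrow> 'a mat \<Rightarrow> int \<Rightarrow> int \<Rightarrow> 'a" where
  "ent c n A i j = A $$ (pos c n i, pos c n j)"

definition munit :: "group_type \<Rightarrow> nat \<Rightarrow> int \<Rightarrow> int \<Rightarrow> 'a::{zero,one} mat" where
  "munit c n i j = mat (msize c n) (msize c n)
     (\<lambda>(a, b). if a = pos c n i \<and> b = pos c n j then 1 else 0)"


subsection \<open>The group of unipotent matrices\<close>

definition unitri :: "nat \<Rightarrow> 'a::{zero,one} mat set" where
  "unitri m = {A \<in> carrier_mat m m. upper_triangular A \<and> (\<forall>i<m. A $$ (i, i) = 1)}"

definition Jmat :: "nat \<Rightarrow> 'a::{zero,one} mat" where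
  "Jmat n = mat n n (\<lambda>(i, j). if i + j + 1 = n then 1 else 0)"

text \<open>The block matrix with rows \<open>(A, B, C)\<close>, \<open>(0, D, E)\<close>, \<open>(0, 0, F)\<close>.\<close>

definition upper_block ::
  "'a::zero mat \<Rightarrow> 'a mat \<Rightarrow> 'a mat \<Rightarrow> 'a mat \<Rightarrow> 'a mat \<Rightarrow> 'a mat \<Rightarrow> 'a mat" where
  "upper_block A B C D E F =
     four_block_mat
       (four_block_mat A B (0\<^sub>m (dim_row D) (dim_col A)) D) (C @\<^sub>r E)
       (0\<^sub>m (dim_row F) (dim_col A + dim_col D)) F"

text \<open>The parameters \<open>(x, v, w)\<close> of the elements of \<open>U\<close>.\<close>

definition params ::
  "group_type \<Rightarrow> nat \<Rightarrow> ('a::field mat \<times> 'a mat \<times> 'a mat) set" where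
  "params c n = {(x, v, w). x \<in> unitri n \<and> v \<in> carrier_mat n (rk c) \<and> w \<in> carrier_mat n n \<and>
     (case c of
        Sp \<Rightarrow> Jmat n * transpose_mat w - w * Jmat n = 0\<^sub>m n n
      | O_even \<Rightarrow> Jmat n * transpose_mat w + w * Jmat n = 0\<^sub>m n n
      | O_odd \<Rightarrow> Jmat n * transpose_mat w + w * Jmat n = - (v * transpose_mat v))}"

definition U_elt ::
  "group_type \<Rightarrow> nat \<Rightarrow> 'a::field mat \<Rightarrow> 'a mat \<Rightarrow> 'a mat \<Rightarrow> 'a mat" where
  "U_elt c n x v w =
     upper_block
       x (x * v)         (x * w)
         (1\<^sub>m (rk c)) (- (transpose_mat v * Jmat n))
                         (Jmat n * transpose_mat (the (mat_inverse x)) * Jmat n)"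

definition U_set :: "group_type \<Rightarrow> nat \<Rightarrow> 'a::field mat set" where
  "U_set c n = {U_elt c n x v w | x v w. (x, v, w) \<in> params c n}"

definition U_grp :: "group_type \<Rightarrow> nat \<Rightarrow> 'a::field mat monoid" where
  "U_grp c n = \<lparr>carrier = U_set c n, mult = (*), one = 1\<^sub>m (msize c n)\<rparr>"


subsection \<open>Roots and basic pairs\<close>

text \<open>The roots \<open>\<epsilon>\<^sub>i - \<epsilon>\<^sub>j\<close>, \<open>\<epsilon>\<^sub>i + \<epsilon>\<^sub>j\<close>, \<open>2\<epsilon>\<^sub>i\<close> and \<open>\<epsilon>\<^sub>i\<close>, in this order.  The \<open>\<epsilon>\<^sub>i\<close> are formal
  symbols, and for \<open>i < j\<close> (as in \<open>roots\<close>) distinct constructor terms are distinct roots.\<close>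

datatype root = Diff int int | Plus int int | Twice int | Single int

definition roots :: "group_type \<Rightarrow> nat \<Rightarrow> root set" where
  "roots c n =
     {Diff i j | i j. 1 \<le> i \<and> i < j \<and> j \<le> int n} \<union> {Plus i j | i j. 1 \<le> i \<and> i < j \<and> j \<le> int n} \<union>
     (case c of
        Sp \<Rightarrow> {Twice i | i. 1 \<le> i \<and> i \<le> int n}
      | O_even \<Rightarrow> {}
      | O_odd \<Rightarrow> {Single i | i. 1 \<le> i \<and> i \<le> int n})"

fun entries :: "root \<Rightarrow> (int \<times> int) set" where
  "entries (Diff i j) = {(i, j), (- j, - i)}"
| "entries (Plus i j) = {(i, - j), (j, - i)}"
| "entries (Twice i) = {(i, - i)}"
| "entries (Single i) = {(i, 0), (0, - i)}"

definition pos_entry :: "group_type \<Rightarrow> nat \<Rightarrow> root \<Rightarrow> int \<times> int" where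
  "pos_entry c n \<alpha> = (THE e. e \<in> entries \<alpha> \<and> 1 \<le> fst e \<and> fst e \<le> int n \<and>
     prec c n (fst e) (snd e) \<and> preceq c n (snd e) (- fst e))"

lemma pos_entry_simps:
  "1 \<le> i \<Longrightarrow> i < j \<Longrightarrow> j \<le> int n \<Longrightarrow> pos_entry c n (Diff i j) = (i, j)"
  "1 \<le> i \<Longrightarrow> i < j \<Longrightarrow> j \<le> int n \<Longrightarrow> pos_entry c n (Plus i j) = (i, - j)"
  "1 \<le> i \<Longrightarrow> i \<le> int n \<Longrightarrow> pos_entry c n (Twice i) = (i, - i)"
  "1 \<le> i \<Longrightarrow> i \<le> int n \<Longrightarrow> pos_entry O_odd n (Single i) = (i, 0)"
  unfolding pos_entry_def
  by (rule the_equality; auto simp: prec_def preceq_def pos_def msize_def rk_def split: if_splits)+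

definition basic :: "group_type \<Rightarrow> nat \<Rightarrow> root set \<Rightarrow> bool" where
  "basic c n D \<longleftrightarrow> D \<subseteq> roots c n \<and>
     inj_on fst (\<Union>\<alpha>\<in>D. entries \<alpha>) \<and> inj_on snd (\<Union>\<alpha>\<in>D. entries \<alpha>)"

text \<open>The maps \<open>\<phi>\<close> are taken extensional (\<open>undefined\<close> outside \<open>D\<close>), so that equality of pairs is
  equality of the sets and of the maps.\<close>

definition basic_pairs :: "group_type \<Rightarrow> nat \<Rightarrow> (root set \<times> (root \<Rightarrow> 'a::field)) set" where
  "basic_pairs c n = {(D, \<phi>). basic c n D \<and> \<phi> \<in> D \<rightarrow>\<^sub>E (UNIV - {0})}"


subsection \<open>Superclasses and their representatives\<close>

fun root_mat :: "group_type \<Rightarrow> nat \<Rightarrow> root \<Rightarrow> 'a::field mat" where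
  "root_mat c n (Diff i j) = munit c n i j - munit c n (- j) (- i)"
| "root_mat c n (Plus i j) =
     (if c = Sp then munit c n i (- j) + munit c n j (- i)
      else munit c n i (- j) - munit c n j (- i))"
| "root_mat c n (Twice i) = munit c n i (- i)"
| "root_mat c n (Single i) = munit c n i 0 - munit c n 0 (- i)"

text \<open>The sum over \<open>D\<close> is taken entrywise: matrices of unspecified size have no additive neutral
  element, so \<open>sum\<close> does not apply to them.\<close>

definition e_mat :: "group_type \<Rightarrow> nat \<Rightarrow> root set \<Rightarrow> (root \<Rightarrow> 'a::field) \<Rightarrow> 'a mat" where
  "e_mat c n D \<phi> = mat (msize c n) (msize c n)
     (\<lambda>(a, b). \<Sum>\<alpha>\<in>D. (\<phi> \<alpha> \<cdot>\<^sub>m root_mat c n \<alpha>) $$ (a, b))"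

definition superclass ::
  "group_type \<Rightarrow> nat \<Rightarrow> root set \<Rightarrow> (root \<Rightarrow> 'a::field) \<Rightarrow> 'a mat set" where
  "superclass c n D \<phi> = {x \<in> U_set c n.
     \<exists>a\<in>unitri (msize c n). \<exists>b\<in>unitri (msize c n). x - 1\<^sub>m (msize c n) = a * e_mat c n D \<phi> * b}"

text \<open>The parameters \<open>(x, v, w)\<close> of \<open>z \<in> U\<close> are uniquely determined by \<open>z\<close>.\<close>

definition a_mat :: "group_type \<Rightarrow> nat \<Rightarrow> 'a::field mat \<Rightarrow> 'a mat" where
  "a_mat c n z =
     (let (x, v, w) = (THE (x, v, w). (x, v, w) \<in> params c n \<and> z = U_elt c n x v w);
          w' = (if rk c = 0 then w else w + (1 / 2) \<cdot>\<^sub>m (v * transpose_mat v * Jmat n))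
      in upper_block
           (x - 1\<^sub>m n) v                    w'
                        (0\<^sub>m (rk c) (rk c)) (- (transpose_mat v * Jmat n))
                                             (- (Jmat n * transpose_mat (x - 1\<^sub>m n) * Jmat n)))"

definition z_rep :: "group_type \<Rightarrow> nat \<Rightarrow> root set \<Rightarrow> (root \<Rightarrow> 'a::field) \<Rightarrow> 'a mat" where
  "z_rep c n D \<phi> = (THE z. z \<in> U_set c n \<and> a_mat c n z = e_mat c n D \<phi>)"


subsection \<open>Characters\<close>

text \<open>The character of \<open>G\<close> induced from a character \<open>f\<close> of the subgroup \<open>H\<close>, by the usual formula.\<close>

definition induced :: "('g, 'm) monoid_scheme \<Rightarrow> 'g set \<Rightarrow> ('g \<Rightarrow> complex) \<Rightarrow> 'g \<Rightarrow> complex" where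
  "induced G H f x = (1 / of_nat (card H)) *
     (\<Sum>g \<in> {g \<in> carrier G. inv\<^bsub>G\<^esub> g \<otimes>\<^bsub>G\<^esub> x \<otimes>\<^bsub>G\<^esub> g \<in> H}. f (inv\<^bsub>G\<^esub> g \<otimes>\<^bsub>G\<^esub> x \<otimes>\<^bsub>G\<^esub> g))"

definition frobenius ::
  "('g, 'm) monoid_scheme \<Rightarrow> ('g \<Rightarrow> complex) \<Rightarrow> ('g \<Rightarrow> complex) \<Rightarrow> complex" where
  "frobenius G f g = (1 / of_nat (card (carrier G))) * (\<Sum>x\<in>carrier G. f x * cnj (g x))"

definition additive_char :: "('a::field \<Rightarrow> complex) \<Rightarrow> bool" where
  "additive_char \<theta> \<longleftrightarrow> (\<forall>a. \<theta> a \<noteq> 0) \<and> (\<forall>a b. \<theta> (a + b) = \<theta> a * \<theta> b)"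

fun U_root :: "group_type \<Rightarrow> nat \<Rightarrow> root \<Rightarrow> 'a::field mat set" where
  "U_root c n (Diff i j) = {x \<in> U_set c n. \<forall>k. i < k \<and> k < j \<longrightarrow> ent c n x i k = 0}"
| "U_root c n (Plus i j) = {x \<in> U_set c n.
     (\<forall>k. i < k \<and> k \<le> int n \<longrightarrow> ent c n x i k = 0) \<and>
     (\<forall>l. (j < l \<and> l \<le> int n) \<or> (c = O_odd \<and> l = 0) \<longrightarrow> ent c n x j l = 0)}"
| "U_root c n (Twice i) = {x \<in> U_set c n. \<forall>k. i < k \<and> k \<le> int n \<longrightarrow> ent c n x i k = 0}"
| "U_root c n (Single i) = {x \<in> U_set c n. \<forall>k. i < k \<and> k \<le> int n \<longrightarrow> ent c n x i k = 0}"

definition lambda_char ::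
  "group_type \<Rightarrow> nat \<Rightarrow> ('a::field \<Rightarrow> complex) \<Rightarrow> root \<Rightarrow> 'a \<Rightarrow> 'a mat \<Rightarrow> complex" where
  "lambda_char c n \<theta> \<alpha> r x =
     \<theta> (r * ent c n x (fst (pos_entry c n \<alpha>)) (snd (pos_entry c n \<alpha>)))"

definition elem_char ::
  "group_type \<Rightarrow> nat \<Rightarrow> ('a::field \<Rightarrow> complex) \<Rightarrow> root \<Rightarrow> 'a \<Rightarrow> 'a mat \<Rightarrow> complex" where
  "elem_char c n \<theta> \<alpha> r = induced (U_grp c n) (U_root c n \<alpha>) (lambda_char c n \<theta> \<alpha> r)"

definition superchar ::
  "group_type \<Rightarrow> nat \<Rightarrow> ('a::field \<Rightarrow> complex) \<Rightarrow> root set \<Rightarrow> (root \<Rightarrow> 'a) \<Rightarrow> 'a mat \<Rightarrow> complex" where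
  "superchar c n \<theta> D \<phi> x = (\<Prod>\<alpha>\<in>D. elem_char c n \<theta> \<alpha> (\<phi> \<alpha>) x)"

end

theory Submission
  imports Defs "Jordan_Normal_Form.Determinant"
begin

text \<open>Let \<open>V\<close> be the full unitriangular group and \<open>a \<mapsto> a\<^sup>\<dagger>\<close> the adjoint with respect to the form defining
  \<open>G\<close>, so that \<open>U = {x \<in> V. x x\<^sup>\<dagger> = 1}\<close>.  Every double coset \<open>V A V\<close> contains exactly one monomial matrix
  \<open>M\<close>; for \<open>A = x - 1\<close> with \<open>x \<in> U\<close>, uniqueness gives \<open>M\<^sup>\<dagger> = - M\<close>, that is \<open>M = e\<^bsub>D,\<phi>\<^esub>\<close> for a basic pair.
  So the superclasses partition \<open>U\<close>.

  The Cayley transform \<open>x \<mapsto> s\<close> identifies \<open>U\<close> with the space of strictly upper triangular \<open>s\<close> with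
  \<open>s\<^sup>\<dagger> = - s\<close>, and turns the elementary character of \<open>\<alpha>\<close> with positive entry \<open>(i, j)\<close> into a multiple of
  the sum of \<open>\<theta> (2 r (a s b)\<^bsub>i,j\<^esub>)\<close> over all \<open>a, b \<in> V\<close>, with \<open>b = a\<^sup>\<dagger>\<close> if \<open>\<alpha> = 2\<epsilon>\<^sub>i\<close>.  Such a sum is
  invariant under \<open>s \<mapsto> g s g\<^sup>\<dagger>\<close>, and if \<open>x, y \<in> U\<close> lie in one superclass, their Cayley transforms are related in
  this way because elements of \<open>V\<close> have square roots.  Hence supercharacters are constant on superclasses,
  and the sum in the theorem is the scalar product of two supercharacters.

  Expanding the products, a supercharacter is a multiple of a sum of \<open>\<theta> (\<mu> s)\<close> over linear functionals
  \<open>\<mu>\<close>; up to upper triangular matrices each \<open>\<mu>\<close> is given by an element of \<open>V E V\<close> with \<open>E\<close> the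
  transpose of a monomial matrix that determines the basic pair.  Again by uniqueness, distinct basic pairs have no
  functional in common, so their supercharacters are orthogonal.\<close>

section \<open>Unitriangular matrices\<close>

text \<open>The average that defines an induced character runs over \<open>U\<close> only, whereas
  the sums to be compared run over all of \<open>V \<times> V\<close>. The bridge: membership in
  \<open>U\<^sub>\<alpha>\<close> is tested by summing values of \<open>\<theta>\<close> over a set
  \<open>Q\<close> of pairs, and the translates \<open>(a * dag g, g * b)\<close> of
  \<open>Q\<close> under \<open>U\<close> cover \<open>V \<times> V\<close> evenly. For
  \<open>2\<epsilon>\<^sub>i\<close> this breaks down: row \<open>i\<close> of \<open>g\<close> and
  column \<open>-i\<close> of \<open>dag g\<close> carry the same data, so two independent matrices
  cannot both be adjusted, and only \<open>b = dag a\<close> is left. Orthogonality comes from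
  translating the argument, which neither \<open>U\<close> nor the set of all \<open>x - 1\<close>
  permits. With \<open>k = (1 - s)^-1\<close> the Cayley transform \<open>s\<close> satisfies
  \<open>x - 1 = 2 s k\<close>, and the skew part of \<open>x\<close> is
  \<open>2 k s (dag k)\<close>; unitriangular factors are absorbed by \<open>a\<close> and
  \<open>b\<close>, and the 2 in front of \<open>r\<close> is the 2 of these identities. Elements of
  one superclass are related by two unrelated factors, but a functional with
  \<open>b = dag a\<close> only tolerates congruence. Square roots turn the first relation into the
  second.\<close>

lemma unitriD:
  assumes "a \<in> unitri m"
  shows "a \<in> carrier_mat m m" "\<And>i j. j < i \<Longrightarrow> i < m \<Longrightarrow> a $$ (i, j) = 0"
    "\<And>i. i < m \<Longrightarrow> a $$ (i, i) = 1"
  using assms by (auto simp: unitri_def upper_triangular_def)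

lemma unitriI:
  assumes "a \<in> carrier_mat m m" "\<And>i j. j < i \<Longrightarrow> i < m \<Longrightarrow> a $$ (i, j) = 0"
    "\<And>i. i < m \<Longrightarrow> a $$ (i, i) = 1"
  shows "a \<in> unitri m"
  using assms by (auto simp: unitri_def upper_triangular_def)

lemma unitri_carrier [simp]: "a \<in> unitri m \<Longrightarrow> a \<in> carrier_mat m m"
  by (rule unitriD)

lemma unitri_dim [simp]: "a \<in> unitri m \<Longrightarrow> dim_row a = m" "a \<in> unitri m \<Longrightarrow> dim_col a = m"
  by (auto dest: unitriD(1))

lemma mult_mat_entry:
  assumes "A \<in> carrier_mat m k" "B \<in> carrier_mat k l" "i < m" "j < l"
  shows "(A * B) $$ (i, j) = (\<Sum>x<k. A $$ (i, x) * B $$ (x, j))"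
  using assms by (auto simp: scalar_prod_def atLeast0LessThan intro!: sum.cong)

lemma unitri_one [simp]: "1\<^sub>m m \<in> unitri m"
  by (rule unitriI) auto

lemma unitri_mult:
  fixes a b :: "'a::semiring_1 mat"
  assumes a: "a \<in> unitri m" and b: "b \<in> unitri m"
  shows "a * b \<in> unitri m"
proof (rule unitriI)
  show "a * b \<in> carrier_mat m m" using a b by (auto dest!: unitriD(1))
next
  fix i j assume "j < i" "i < m"
  hence "(a * b) $$ (i, j) = (\<Sum>x<m. a $$ (i, x) * b $$ (x, j))"
    using a b by (intro mult_mat_entry[of a m m b m]) auto
  also have "\<dots> = 0"
  proof (rule sum.neutral, clarify)
    fix x assume x: "x < m"
    show "a $$ (i, x) * b $$ (x, j) = 0"
      using unitriD(2)[OF a, of x i] unitriD(2)[OF b, of j x] \<open>j < i\<close> \<open>i < m\<close> x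
      by (cases "x < i") auto
  qed
  finally show "(a * b) $$ (i, j) = 0" .
next
  fix i assume i: "i < m"
  hence "(a * b) $$ (i, i) = (\<Sum>x<m. a $$ (i, x) * b $$ (x, i))"
    using a b by (intro mult_mat_entry[of a m m b m]) auto
  also have "\<dots> = (\<Sum>x\<in>{i}. a $$ (i, x) * b $$ (x, i))"
  proof (rule sum.mono_neutral_right, goal_cases)
    case 3
    show ?case
    proof
      fix x assume "x \<in> {..<m} - {i}"
      thus "a $$ (i, x) * b $$ (x, i) = 0"
        using unitriD(2)[OF a, of x i] unitriD(2)[OF b, of i x] i
        by (cases "x < i") auto
    qed
  qed (use i in auto)
  finally show "(a * b) $$ (i, i) = 1"
    using unitriD(3)[OF a i] unitriD(3)[OF b i] by simp
qed

lemma finite_carrier_mat [simp]: "finite (carrier_mat m k :: 'a::finite mat set)"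
proof (rule finite_subset)
  show "(carrier_mat m k :: 'a mat set) \<subseteq> (\<lambda>f. mat m k f) ` ({..<m} \<times> {..<k} \<rightarrow>\<^sub>E UNIV)"
  proof
    fix A :: "'a mat" assume A: "A \<in> carrier_mat m k"
    have "A = mat m k (restrict (($$) A) ({..<m} \<times> {..<k}))"
      using A by (intro eq_matI) auto
    moreover have "restrict (($$) A) ({..<m} \<times> {..<k}) \<in> {..<m} \<times> {..<k} \<rightarrow>\<^sub>E UNIV" by simp
    ultimately show "A \<in> (\<lambda>f. mat m k f) ` ({..<m} \<times> {..<k} \<rightarrow>\<^sub>E UNIV)" by (rule image_eqI)
  qed
qed (simp add: finite_PiE)

lemma finite_unitri [simp]: "finite (unitri m :: 'a::{finite,zero,one} mat set)"
  by (rule finite_subset[OF _ finite_carrier_mat]) auto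

lemma unitri_mult_inj:
  fixes a :: "'a::field mat"
  assumes "a \<in> unitri m"
  shows "inj_on ((*) a) (carrier_mat m k)"
proof -
  have "det a = 1"
    using assms det_upper_triangular[of a m] unitriD(3)[OF assms]
    by (auto simp: prod_list_diag_prod upper_triangular_def unitriD(2))
  then obtain b where b: "b \<in> carrier_mat m m" "b * a = 1\<^sub>m m"
    using assms det_non_zero_imp_unit[of a m "()"] by (auto simp: Units_def ring_mat_def)
  show ?thesis
  proof (rule inj_onI)
    fix x y assume xy: "x \<in> carrier_mat m k" "y \<in> carrier_mat m k" "a * x = a * y"
    have "(b * a) * x = b * (a * x)" "(b * a) * y = b * (a * y)"
      using xy(1,2) b(1) assms by (auto intro: assoc_mult_mat[of b m m a m _ k])
    thus "x = y" using b xy by simp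
  qed
qed

text \<open>Finiteness replaces back substitution: left multiplication by \<open>a\<close> is
  injective, so it permutes the finite set \<open>unitri m\<close> and attains the identity
  there.\<close>

lemma unitri_inverse:
  fixes a :: "'a::{field,finite} mat"
  assumes a: "a \<in> unitri m"
  obtains b where "b \<in> unitri m" "a * b = 1\<^sub>m m" "b * a = 1\<^sub>m m"
proof -
  have "(*) a ` unitri m = unitri m"
  proof (rule endo_inj_surj)
    show "inj_on ((*) a) (unitri m)"
      by (rule inj_on_subset[OF unitri_mult_inj[OF a, of m]]) auto
  qed (use a unitri_mult in auto)
  then obtain b where b: "b \<in> unitri m" "a * b = 1\<^sub>m m"
    using unitri_one by (metis imageE)
  with that show ?thesis using mat_mult_left_right_inverse[of a m b] a by auto
qed

text \<open>Serves both \<open>(x + y) / 2\<close> in the proof that squaring is injective and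
  \<open>(x + 1) / 2\<close> in the Cayley transform.\<close>

lemma unitri_half_sum:
  fixes a b :: "'a::field mat"
  assumes "(2::'a) \<noteq> 0" "a \<in> unitri m" "b \<in> unitri m"
  shows "(1/2) \<cdot>\<^sub>m (a + b) \<in> unitri m"
  using assms by (auto intro!: unitriI simp: unitriD)

text \<open>Squaring is injective on the powers of \<open>h\<close>. These commute, so
  \<open>x * x = y * y\<close> gives \<open>(x + y) * (x - y) = 0\<close>, and
  \<open>(x + y) / 2\<close> is unitriangular, hence cancellable. An injective map of a finite set
  into itself is onto, so \<open>h\<close> is the square of one of its own powers. That the root is
  a power of \<open>h\<close> matters later: it inherits every relation
  \<open>h * s = s * dag h\<close>.\<close>

lemma unitri_sqrt:
  fixes h :: "'a::{field,finite} mat"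
  assumes two: "(2::'a) \<noteq> 0" and h: "h \<in> unitri m"
  obtains i where "h ^\<^sub>m i * h ^\<^sub>m i = h" "h ^\<^sub>m i \<in> unitri m"
proof -
  define C where "C = range (\<lambda>i. h ^\<^sub>m i)"
  have pow: "h ^\<^sub>m i \<in> unitri m" for i
    by (induction i) (use h in \<open>auto intro: unitri_mult\<close>)
  have add: "h ^\<^sub>m i * h ^\<^sub>m j = h ^\<^sub>m (i + j)" for i j
  proof (induction j)
    case (Suc j)
    have "h ^\<^sub>m i * (h ^\<^sub>m j * h) = h ^\<^sub>m i * h ^\<^sub>m j * h"
      using pow[of i] pow[of j] h by (simp add: assoc_mult_mat[of _ m m _ m _ m])
    thus ?case using Suc by simp
  qed (use h in simp)
  have inj: "inj_on (\<lambda>x. x * x) C"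
  proof (rule inj_onI)
    fix x y assume "x \<in> C" "y \<in> C" and eq: "x * x = y * y"
    then obtain i j where ij: "x = h ^\<^sub>m i" "y = h ^\<^sub>m j" by (auto simp: C_def)
    have xy: "x \<in> unitri m" "y \<in> unitri m" using ij pow by auto
    hence cc: "x \<in> carrier_mat m m" "y \<in> carrier_mat m m" by auto
    have comm: "x * y = y * x" by (simp add: ij add add.commute)
    have "(x + y) * (x - y) = x * (x - y) + y * (x - y)"
      using cc by (intro add_mult_distrib_mat[of _ m m]) auto
    also have "x * (x - y) = x * x - x * y"
      using cc by (auto intro: mult_minus_distrib_mat[of _ m m])
    also have "y * (x - y) = y * x - y * y"
      using cc by (auto intro: mult_minus_distrib_mat[of _ m m])
    also have "x * x - x * y + (y * x - y * y) = 0\<^sub>m m m"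
      unfolding comm eq by (rule eq_matI) (use cc in \<open>auto simp del: index_mult_mat(1)\<close>)
    finally have "((1/2) \<cdot>\<^sub>m (x + y)) * (x - y) = ((1/2) \<cdot>\<^sub>m (x + y)) * 0\<^sub>m m m"
      using cc by (subst mult_smult_assoc_mat[of _ m m _ m]) auto
    hence "x - y = 0\<^sub>m m m"
      using inj_onD[OF unitri_mult_inj[OF unitri_half_sum[OF two xy], of m], of "x - y" "0\<^sub>m m m"] cc
      by (simp add: minus_carrier_mat)
    hence "\<forall>i<m. \<forall>j<m. (x - y) $$ (i, j) = 0" by simp
    thus "x = y" using cc by (intro eq_matI) auto
  qed
  have "(\<lambda>x. x * x) ` C = C"
  proof (rule endo_inj_surj)
    show "finite C"
      using pow by (intro finite_subset[OF _ finite_unitri[of m]]) (auto simp: C_def)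
    show "(\<lambda>x. x * x) ` C \<subseteq> C"
      using add by (force simp: C_def)
  qed (rule inj)
  moreover have "h \<in> C"
    unfolding C_def by (rule range_eqI[of _ _ 1]) (use h in simp)
  ultimately have "h \<in> (\<lambda>x. x * x) ` C" by blast
  then obtain y i where "h = y * y" "y = h ^\<^sub>m i" unfolding C_def by blast
  hence "h ^\<^sub>m i * h ^\<^sub>m i = h" by metis
  thus ?thesis using pow that by blast
qed

section \<open>Block matrices\<close>

lemma sum_lessThan_add: "(\<Sum>x<a + b. f x) = (\<Sum>x<a. f x) + (\<Sum>x<b. f (a + x :: nat) :: 'b::comm_monoid_add)"
  by (induction b) (auto simp: algebra_simps)

lemma upper_block_carrier [simp]:
  "A \<in> carrier_mat n n \<Longrightarrow> D \<in> carrier_mat r r \<Longrightarrow> F \<in> carrier_mat n n \<Longrightarrow>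
   upper_block A B C D E F \<in> carrier_mat (2 * n + r) (2 * n + r)"
  unfolding upper_block_def by (auto intro!: carrier_matI)

lemma upper_block_index:
  assumes "A \<in> carrier_mat n n" "B \<in> carrier_mat n r" "C \<in> carrier_mat n n"
    "D \<in> carrier_mat r r" "E \<in> carrier_mat r n" "F \<in> carrier_mat n n"
    "a < 2 * n + r" "b < 2 * n + r"
  shows "upper_block A B C D E F $$ (a, b) =
    (if a < n then if b < n then A $$ (a, b) else if b < n + r then B $$ (a, b - n) else C $$ (a, b - n - r)
     else if a < n + r then if b < n then 0 else if b < n + r then D $$ (a - n, b - n) else E $$ (a - n, b - n - r)
     else if b < n + r then 0 else F $$ (a - n - r, b - n - r))"
  using assms unfolding upper_block_def append_rows_def
  by (auto simp: not_less)

lemma less_blocks_cases: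
  fixes a n r :: nat
  assumes "a < 2 * n + r"
  obtains "a < n" | x where "a = n + x" "x < r" | x where "a = n + r + x" "x < n"
proof (cases "a < n")
  case False
  show ?thesis
  proof (cases "a < n + r")
    case True
    with False that(2)[of "a - n"] show ?thesis by simp
  next
    case 2: False
    with False that(3)[of "a - n - r"] assms show ?thesis by simp
  qed
qed (use that in blast)

lemma upper_block_mult:
  fixes A :: "'a::ring_1 mat"
  assumes "A \<in> carrier_mat n n" "B \<in> carrier_mat n r" "C \<in> carrier_mat n n"
    "D \<in> carrier_mat r r" "E \<in> carrier_mat r n" "F \<in> carrier_mat n n"
    "A' \<in> carrier_mat n n" "B' \<in> carrier_mat n r" "C' \<in> carrier_mat n n"
    "D' \<in> carrier_mat r r" "E' \<in> carrier_mat r n" "F' \<in> carrier_mat n n"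
  shows "upper_block A B C D E F * upper_block A' B' C' D' E' F' =
    upper_block (A * A') (A * B' + B * D') (A * C' + B * E' + C * F') (D * D') (D * E' + E * F') (F * F')"
    (is "?L * ?R = ?M")
proof (rule eq_matI)
  have c [simp]: "A * A' \<in> carrier_mat n n" "A * B' + B * D' \<in> carrier_mat n r"
    "A * C' + B * E' + C * F' \<in> carrier_mat n n" "D * D' \<in> carrier_mat r r"
    "D * E' + E * F' \<in> carrier_mat r n" "F * F' \<in> carrier_mat n n"
    "A * B' \<in> carrier_mat n r" "B * D' \<in> carrier_mat n r" "A * C' \<in> carrier_mat n n"
    "B * E' \<in> carrier_mat n n" "C * F' \<in> carrier_mat n n" "D * E' \<in> carrier_mat r n" "E * F' \<in> carrier_mat r n"
    using assms by auto
  note [simp] = assms assms[THEN carrier_matD(1)] assms[THEN carrier_matD(2)]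
  have L: "?L \<in> carrier_mat (2 * n + r) (2 * n + r)" and R: "?R \<in> carrier_mat (2 * n + r) (2 * n + r)"
    and M: "?M \<in> carrier_mat (2 * n + r) (2 * n + r)"
    by (rule upper_block_carrier; simp)+
  note ent =
    mult_mat_entry[of A n n A' n]
    mult_mat_entry[of A n n B' r]
    mult_mat_entry[of B n r D' r]
    mult_mat_entry[of A n n C' n]
    mult_mat_entry[of B n r E' n]
    mult_mat_entry[of C n n F' n]
    mult_mat_entry[of D r r D' r]
    mult_mat_entry[of D r r E' n]
    mult_mat_entry[of E r n F' n]
    mult_mat_entry[of F n n F' n]
  fix a b assume "a < dim_row ?M" "b < dim_col ?M"
  hence ab: "a < 2 * n + r" "b < 2 * n + r" using M by auto
  have split: "(\<Sum>x<2 * n + r. f x) = (\<Sum>x<n. f x) + (\<Sum>x<r. f (n + x)) + (\<Sum>x<n. f (n + r + x))" for f :: "nat \<Rightarrow> 'a"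
    using sum_lessThan_add[of f "n + r" n] by (simp add: sum_lessThan_add mult_2 add.commute add.left_commute)
  have "(?L * ?R) $$ (a, b) = (\<Sum>x<2 * n + r. ?L $$ (a, x) * ?R $$ (x, b))"
    by (rule mult_mat_entry[OF L R ab])
  also note split
  also have "(\<Sum>x<n. ?L $$ (a, x) * ?R $$ (x, b)) + (\<Sum>x<r. ?L $$ (a, n + x) * ?R $$ (n + x, b)) +
      (\<Sum>x<n. ?L $$ (a, n + r + x) * ?R $$ (n + r + x, b)) = ?M $$ (a, b)"
    using ab(1)
  proof (cases rule: less_blocks_cases)
    case 1
    show ?thesis using ab(2)
      by (cases rule: less_blocks_cases)
        (use 1 in \<open>auto simp: upper_block_index[of _ n _ r] ent simp del: index_mult_mat(1)\<close>)
  next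
    case (2 y)
    show ?thesis using ab(2)
      by (cases rule: less_blocks_cases)
        (use 2 in \<open>auto simp: upper_block_index[of _ n _ r] ent simp del: index_mult_mat(1)\<close>)
  next
    case (3 y)
    show ?thesis using ab(2)
      by (cases rule: less_blocks_cases)
        (use 3 in \<open>auto simp: upper_block_index[of _ n _ r] ent simp del: index_mult_mat(1)\<close>)
  qed
  finally show "(?L * ?R) $$ (a, b) = ?M $$ (a, b)" .
qed (auto simp: upper_block_def)

lemma upper_block_one: "upper_block (1\<^sub>m n) (0\<^sub>m n r) (0\<^sub>m n n) (1\<^sub>m r) (0\<^sub>m r n) (1\<^sub>m n) = 1\<^sub>m (2 * n + r)"
  by (rule eq_matI, subst upper_block_index[of _ n _ r]) (auto simp: upper_block_def)

lemma upper_block_inject: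
  assumes "A \<in> carrier_mat n n" "B \<in> carrier_mat n r" "C \<in> carrier_mat n n"
    "D \<in> carrier_mat r r" "E \<in> carrier_mat r n" "F \<in> carrier_mat n n"
    "A' \<in> carrier_mat n n" "B' \<in> carrier_mat n r" "C' \<in> carrier_mat n n"
    "D' \<in> carrier_mat r r" "E' \<in> carrier_mat r n" "F' \<in> carrier_mat n n"
  shows "upper_block A B C D E F = upper_block A' B' C' D' E' F' \<longleftrightarrow>
    A = A' \<and> B = B' \<and> C = C' \<and> D = D' \<and> E = E' \<and> F = F'"
proof
  assume *: "upper_block A B C D E F = upper_block A' B' C' D' E' F'"
  have "upper_block A B C D E F $$ (a, b) = upper_block A' B' C' D' E' F' $$ (a, b)" for a b
    using * by simp
  note eq = this[unfolded atomize_all]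
  have ind: "a < 2 * n + r \<Longrightarrow> b < 2 * n + r \<Longrightarrow> 
    (if a < n then if b < n then A $$ (a, b) else if b < n + r then B $$ (a, b - n) else C $$ (a, b - n - r)
     else if a < n + r then if b < n then 0 else if b < n + r then D $$ (a - n, b - n) else E $$ (a - n, b - n - r)
     else if b < n + r then 0 else F $$ (a - n - r, b - n - r)) =
    (if a < n then if b < n then A' $$ (a, b) else if b < n + r then B' $$ (a, b - n) else C' $$ (a, b - n - r)
     else if a < n + r then if b < n then 0 else if b < n + r then D' $$ (a - n, b - n) else E' $$ (a - n, b - n - r)
     else if b < n + r then 0 else F' $$ (a - n - r, b - n - r))" for a b
    using eq[rule_format, of a b] assms by (simp add: upper_block_index[of _ n _ r])
  show "A = A' \<and> B = B' \<and> C = C' \<and> D = D' \<and> E = E' \<and> F = F'"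
  proof (intro conjI; rule eq_matI)
    fix i j assume "i < dim_row A'" "j < dim_col A'"
    thus "A $$ (i, j) = A' $$ (i, j)" using ind[of i j] assms by simp
  next
    fix i j assume "i < dim_row B'" "j < dim_col B'"
    thus "B $$ (i, j) = B' $$ (i, j)" using ind[of i "n + j"] assms by simp
  next
    fix i j assume "i < dim_row C'" "j < dim_col C'"
    thus "C $$ (i, j) = C' $$ (i, j)" using ind[of i "n + r + j"] assms by simp
  next
    fix i j assume "i < dim_row D'" "j < dim_col D'"
    thus "D $$ (i, j) = D' $$ (i, j)" using ind[of "n + i" "n + j"] assms by simp
  next
    fix i j assume "i < dim_row E'" "j < dim_col E'"
    thus "E $$ (i, j) = E' $$ (i, j)" using ind[of "n + i" "n + r + j"] assms by simp
  next
    fix i j assume "i < dim_row F'" "j < dim_col F'"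
    thus "F $$ (i, j) = F' $$ (i, j)" using ind[of "n + r + i" "n + r + j"] assms by simp
  qed (use assms in auto)
qed simp

lemma upper_block_decompose:
  fixes x :: "'a::zero mat"
  assumes x: "x \<in> carrier_mat (2 * n + r) (2 * n + r)" and "upper_triangular x"
  obtains A B C D E F where "A \<in> carrier_mat n n" "B \<in> carrier_mat n r" "C \<in> carrier_mat n n"
    "D \<in> carrier_mat r r" "E \<in> carrier_mat r n" "F \<in> carrier_mat n n"
    "x = upper_block A B C D E F"
proof
  let ?A = "mat n n (\<lambda>(i, j). x $$ (i, j))" and ?B = "mat n r (\<lambda>(i, j). x $$ (i, n + j))"
    and ?C = "mat n n (\<lambda>(i, j). x $$ (i, n + r + j))" and ?D = "mat r r (\<lambda>(i, j). x $$ (n + i, n + j))"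
    and ?E = "mat r n (\<lambda>(i, j). x $$ (n + i, n + r + j))"
    and ?F = "mat n n (\<lambda>(i, j). x $$ (n + r + i, n + r + j))"
  show "x = upper_block ?A ?B ?C ?D ?E ?F"
  proof (rule eq_matI)
    fix i j assume "i < dim_row (upper_block ?A ?B ?C ?D ?E ?F)" "j < dim_col (upper_block ?A ?B ?C ?D ?E ?F)"
    hence ij: "i < 2 * n + r" "j < 2 * n + r" by (auto simp: upper_block_def)
    have z: "j < i \<Longrightarrow> x $$ (i, j) = 0" using assms ij by (auto simp: upper_triangular_def)
    show "x $$ (i, j) = upper_block ?A ?B ?C ?D ?E ?F $$ (i, j)"
      using z ij by (subst upper_block_index[of _ n _ r]) auto
  qed (use x in \<open>auto simp: upper_block_def\<close>)
qed auto

lemma Jmat_carrier [simp]: "Jmat n \<in> carrier_mat n n"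
  by (simp add: Jmat_def)

lemma Jmat_mult_index:
  fixes A :: "'a::semiring_1 mat"
  assumes "A \<in> carrier_mat n k" "i < n" "j < k"
  shows "(Jmat n * A) $$ (i, j) = A $$ (n - 1 - i, j)"
proof -
  have "(Jmat n * A) $$ (i, j) = (\<Sum>x<n. if x = n - 1 - i then A $$ (x, j) else 0)"
    unfolding mult_mat_entry[OF Jmat_carrier assms]
    by (rule sum.cong) (use assms in \<open>auto simp: Jmat_def\<close>)
  thus ?thesis using assms by (simp add: sum.delta)
qed

lemma mult_Jmat_index:
  fixes A :: "'a::semiring_1 mat"
  assumes "A \<in> carrier_mat k n" "i < k" "j < n"
  shows "(A * Jmat n) $$ (i, j) = A $$ (i, n - 1 - j)"
proof -
  have "(A * Jmat n) $$ (i, j) = (\<Sum>x<n. if x = n - 1 - j then A $$ (i, x) else 0)"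
    unfolding mult_mat_entry[OF assms(1) Jmat_carrier assms(2,3)]
    by (rule sum.cong) (use assms in \<open>auto simp: Jmat_def\<close>)
  thus ?thesis using assms by (simp add: sum.delta)
qed

lemma Jmat_Jmat [simp]: "Jmat n * Jmat n = (1\<^sub>m n :: 'a::semiring_1 mat)"
  by (rule eq_matI) (auto simp: Jmat_mult_index[of _ n n] simp del: index_mult_mat(1), auto simp: Jmat_def)

lemma transpose_Jmat [simp]: "transpose_mat (Jmat n) = Jmat n"
  by (rule eq_matI) (auto simp: Jmat_def add.commute)

section \<open>The adjoint and the group\<close>

lemma add_mat_cancel_0:
  fixes A :: "'a::ab_group_add mat"
  assumes "A \<in> carrier_mat k l" "B \<in> carrier_mat k l" "A + B = 0\<^sub>m k l"
  shows "A = - B"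
proof (rule eq_matI)
  fix i j assume "i < dim_row (- B)" "j < dim_col (- B)"
  with assms have "(A + B) $$ (i, j) = 0" "i < k" "j < l" by auto
  with assms(1,2) show "A $$ (i, j) = (- B) $$ (i, j)" by (simp add: eq_neg_iff_add_eq_0)
qed (use assms in auto)

locale unipotent_classical =
  fixes c :: group_type and n m :: nat and \<theta> :: "'a::{field,finite} \<Rightarrow> complex"
  assumes m_def: "m = msize c n"
    and two_neq_0: "(2 :: 'a) \<noteq> 0"
    and additive: "additive_char \<theta>" and nontrivial: "\<exists>a. \<theta> a \<noteq> 1"
begin

lemma m_eq: "m = 2 * n + rk c"
  by (simp add: m_def msize_def)

lemma rk_cases: "rk c = 0 \<and> c \<noteq> O_odd \<or> rk c = 1 \<and> c = O_odd"
  by (auto simp: rk_def)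

text \<open>The nonzero entries of the Gram matrix, which is antidiagonal; for \<open>Sp\<close> the
  form is alternating, whence the opposite signs in the two halves.\<close>

definition eps :: "nat \<Rightarrow> 'a" where
  "eps a = (if c = Sp \<and> n \<le> a then - 1 else 1)"

text \<open>The adjoint of a matrix with respect to the bilinear form defining \<open>G\<close>.\<close>

definition dag :: "'a mat \<Rightarrow> 'a mat" where
  "dag A = mat m m (\<lambda>(a, b). eps a * eps b * A $$ (m - 1 - b, m - 1 - a))"

definition U :: "'a mat set" where "U = U_set c n"

definition V :: "'a mat set" where "V = unitri m"

lemma eps_sq [simp]: "eps a * eps a = 1"
  by (simp add: eps_def)

lemma eps_sq' [simp]: "eps a * (eps a * x) = x"
  by (simp add: eps_def)

text \<open>Reflection exchanges the two halves, so for \<open>Sp\<close> both signs change and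
  their product does not.\<close>

lemma eps_flip:
  assumes "a < m" "b < m"
  shows "eps (m - 1 - a) * eps (m - 1 - b) = eps a * eps b"
  using assms by (auto simp: eps_def m_eq rk_def)

lemma dag_carrier [simp]: "dag A \<in> carrier_mat m m"
  by (simp add: dag_def)

lemma dag_dim [simp]: "dim_row (dag A) = m" "dim_col (dag A) = m"
  by (simp_all add: dag_def)

lemma dag_index: "a < m \<Longrightarrow> b < m \<Longrightarrow> dag A $$ (a, b) = eps a * eps b * A $$ (m - 1 - b, m - 1 - a)"
  by (simp add: dag_def)

lemma dag_dag [simp]:
  assumes "A \<in> carrier_mat m m"
  shows "dag (dag A) = A"
proof (rule eq_matI)
  fix i j assume "i < dim_row A" "j < dim_col A"
  with assms have ij: "i < m" "j < m" by auto
  have "dag (dag A) $$ (i, j) = (eps i * eps j) * (eps (m - 1 - j) * eps (m - 1 - i)) * A $$ (i, j)"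
    using ij by (simp add: dag_index)
  also have "\<dots> = (eps i * eps i) * (eps j * eps j) * A $$ (i, j)"
    unfolding eps_flip[OF ij(2,1)] by (simp only: mult_ac)
  finally show "dag (dag A) $$ (i, j) = A $$ (i, j)" by simp
qed (use assms in auto)

lemma dag_mult:
  assumes "A \<in> carrier_mat m m" "B \<in> carrier_mat m m"
  shows "dag (A * B) = dag B * dag A"
proof (rule eq_matI)
  fix i j assume "i < dim_row (dag B * dag A)" "j < dim_col (dag B * dag A)"
  hence ij: "i < m" "j < m" by auto
  have "dag (A * B) $$ (i, j) = (\<Sum>x<m. eps i * eps j * A $$ (m - 1 - j, x) * B $$ (x, m - 1 - i))"
    using ij by (simp add: dag_index mult_mat_entry[OF assms] sum_distrib_left mult.assoc
        del: index_mult_mat(1))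
  also have "\<dots> = (\<Sum>x<m. dag B $$ (i, x) * dag A $$ (x, j))"
    by (rule sum.reindex_bij_witness[of _ "\<lambda>x. m - 1 - x" "\<lambda>x. m - 1 - x"])
      (use ij in \<open>auto simp: dag_index mult_ac\<close>)
  also have "\<dots> = (dag B * dag A) $$ (i, j)"
    by (rule mult_mat_entry[symmetric]) (use ij in auto)
  finally show "dag (A * B) $$ (i, j) = (dag B * dag A) $$ (i, j)" .
qed auto

lemma dag_one [simp]: "dag (1\<^sub>m m) = 1\<^sub>m m"
  by (rule eq_matI) (auto simp: dag_index)

lemma dag_add: "A \<in> carrier_mat m m \<Longrightarrow> B \<in> carrier_mat m m \<Longrightarrow> dag (A + B) = dag A + dag B"
  by (rule eq_matI) (auto simp: dag_index algebra_simps)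

lemma dag_minus: "A \<in> carrier_mat m m \<Longrightarrow> B \<in> carrier_mat m m \<Longrightarrow> dag (A - B) = dag A - dag B"
  by (rule eq_matI) (auto simp: dag_index algebra_simps)

lemma dag_smult: "A \<in> carrier_mat m m \<Longrightarrow> dag (k \<cdot>\<^sub>m A) = k \<cdot>\<^sub>m dag A"
  by (rule eq_matI) (auto simp: dag_index algebra_simps)

lemma V_carrier [simp]: "a \<in> V \<Longrightarrow> a \<in> carrier_mat m m"
  by (simp add: V_def)

lemma V_one [simp]: "1\<^sub>m m \<in> V"
  by (simp add: V_def)

lemma V_mult [simp]: "a \<in> V \<Longrightarrow> b \<in> V \<Longrightarrow> a * b \<in> V"
  by (simp add: V_def unitri_mult)

lemma V_dag [simp]:
  assumes "a \<in> V"
  shows "dag a \<in> V"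
proof -
  note * = unitriD[OF assms[unfolded V_def]]
  have "eps i * eps i * a $$ (m - 1 - i, m - 1 - i) = 1" if "i < m" for i
    using *(3)[of "m - 1 - i"] that by simp
  thus ?thesis unfolding V_def using * by (intro unitriI) (auto simp: dag_index)
qed

lemma V_inverse:
  assumes "a \<in> V"
  obtains b where "b \<in> V" "a * b = 1\<^sub>m m" "b * a = 1\<^sub>m m"
  using unitri_inverse[of a m] assms unfolding V_def by blast

lemma finite_V [simp]: "finite V"
  by (simp add: V_def)

lemmas assoc = assoc_mult_mat[of _ m m _ m _ m]

definition sg :: 'a where "sg = (if c = Sp then - 1 else 1)"

text \<open>Reflection in the antidiagonal conjugates the outer blocks by \<open>Jmat\<close>; the
  middle block has size at most 1, so nothing is reversed there. Signs can only show up for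
  \<open>Sp\<close>, where the middle blocks are empty, and then only in the corner block, whose
  rows and columns lie in different halves.\<close>

lemma dag_upper_block:
  assumes [simp]: "A \<in> carrier_mat n n" "B \<in> carrier_mat n (rk c)" "C \<in> carrier_mat n n"
    "D \<in> carrier_mat (rk c) (rk c)" "E \<in> carrier_mat (rk c) n" "F \<in> carrier_mat n n"
  shows "dag (upper_block A B C D E F) =
    upper_block (Jmat n * transpose_mat F * Jmat n) (Jmat n * transpose_mat E)
      (sg \<cdot>\<^sub>m (Jmat n * transpose_mat C * Jmat n)) (transpose_mat D)
      (transpose_mat B * Jmat n) (Jmat n * transpose_mat A * Jmat n)" (is "_ = ?M")
proof (rule eq_matI)
  note [simp] = assms[THEN carrier_matD(1)] assms[THEN carrier_matD(2)]
  have [simp]: "dim_row (Jmat n) = n" "dim_col (Jmat n) = n"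
    by (simp_all add: Jmat_def)
  have [simp]: "Jmat n * transpose_mat F \<in> carrier_mat n n" "Jmat n * transpose_mat E \<in> carrier_mat n (rk c)"
    "Jmat n * transpose_mat C \<in> carrier_mat n n" "transpose_mat B * Jmat n \<in> carrier_mat (rk c) n"
    "Jmat n * transpose_mat A \<in> carrier_mat n n"
    by (rule carrier_matI; simp)+
  have [simp]: "Jmat n * transpose_mat F * Jmat n \<in> carrier_mat n n"
    "Jmat n * transpose_mat C * Jmat n \<in> carrier_mat n n"
    "Jmat n * transpose_mat A * Jmat n \<in> carrier_mat n n"
    by (rule carrier_matI; simp)+
  note ent = Jmat_mult_index[of "transpose_mat F" n n] Jmat_mult_index[of "transpose_mat E" n "rk c"]
    Jmat_mult_index[of "transpose_mat C" n n] Jmat_mult_index[of "transpose_mat A" n n]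
    mult_Jmat_index[of "transpose_mat B" "rk c" n]
    mult_Jmat_index[of "Jmat n * transpose_mat F" n n] mult_Jmat_index[of "Jmat n * transpose_mat C" n n]
    mult_Jmat_index[of "Jmat n * transpose_mat A" n n]
  have M: "?M \<in> carrier_mat (2 * n + rk c) (2 * n + rk c)"
    by (rule upper_block_carrier) auto
  fix a b assume "a < dim_row ?M" "b < dim_col ?M"
  hence ab: "a < 2 * n + rk c" "b < 2 * n + rk c" using M by auto
  have rk1: "x = 0 \<and> c = O_odd \<and> rk c = Suc 0" if "x < rk c" for x using that rk_cases by auto
  have "dag (upper_block A B C D E F) $$ (a, b) = eps a * eps b * upper_block A B C D E F $$ (m - 1 - b, m - 1 - a)"
    by (rule dag_index) (use ab m_eq in auto)
  also have "\<dots> = ?M $$ (a, b)"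
    using ab(1)
  proof (cases rule: less_blocks_cases)
    case 1
    show ?thesis using ab(2)
      by (cases rule: less_blocks_cases)
        (use 1 in \<open>auto dest!: rk1 simp: upper_block_index[of _ n _ "rk c"] m_eq ent eps_def sg_def simp del: index_mult_mat(1)\<close>)
  next
    case (2 y)
    show ?thesis using ab(2)
      by (cases rule: less_blocks_cases)
        (use 2 in \<open>auto dest!: rk1 simp: upper_block_index[of _ n _ "rk c"] m_eq ent eps_def sg_def simp del: index_mult_mat(1)\<close>)
  next
    case (3 y)
    show ?thesis using ab(2)
      by (cases rule: less_blocks_cases)
        (use 3 in \<open>auto dest!: rk1 simp: upper_block_index[of _ n _ "rk c"] m_eq ent eps_def sg_def simp del: index_mult_mat(1)\<close>)
  qed
  finally show "dag (upper_block A B C D E F) $$ (a, b) = ?M $$ (a, b)" .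
qed (use assms[THEN carrier_matD(1)] assms[THEN carrier_matD(2)] in \<open>auto simp: upper_block_def Jmat_def trans[OF dag_dim(1) m_eq] trans[OF dag_dim(2) m_eq] simp del: dag_dim\<close>)

end

section \<open>Matrix algebra under dimension side conditions\<close>

lemma mat_carrier_iff: "A \<in> carrier_mat k l \<longleftrightarrow> dim_row A = k \<and> dim_col A = l"
  by auto

text \<open>The premise of \<open>carrier_matD\<close> contains a dimension that its conclusion does not determine, and the
  simplifier cannot guess it.\<close>

declare carrier_matD [simp del] mat_carrier_iff [simp]

lemma mat_assoc:
  "dim_col A = dim_row B \<Longrightarrow> dim_col B = dim_row C \<Longrightarrow> A * B * C = A * (B * C :: 'a::semiring_0 mat)"
  by (rule assoc_mult_mat[of _ "dim_row A" "dim_row B" _ "dim_row C" _ "dim_col C"]) auto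

lemma mat_distrib_right:
  "dim_row A = dim_row B \<Longrightarrow> dim_col A = dim_col B \<Longrightarrow> dim_col B = dim_row C \<Longrightarrow>
   (A + B) * C = A * C + B * (C :: 'a::semiring_0 mat)"
  by (rule add_mult_distrib_mat[of _ "dim_row B" "dim_row C" _ _ "dim_col C"]) auto

lemma mat_distrib_left:
  "dim_row B = dim_row C \<Longrightarrow> dim_col B = dim_col C \<Longrightarrow> dim_col A = dim_row C \<Longrightarrow>
   A * (B + C) = A * B + A * (C :: 'a::semiring_0 mat)"
  by (rule mult_add_distrib_mat[of _ "dim_row A" "dim_row C" _ "dim_col C"]) auto

lemma mat_diff_distrib_right:
  "dim_row A = dim_row B \<Longrightarrow> dim_col A = dim_col B \<Longrightarrow> dim_col B = dim_row C \<Longrightarrow>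
   (A - B) * C = A * C - B * (C :: 'a::ring mat)"
  by (rule minus_mult_distrib_mat[of _ "dim_row B" "dim_row C" _ _ "dim_col C"]) auto

lemma mat_diff_distrib_left:
  "dim_row B = dim_row C \<Longrightarrow> dim_col B = dim_col C \<Longrightarrow> dim_col A = dim_row C \<Longrightarrow>
   A * (B - C) = A * B - A * (C :: 'a::ring mat)"
  by (rule mult_minus_distrib_mat[of _ "dim_row A" "dim_row C" _ "dim_col C"]) auto

lemma mat_smult_left: "dim_col A = dim_row B \<Longrightarrow> (k \<cdot>\<^sub>m A) * B = k \<cdot>\<^sub>m (A * B :: 'a::comm_semiring_0 mat)"
  by (rule mult_smult_assoc_mat[of _ "dim_row A" "dim_row B" _ "dim_col B"]) auto

lemma mat_smult_right: "dim_col A = dim_row B \<Longrightarrow> A * (k \<cdot>\<^sub>m B) = k \<cdot>\<^sub>m (A * B :: 'a::comm_semiring_0 mat)"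
  by (rule mult_smult_distrib[of _ "dim_row A" "dim_row B" _ "dim_col B"]) auto

lemma mat_transpose_mult:
  "dim_col A = dim_row B \<Longrightarrow> transpose_mat (A * B) = transpose_mat B * transpose_mat (A :: 'a::comm_semiring_0 mat)"
  by (rule transpose_mult[of _ "dim_row A" "dim_row B" _ "dim_col B"]) auto

lemma transpose_uminus_mat: "transpose_mat (- A) = - transpose_mat A"
  by (rule eq_matI) auto

lemma mat_add_uminus_self: "A + - A = 0\<^sub>m (dim_row A) (dim_col (A :: 'a::ab_group_add mat))"
  by (rule eq_matI) auto

lemma transpose_smult_mat: "transpose_mat (k \<cdot>\<^sub>m A) = k \<cdot>\<^sub>m transpose_mat A"
  by (rule eq_matI) auto

lemmas mat_alg = mat_distrib_right mat_distrib_left mat_diff_distrib_right mat_diff_distrib_left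
  mat_smult_left mat_smult_right mat_assoc

lemma Jmat_dim [simp]: "dim_row (Jmat n) = n" "dim_col (Jmat n) = n"
  by (simp_all add: Jmat_def)

lemma Jmat_Jmat_mult [simp]: "dim_row A = n \<Longrightarrow> Jmat n * (Jmat n * A) = (A :: 'a::semiring_1 mat)"
  by (simp flip: mat_assoc)

lemma upper_block_unitri:
  fixes A :: "'a::semiring_1 mat"
  assumes A: "A \<in> unitri n" and D: "D \<in> unitri r" and F: "F \<in> unitri n"
    and "B \<in> carrier_mat n r" "C \<in> carrier_mat n n" "E \<in> carrier_mat r n"
  shows "upper_block A B C D E F \<in> unitri (2 * n + r)"
proof (rule unitriI)
  show "upper_block A B C D E F \<in> carrier_mat (2 * n + r) (2 * n + r)"
    by (rule upper_block_carrier) (intro unitri_carrier assms)+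
  fix i assume i: "i < 2 * n + r"
  note ix = upper_block_index[OF unitri_carrier[OF A] assms(4,5) unitri_carrier[OF D] assms(6) unitri_carrier[OF F]]
  show "upper_block A B C D E F $$ (i, i) = 1"
    using i unitriD(3)[OF A, of i] unitriD(3)[OF D, of "i - n"] unitriD(3)[OF F, of "i - n - r"]
    by (auto simp: ix)
  fix j assume "j < i"
  thus "upper_block A B C D E F $$ (i, j) = 0"
    using i unitriD(2)[OF A, of j i] unitriD(2)[OF D, of "j - n" "i - n"]
      unitriD(2)[OF F, of "j - n - r" "i - n - r"]
    by (auto simp: ix)
qed

lemma upper_block_unitriD:
  fixes A :: "'a::semiring_1 mat"
  assumes z: "upper_block A B C D E F \<in> unitri (2 * n + r)"
    and car: "A \<in> carrier_mat n n" "B \<in> carrier_mat n r" "C \<in> carrier_mat n n"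
      "D \<in> carrier_mat r r" "E \<in> carrier_mat r n" "F \<in> carrier_mat n n"
  shows "A \<in> unitri n" "D \<in> unitri r"
proof -
  note ix = upper_block_index[OF car]
  show "A \<in> unitri n"
  proof (rule unitriI[OF car(1)])
    fix i assume "i < n"
    thus "A $$ (i, i) = 1" using unitriD(3)[OF z, of i] by (simp add: ix)
  next
    fix i j assume "j < i" "i < n"
    thus "A $$ (i, j) = 0" using unitriD(2)[OF z, of j i] by (simp add: ix)
  qed
  show "D \<in> unitri r"
  proof (rule unitriI[OF car(4)])
    fix i assume "i < r"
    thus "D $$ (i, i) = 1" using unitriD(3)[OF z, of "n + i"] by (simp add: ix)
  next
    fix i j assume "j < i" "i < r"
    thus "D $$ (i, j) = 0" using unitriD(2)[OF z, of "n + j" "n + i"] by (simp add: ix)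
  qed
qed

lemma Jmat_transpose_unitri:
  fixes y :: "'a::semiring_1 mat"
  assumes y: "y \<in> unitri n"
  shows "Jmat n * transpose_mat y * Jmat n \<in> unitri n"
proof -
  have ent: "(Jmat n * transpose_mat y * Jmat n) $$ (i, j) = y $$ (n - 1 - j, n - 1 - i)"
    if "i < n" "j < n" for i j
    using that unitri_carrier[OF y]
    by (simp add: mult_Jmat_index[of _ n n] Jmat_mult_index[of _ n n] del: index_mult_mat(1))
  show ?thesis
  proof (rule unitriI)
    fix i j assume "j < i" "i < n"
    thus "(Jmat n * transpose_mat y * Jmat n) $$ (i, j) = 0"
      by (subst ent) (auto intro: unitriD(2)[OF y])
  next
    fix i assume "i < n"
    thus "(Jmat n * transpose_mat y * Jmat n) $$ (i, i) = 1"
      by (subst ent) (auto intro: unitriD(3)[OF y])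
  qed (use unitri_carrier[OF y] in simp)
qed

lemma mat_eq_cong:
  assumes "A \<in> carrier_mat k l" "B \<in> carrier_mat k l" "C \<in> carrier_mat k l" "D \<in> carrier_mat k l"
    and "\<And>i j. i < k \<Longrightarrow> j < l \<Longrightarrow> A $$ (i, j) = B $$ (i, j) \<longleftrightarrow> C $$ (i, j) = D $$ (i, j)"
  shows "A = B \<longleftrightarrow> C = D"
  using assms by (simp add: mat_eq_iff)

lemma mat_inverse_mult:
  "A * B = 1\<^sub>m k \<Longrightarrow> dim_col A = dim_row B \<Longrightarrow> dim_row C = k \<Longrightarrow> dim_col B = k \<Longrightarrow> A * (B * C) = (C :: 'a::semiring_1 mat)"
  by (simp flip: mat_assoc)

context unipotent_classical
begin

text \<open>One equation covers the three groups: without a middle block \<open>v\<close> has no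
  columns and \<open>v * transpose_mat v\<close> vanishes, and for \<open>Sp\<close> the original
  equation is negated.\<close>

lemma params_iff:
  "(x, v, w) \<in> params c n \<longleftrightarrow> x \<in> unitri n \<and> v \<in> carrier_mat n (rk c) \<and> w \<in> carrier_mat n n \<and>
     sg \<cdot>\<^sub>m (Jmat n * transpose_mat w) + v * transpose_mat v + w * Jmat n = 0\<^sub>m n n"
proof -
  have "(case c of
        Sp \<Rightarrow> Jmat n * transpose_mat w - w * Jmat n = 0\<^sub>m n n
      | O_even \<Rightarrow> Jmat n * transpose_mat w + w * Jmat n = 0\<^sub>m n n
      | O_odd \<Rightarrow> Jmat n * transpose_mat w + w * Jmat n = - (v * transpose_mat v)) \<longleftrightarrow>
     sg \<cdot>\<^sub>m (Jmat n * transpose_mat w) + v * transpose_mat v + w * Jmat n = 0\<^sub>m n n"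
    if v: "v \<in> carrier_mat n (rk c)" and w: "w \<in> carrier_mat n n"
  proof -
    let ?P = "Jmat n * transpose_mat w" and ?Q = "v * transpose_mat v" and ?R = "w * Jmat n"
    have dims: "dim_row v = n" "dim_col v = rk c" "dim_row w = n" "dim_col w = n" using v w by auto
    have Q0: "?Q = 0\<^sub>m n n" if "rk c = 0"
      using v that by (intro eq_matI) (auto simp: scalar_prod_def)
    have P: "?P \<in> carrier_mat n n" "?R \<in> carrier_mat n n" "?Q \<in> carrier_mat n n"
      using dims by auto
    show ?thesis
    proof (cases c)
      case Sp
      have "?P - ?R = 0\<^sub>m n n \<longleftrightarrow> - 1 \<cdot>\<^sub>m ?P + 0\<^sub>m n n + ?R = 0\<^sub>m n n"
        using P by (intro mat_eq_cong) (auto simp del: index_mult_mat(1))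
      moreover have "sg = - 1" "?Q = 0\<^sub>m n n" using Q0 Sp unfolding sg_def rk_def by simp_all
      ultimately show ?thesis by (simp only: Sp group_type.case)
    next
      case O_even
      have "?P + ?R = 0\<^sub>m n n \<longleftrightarrow> 1 \<cdot>\<^sub>m ?P + 0\<^sub>m n n + ?R = 0\<^sub>m n n"
        using P by (intro mat_eq_cong) (auto simp del: index_mult_mat(1))
      moreover have "sg = 1" "?Q = 0\<^sub>m n n" using Q0 O_even unfolding sg_def rk_def by simp_all
      ultimately show ?thesis by (simp only: O_even group_type.case)
    next
      case O_odd
      have "?P + ?R = - ?Q \<longleftrightarrow> 1 \<cdot>\<^sub>m ?P + ?Q + ?R = 0\<^sub>m n n"
        using P by (intro mat_eq_cong) (auto simp: eq_neg_iff_add_eq_0 add_ac simp del: index_mult_mat(1))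
      moreover have "sg = 1" using O_odd unfolding sg_def by simp
      ultimately show ?thesis by (simp only: O_odd group_type.case)
    qed
  qed
  thus ?thesis by (auto simp: params_def)
qed

lemma inverse_the:
  assumes x: "x \<in> unitri n"
  obtains y where "the (mat_inverse x) = (y::'a mat)" "y \<in> unitri n" "x * y = 1\<^sub>m n" "y * x = 1\<^sub>m n"
proof -
  obtain y where y: "y \<in> unitri n" "x * y = 1\<^sub>m n" "y * x = 1\<^sub>m n"
    using unitri_inverse[OF x] .
  have xc: "x \<in> carrier_mat n n" using x by simp
  obtain z where z: "mat_inverse x = Some z"
    using mat_inverse(1)[OF xc] y x unitri_carrier[OF y(1)] by (cases "mat_inverse x") (auto simp: Units_def ring_mat_def)
  have dims: "dim_row z = n" "dim_row y = n" "dim_col y = n" "dim_row x = n" "dim_col x = n"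
    using mat_inverse(2)[OF xc z] unitri_carrier[OF y(1)] xc by auto
  hence "z = (y * x) * z" using y(3) by simp
  also have "\<dots> = y * (x * z)" using dims by (intro mat_assoc) auto
  also have "\<dots> = y" using mat_inverse(2)[OF xc z] dims by simp
  finally show ?thesis using that[of y] z y by simp
qed

lemma upper_block_times_dag:
  fixes A B C D E F :: "'a mat"
  assumes "A \<in> carrier_mat n n" "B \<in> carrier_mat n (rk c)" "C \<in> carrier_mat n n"
    "D \<in> carrier_mat (rk c) (rk c)" "E \<in> carrier_mat (rk c) n" "F \<in> carrier_mat n n"
  shows "upper_block A B C D E F * dag (upper_block A B C D E F) =
    upper_block (A * (Jmat n * transpose_mat F * Jmat n)) (A * (Jmat n * transpose_mat E) + B * transpose_mat D)
      (A * (sg \<cdot>\<^sub>m (Jmat n * transpose_mat C * Jmat n)) + B * (transpose_mat B * Jmat n) + C * (Jmat n * transpose_mat A * Jmat n))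
      (D * transpose_mat D) (D * (transpose_mat B * Jmat n) + E * (Jmat n * transpose_mat A * Jmat n))
      (F * (Jmat n * transpose_mat A * Jmat n))"
  unfolding dag_upper_block[OF assms]
  by (rule upper_block_mult) (use assms in auto)

lemma middle_unitri:
  "D \<in> carrier_mat (rk c) (rk c) \<Longrightarrow> (\<And>i. i < rk c \<Longrightarrow> D $$ (i, i) = 1) \<Longrightarrow> D = 1\<^sub>m (rk c)"
  using rk_cases by (intro eq_matI) auto

text \<open>The three families of block matrices become the solutions of a single equation, which
  yields the group laws and lets \<open>dag x\<close> serve as the inverse of \<open>x\<close> from
  here on. In blocks, the corner of \<open>x * dag x\<close> is the condition of
  \<open>params\<close> with \<open>x\<close> in front and \<open>transpose_mat x * Jmat n\<close>
  behind, and the remaining blocks fix the middle and lower right blocks of \<open>U_elt\<close>.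
  Conversely, \<open>v\<close> and \<open>w\<close> are recovered from the top row by dividing by
  \<open>x\<close>.\<close>

lemma U_set_eq: "U = {x \<in> V. x * dag x = 1\<^sub>m m}"
proof (intro equalityI subsetI)
  fix z assume "z \<in> U"
  then obtain x v w where z: "z = U_elt c n x v w" and p: "(x, v, w) \<in> params c n"
    by (auto simp: U_def U_set_def)
  have x: "x \<in> unitri n" and v: "v \<in> carrier_mat n (rk c)" and w: "w \<in> carrier_mat n n"
    and eq: "sg \<cdot>\<^sub>m (Jmat n * transpose_mat w) + v * transpose_mat v + w * Jmat n = 0\<^sub>m n n"
    using p by (auto simp: params_iff)
  obtain y where y: "the (mat_inverse x) = y" "y \<in> unitri n" "x * y = 1\<^sub>m n" "y * x = 1\<^sub>m n"
    using inverse_the[OF x] .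
  let ?J = "Jmat n :: 'a mat"
  let ?F = "?J * transpose_mat y * ?J" and ?E = "- (transpose_mat v * ?J)"
  have dims [simp]: "dim_row x = n" "dim_col x = n" "dim_row y = n" "dim_col y = n"
    "dim_row v = n" "dim_col v = rk c" "dim_row w = n" "dim_col w = n"
    using unitri_carrier[OF x] unitri_carrier[OF y(2)] v w by auto
  have zb: "z = upper_block x (x * v) (x * w) (1\<^sub>m (rk c)) ?E ?F"
    by (simp add: z U_elt_def y(1))
  have yT: "transpose_mat y * (transpose_mat x * A) = A" if "dim_row A = n" for A
    using y(3) that by (simp flip: mat_transpose_mult mat_assoc)
  note xy = mat_inverse_mult[OF y(3)]
  have "z * dag z = upper_block (1\<^sub>m n) (0\<^sub>m n (rk c)) (0\<^sub>m n n) (1\<^sub>m (rk c)) (0\<^sub>m (rk c) n) (1\<^sub>m n)"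
    unfolding zb
  proof (subst upper_block_times_dag)
    have "x * (sg \<cdot>\<^sub>m (?J * transpose_mat (x * w) * ?J)) + x * v * (transpose_mat (x * v) * ?J)
        + x * w * (?J * transpose_mat x * ?J) =
        x * ((sg \<cdot>\<^sub>m (?J * transpose_mat w) + v * transpose_mat v + w * ?J) * (transpose_mat x * ?J))"
      by (simp add: mat_alg mat_transpose_mult)
    also have "\<dots> = 0\<^sub>m n n" unfolding eq by simp
    finally show "upper_block (x * (?J * transpose_mat ?F * ?J)) (x * (?J * transpose_mat ?E) + x * v * transpose_mat (1\<^sub>m (rk c)))
      (x * (sg \<cdot>\<^sub>m (?J * transpose_mat (x * w) * ?J)) + x * v * (transpose_mat (x * v) * ?J) + x * w * (?J * transpose_mat x * ?J))
      (1\<^sub>m (rk c) * transpose_mat (1\<^sub>m (rk c))) (1\<^sub>m (rk c) * (transpose_mat (x * v) * ?J) + ?E * (?J * transpose_mat x * ?J))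
      (?F * (?J * transpose_mat x * ?J)) =
      upper_block (1\<^sub>m n) (0\<^sub>m n (rk c)) (0\<^sub>m n n) (1\<^sub>m (rk c)) (0\<^sub>m (rk c) n) (1\<^sub>m n)"
      using y(3,4) yT by (simp add: mat_alg mat_transpose_mult transpose_uminus_mat mat_add_uminus_self)
  qed auto
  hence 1: "z * dag z = 1\<^sub>m m" by (simp add: upper_block_one m_eq)
  have "z \<in> unitri (2 * n + rk c)" unfolding zb
    by (rule upper_block_unitri) (use x Jmat_transpose_unitri[OF y(2)] in auto)
  hence "z \<in> V" by (simp add: V_def flip: m_eq)
  with 1 show "z \<in> {x \<in> V. x * dag x = 1\<^sub>m m}" by simp
next
  fix z assume "z \<in> {x \<in> V. x * dag x = 1\<^sub>m m}"
  hence z: "z \<in> unitri (2 * n + rk c)" and zz: "z * dag z = 1\<^sub>m m" by (auto simp: V_def simp flip: m_eq)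
  have zc: "z \<in> carrier_mat (2 * n + rk c) (2 * n + rk c)" using unitri_carrier[OF z] .
  have "upper_triangular z" using z unitriD(2)[OF z] zc by (auto simp: upper_triangular_def)
  from upper_block_decompose[OF zc this] obtain A B C D E F where
    car: "A \<in> carrier_mat n n" "B \<in> carrier_mat n (rk c)" "C \<in> carrier_mat n n"
    "D \<in> carrier_mat (rk c) (rk c)" "E \<in> carrier_mat (rk c) n" "F \<in> carrier_mat n n"
    and zb: "z = upper_block A B C D E F" by metis
  have A: "A \<in> unitri n" and "D \<in> unitri (rk c)"
    using upper_block_unitriD[OF z[unfolded zb] car] .
  hence D: "D = 1\<^sub>m (rk c)" using middle_unitri[OF car(4)] unitriD(3) by blast
  obtain y where y: "the (mat_inverse A) = y" "y \<in> unitri n" "A * y = 1\<^sub>m n" "y * A = 1\<^sub>m n"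
    using inverse_the[OF A] .
  have dims [simp]: "dim_row A = n" "dim_col A = n" "dim_row y = n" "dim_col y = n"
    "dim_row B = n" "dim_col B = rk c" "dim_row C = n" "dim_col C = n" "dim_row E = rk c"
    "dim_col E = n" "dim_row F = n" "dim_col F = n"
    using car unitri_carrier[OF y(2)] by auto
  let ?J = "Jmat n :: 'a mat"
  have "upper_block (A * (?J * transpose_mat F * ?J)) (A * (?J * transpose_mat E) + B * transpose_mat D)
      (A * (sg \<cdot>\<^sub>m (?J * transpose_mat C * ?J)) + B * (transpose_mat B * ?J) + C * (?J * transpose_mat A * ?J))
      (D * transpose_mat D) (D * (transpose_mat B * ?J) + E * (?J * transpose_mat A * ?J))
      (F * (?J * transpose_mat A * ?J)) =
      upper_block (1\<^sub>m n) (0\<^sub>m n (rk c)) (0\<^sub>m n n) (1\<^sub>m (rk c)) (0\<^sub>m (rk c) n) (1\<^sub>m n)"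
    using zz[unfolded zb upper_block_times_dag[OF car]] by (simp add: upper_block_one m_eq)
  hence e3: "A * (sg \<cdot>\<^sub>m (?J * transpose_mat C * ?J)) + B * (transpose_mat B * ?J) + C * (?J * transpose_mat A * ?J) = 0\<^sub>m n n"
    and e5: "D * (transpose_mat B * ?J) + E * (?J * transpose_mat A * ?J) = 0\<^sub>m (rk c) n"
    and e6: "F * (?J * transpose_mat A * ?J) = 1\<^sub>m n"
    by (subst (asm) upper_block_inject[of _ n _ "rk c"]; simp add: D)+
  have yT: "transpose_mat A * (transpose_mat y * M) = M" if "dim_row M = n" for M
    using y(4) that by (simp flip: mat_transpose_mult mat_assoc)
  have yT': "transpose_mat A * transpose_mat y = 1\<^sub>m n"
    using y(4) by (simp flip: mat_transpose_mult)
  note yA = mat_inverse_mult[OF y(4)]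
  have "F = F * (?J * transpose_mat A * ?J) * (?J * transpose_mat y * ?J)"
    by (simp add: mat_assoc yT)
  hence F: "F = ?J * transpose_mat y * ?J" unfolding e6 by simp
  have "E * (?J * transpose_mat A * ?J) = - (transpose_mat B * ?J)"
    using e5 by (intro add_mat_cancel_0[of _ "rk c" n]) (auto simp: D comm_add_mat[of _ "rk c" n])
  hence "E * (?J * transpose_mat A * ?J) * (?J * transpose_mat y * ?J) = - (transpose_mat B * ?J) * (?J * transpose_mat y * ?J)"
    by simp
  hence E: "E = - (transpose_mat (y * B) * ?J)"
    by (simp add: mat_assoc yT mat_transpose_mult)
  \<comment> \<open>\<open>y\<close> and \<open>?J * transpose_mat y\<close> are the inverses of the
    two factors \<open>A\<close> and \<open>transpose_mat A * ?J\<close> that surround the condition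
    of \<open>params\<close> in the corner block.\<close>
  have "y * (A * (sg \<cdot>\<^sub>m (?J * transpose_mat C * ?J)) + B * (transpose_mat B * ?J) + C * (?J * transpose_mat A * ?J)) * (?J * transpose_mat y)
     = sg \<cdot>\<^sub>m (?J * transpose_mat (y * C)) + (y * B) * transpose_mat (y * B) + (y * C) * ?J"
    by (simp add: mat_alg yT yT' yA mat_transpose_mult)
  hence "(A, y * B, y * C) \<in> params c n"
    unfolding e3 using A by (auto simp: params_iff)
  moreover have "z = U_elt c n A (y * B) (y * C)"
    unfolding zb U_elt_def y(1) by (simp add: mat_inverse_mult[OF y(3)] D E F)
  ultimately show "z \<in> U" unfolding U_def U_set_def by blast
qed

end

section \<open>Monomial matrices\<close>

text \<open>Only the rows from \<open>k\<close> on are constrained, since elimination works upwards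
  from the bottom row while \<open>k\<close> decreases to 0.\<close>

definition monomial_from :: "nat \<Rightarrow> nat \<Rightarrow> 'a::zero mat \<Rightarrow> bool" where
  "monomial_from m k M \<longleftrightarrow> (\<forall>i\<in>{k..<m}. \<forall>j<m. \<forall>l<m. M $$ (i, j) \<noteq> 0 \<longrightarrow> M $$ (i, l) \<noteq> 0 \<longrightarrow> j = l) \<and>
     (\<forall>i\<in>{k..<m}. \<forall>i'\<in>{k..<m}. \<forall>j<m. M $$ (i, j) \<noteq> 0 \<longrightarrow> M $$ (i', j) \<noteq> 0 \<longrightarrow> i = i')"

abbreviation monomial :: "nat \<Rightarrow> 'a::zero mat \<Rightarrow> bool" where
  "monomial m \<equiv> monomial_from m 0"

lemma monomial_rowD:
  "monomial_from m k M \<Longrightarrow> M $$ (i, j) \<noteq> 0 \<Longrightarrow> M $$ (i, l) \<noteq> 0 \<Longrightarrow> k \<le> i \<Longrightarrow> i < m \<Longrightarrow> j < m \<Longrightarrow> l < m \<Longrightarrow> j = l"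
  unfolding monomial_from_def by auto

lemma monomial_colD:
  "monomial_from m k M \<Longrightarrow> M $$ (i, j) \<noteq> 0 \<Longrightarrow> M $$ (i', j) \<noteq> 0 \<Longrightarrow> k \<le> i \<Longrightarrow> k \<le> i' \<Longrightarrow> i < m \<Longrightarrow> i' < m \<Longrightarrow> j < m \<Longrightarrow> i = i'"
  unfolding monomial_from_def by auto

lemma monomial_fromI:
  assumes "\<And>i j l. k \<le> i \<Longrightarrow> i < m \<Longrightarrow> j < m \<Longrightarrow> l < m \<Longrightarrow> M $$ (i, j) \<noteq> 0 \<Longrightarrow> M $$ (i, l) \<noteq> 0 \<Longrightarrow> j = l"
    and "\<And>i i' j. k \<le> i \<Longrightarrow> i < m \<Longrightarrow> k \<le> i' \<Longrightarrow> i' < m \<Longrightarrow> j < m \<Longrightarrow> M $$ (i, j) \<noteq> 0 \<Longrightarrow> M $$ (i', j) \<noteq> 0 \<Longrightarrow> i = i'"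
  shows "monomial_from m k M"
  unfolding monomial_from_def by (auto intro: assms)

text \<open>Left multiplication by a unitriangular matrix adds to an entry multiples of entries
  below it, right multiplication multiples of entries to its left. On such a region equations
  between matrices therefore survive unitriangular factors, even if nothing is known outside. The
  regions used are the whole square, the part on and below the diagonal, and the part strictly below
  it.\<close>

definition lower_closed :: "(nat \<Rightarrow> nat \<Rightarrow> bool) \<Rightarrow> bool" where
  "lower_closed R \<longleftrightarrow> (\<forall>i j i' j'. R i j \<longrightarrow> i \<le> i' \<longrightarrow> j' \<le> j \<longrightarrow> R i' j')"

lemma lower_closedD: "lower_closed R \<Longrightarrow> R i j \<Longrightarrow> i \<le> i' \<Longrightarrow> j' \<le> j \<Longrightarrow> R i' j'"
  unfolding lower_closed_def by blast

lemma lower_closed_mult_right: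
  fixes N :: "'a::semiring_1 mat"
  assumes R: "lower_closed R" and N: "N \<in> carrier_mat m m" and b: "b \<in> unitri m"
    and z: "\<And>i j. i < m \<Longrightarrow> j < m \<Longrightarrow> R i j \<Longrightarrow> N $$ (i, j) = 0"
    and ij: "i < m" "j < m" "R i j"
  shows "(N * b) $$ (i, j) = 0"
  unfolding mult_mat_entry[OF N unitri_carrier[OF b] ij(1,2)]
proof (rule sum.neutral, clarify)
  fix x assume x: "x < m"
  show "N $$ (i, x) * b $$ (x, j) = 0"
    using z[OF ij(1) x] lower_closedD[OF R ij(3), of i x] unitriD(2)[OF b, of j x] x
    by (cases "x \<le> j") auto
qed

lemma lower_closed_mult_left:
  fixes N :: "'a::semiring_1 mat"
  assumes R: "lower_closed R" and N: "N \<in> carrier_mat m m" and b: "b \<in> unitri m"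
    and z: "\<And>i j. i < m \<Longrightarrow> j < m \<Longrightarrow> R i j \<Longrightarrow> N $$ (i, j) = 0"
    and ij: "i < m" "j < m" "R i j"
  shows "(b * N) $$ (i, j) = 0"
  unfolding mult_mat_entry[OF unitri_carrier[OF b] N ij(1,2)]
proof (rule sum.neutral, clarify)
  fix x assume x: "x < m"
  show "b $$ (i, x) * N $$ (x, j) = 0"
    using z[OF x ij(2)] lower_closedD[OF R ij(3), of x j] unitriD(2)[OF b, of x i] ij
    by (cases "i \<le> x") auto
qed

text \<open>In column \<open>j\<close> of \<open>E1\<close> only row \<open>i\<close> is occupied,
  so \<open>(a * E1) $$ (i, j)\<close> is the entry of \<open>E1\<close> itself. On the other side
  \<open>(E2 * b) $$ (i, j)\<close> collects entries of row \<open>i\<close> of \<open>E2\<close> up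
  to column \<open>j\<close>, at most one of them nonzero: it stands at \<open>j\<close>, or further
  left.\<close>

lemma monomial_unique_aux:
  fixes E1 E2 :: "'a::{field,finite} mat"
  assumes R: "lower_closed R" and E1: "E1 \<in> carrier_mat m m" and E2: "E2 \<in> carrier_mat m m"
    and mon1: "monomial m E1" and mon2: "monomial m E2"
    and a: "a \<in> unitri m" and b: "b \<in> unitri m"
    and eq: "\<And>i j. i < m \<Longrightarrow> j < m \<Longrightarrow> R i j \<Longrightarrow> (a * E1) $$ (i, j) = (E2 * b) $$ (i, j)"
    and ij: "i < m" "j < m" "R i j" "E1 $$ (i, j) \<noteq> 0"
  shows "E2 $$ (i, j) = E1 $$ (i, j) \<or> (\<exists>l<j. E2 $$ (i, l) \<noteq> 0)"
proof -
  have "(a * E1) $$ (i, j) = (\<Sum>x<m. a $$ (i, x) * E1 $$ (x, j))"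
    by (rule mult_mat_entry[OF unitri_carrier[OF a] E1 ij(1,2)])
  also have "\<dots> = (\<Sum>x<m. if x = i then E1 $$ (x, j) else 0)"
  proof (rule sum.cong)
    fix x assume "x \<in> {..<m}"
    thus "a $$ (i, x) * E1 $$ (x, j) = (if x = i then E1 $$ (x, j) else 0)"
      using monomial_colD[OF mon1 _ ij(4), of x] ij unitriD(3)[OF a ij(1)] by (cases "E1 $$ (x, j) = 0") auto
  qed simp
  also have "\<dots> = E1 $$ (i, j)" using ij by (simp add: sum.delta)
  finally have 1: "(E2 * b) $$ (i, j) = E1 $$ (i, j)" using eq ij by simp
  have 2: "(E2 * b) $$ (i, j) = (\<Sum>x<m. E2 $$ (i, x) * b $$ (x, j))"
    by (rule mult_mat_entry[OF E2 unitri_carrier[OF b] ij(1,2)])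
  show ?thesis
  proof (cases "E2 $$ (i, j) = 0")
    case False
    have "(\<Sum>x<m. E2 $$ (i, x) * b $$ (x, j)) = (\<Sum>x<m. if x = j then E2 $$ (i, x) else 0)"
    proof (rule sum.cong)
      fix x assume "x \<in> {..<m}"
      thus "E2 $$ (i, x) * b $$ (x, j) = (if x = j then E2 $$ (i, x) else 0)"
        using monomial_rowD[OF mon2 _ False, of x] ij unitriD(3)[OF b ij(2)] by (cases "E2 $$ (i, x) = 0") auto
    qed simp
    also have "\<dots> = E2 $$ (i, j)" using ij by (simp add: sum.delta)
    finally show ?thesis using 1 2 by simp
  next
    case True
    obtain x where x: "x < m" "E2 $$ (i, x) * b $$ (x, j) \<noteq> 0"
      using 1 2 ij(4) by (metis (no_types, lifting) lessThan_iff sum.neutral)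
    hence "x \<le> j" using unitriD(2)[OF b, of j x] by (cases "x \<le> j") auto
    moreover have "x \<noteq> j" using x True by auto
    ultimately show ?thesis using x by auto
  qed
qed

text \<open>A mismatch at \<open>(i, j)\<close> would give \<open>E2\<close> an entry in row
  \<open>i\<close> to the left of \<open>j\<close>; from there the same argument, with the roles
  exchanged, gives \<open>E1\<close> an entry in that row at least as far left, a second one besides
  column \<open>j\<close>.\<close>

lemma monomial_unique:
  fixes E1 E2 :: "'a::{field,finite} mat"
  assumes R: "lower_closed R" and E1: "E1 \<in> carrier_mat m m" and E2: "E2 \<in> carrier_mat m m"
    and mon1: "monomial m E1" and mon2: "monomial m E2"
    and a: "a \<in> unitri m" and b: "b \<in> unitri m"
    and eq: "\<And>i j. i < m \<Longrightarrow> j < m \<Longrightarrow> R i j \<Longrightarrow> (a * E1 * b) $$ (i, j) = E2 $$ (i, j)"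
    and ij: "i < m" "j < m" "R i j"
  shows "E1 $$ (i, j) = E2 $$ (i, j)"
proof -
  obtain a' where a': "a' \<in> unitri m" "a * a' = 1\<^sub>m m" "a' * a = 1\<^sub>m m" using unitri_inverse[OF a] .
  obtain b' where b': "b' \<in> unitri m" "b * b' = 1\<^sub>m m" "b' * b = 1\<^sub>m m" using unitri_inverse[OF b] .
  note [simp] = carrier_matD[OF E1] carrier_matD[OF E2] carrier_matD[OF unitri_carrier[OF a]]
    carrier_matD[OF unitri_carrier[OF b]] carrier_matD[OF unitri_carrier[OF a'(1)]] carrier_matD[OF unitri_carrier[OF b'(1)]]
  define N where "N = a * E1 * b - E2"
  have N: "N \<in> carrier_mat m m" by (simp add: N_def minus_carrier_mat)
  have N0: "N $$ (i, j) = 0" if "i < m" "j < m" "R i j" for i j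
    using eq[OF that] that by (simp add: N_def del: index_mult_mat(1))
  have Nb: "N * b' = a * E1 - E2 * b'"
    by (simp add: N_def mat_alg b')
  have e1: "(a * E1) $$ (i, j) = (E2 * b') $$ (i, j)" if "i < m" "j < m" "R i j" for i j
    using lower_closed_mult_right[OF R N b'(1) N0 that] that unfolding Nb
    by (simp del: index_mult_mat(1))
  have aN: "a' * N = E1 * b - a' * E2"
    by (simp add: N_def mat_alg a' mat_inverse_mult[OF a'(3)])
  have e2: "(a' * E2) $$ (i, j) = (E1 * b) $$ (i, j)" if "i < m" "j < m" "R i j" for i j
    using lower_closed_mult_left[OF R N a'(1) N0 that] that unfolding aN
    by (simp del: index_mult_mat(1))
  have row: "j = l" if "monomial m E" "E $$ (i, j) \<noteq> 0" "E $$ (i, l) \<noteq> 0" "i < m" "j < m" "l < m"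
    for E :: "'a mat" and i j l using monomial_rowD[OF that(1-3)] that by simp
  \<comment> \<open>Formulated for interchangeable matrices, because the nonzero entry may lie in
    \<open>E1\<close> or only in \<open>E2\<close>.\<close>
  have key: "F $$ (i, j) = E $$ (i, j)"
    if E: "E \<in> carrier_mat m m" "F \<in> carrier_mat m m" "monomial m E" "monomial m F"
      and ab: "a \<in> unitri m" "b \<in> unitri m" "a' \<in> unitri m" "b' \<in> unitri m"
      and e1: "\<forall>i<m. \<forall>j<m. R i j \<longrightarrow> (a * E) $$ (i, j) = (F * b') $$ (i, j)"
      and e2: "\<forall>i<m. \<forall>j<m. R i j \<longrightarrow> (a' * F) $$ (i, j) = (E * b) $$ (i, j)"
      and nz: "E $$ (i, j) \<noteq> 0"
    for E F a b a' b' :: "'a mat"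
  proof (rule ccontr)
    assume "F $$ (i, j) \<noteq> E $$ (i, j)"
    then obtain l where l: "l < j" "F $$ (i, l) \<noteq> 0"
      using monomial_unique_aux[OF R E ab(1,4) e1[rule_format] ij nz] by blast
    have "E $$ (i, l) = F $$ (i, l) \<or> (\<exists>l'<l. E $$ (i, l') \<noteq> 0)"
      using monomial_unique_aux[OF R E(2,1,4,3) ab(3,2) e2[rule_format] ij(1) less_trans[OF l(1) ij(2)]
          lower_closedD[OF R ij(3) order_refl less_imp_le[OF l(1)]] l(2)] by blast
    then obtain l' where "l' \<le> l" "E $$ (i, l') \<noteq> 0" using l by (metis le_refl less_imp_le)
    with row[OF E(3) this(2) nz] l ij show False by auto
  qed
  show ?thesis
  proof -
    have e1': "\<forall>i<m. \<forall>j<m. R i j \<longrightarrow> (a * E1) $$ (i, j) = (E2 * b') $$ (i, j)"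
      and e2': "\<forall>i<m. \<forall>j<m. R i j \<longrightarrow> (a' * E2) $$ (i, j) = (E1 * b) $$ (i, j)"
      using e1 e2 by blast+
    show ?thesis
      using key[OF E1 E2 mon1 mon2 a b a'(1) b'(1) e1' e2'] key[OF E2 E1 mon2 mon1 a'(1) b'(1) a b e2' e1']
      by (cases "E1 $$ (i, j) = 0") auto
  qed
qed

text \<open>Row \<open>k\<close> is reduced in two moves. The rows below it, being monomial, clear
  from it every column in which they have an entry (\<open>a\<close>). Then the leftmost surviving
  entry, in column \<open>p\<close>, clears the rest of the row to its right (\<open>b\<close>);
  leftmost, because unitriangular column operations only act to the right. As column
  \<open>p\<close> is empty below row \<open>k\<close>, the second move leaves the lower rows
  alone.\<close>

lemma monomial_step:
  fixes M :: "'a::field mat"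
  assumes M: "M \<in> carrier_mat m m" and mon: "monomial_from m (Suc k) M" and k: "k < m"
  obtains a b where "a \<in> unitri m" "b \<in> unitri m" "monomial_from m k (a * M * b)"
proof -
  \<comment> \<open>A row \<open>j\<close> below \<open>k\<close> has at most one nonzero entry and
    division by 0 yields 0, so this sum is the quotient at that entry, or 0 for a zero row.\<close>
  define t where "t = (\<lambda>j. \<Sum>l<m. M $$ (k, l) / M $$ (j, l))"
  define a where "a = mat m m (\<lambda>(i, j). if i = j then 1 else if i = k \<and> k < j then - t j else 0)"
  have a: "a \<in> unitri m" unfolding a_def by (rule unitriI) auto
  define M1 where "M1 = a * M"
  have M1c: "M1 \<in> carrier_mat m m" using M unitri_carrier[OF a] by (auto simp: M1_def)
  have M1: "M1 $$ (i, l) = (if i = k then M $$ (k, l) - (\<Sum>j\<in>{k<..<m}. t j * M $$ (j, l)) else M $$ (i, l))"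
    if "i < m" "l < m" for i l
  proof -
    have "M1 $$ (i, l) = (\<Sum>j<m. a $$ (i, j) * M $$ (j, l))"
      unfolding M1_def by (rule mult_mat_entry[OF unitri_carrier[OF a] M that])
    also have "\<dots> = (\<Sum>j<m. (if j = i then M $$ (j, l) else 0) + (if i = k \<and> k < j then - t j * M $$ (j, l) else 0))"
      by (rule sum.cong) (use that in \<open>auto simp: a_def\<close>)
    also have "\<dots> = M $$ (i, l) + (\<Sum>j<m. if i = k \<and> k < j then - t j * M $$ (j, l) else 0)"
      using that by (simp add: sum.distrib sum.delta)
    also have "(\<Sum>j<m. if i = k \<and> k < j then - t j * M $$ (j, l) else 0) =
        (if i = k then - (\<Sum>j\<in>{k<..<m}. t j * M $$ (j, l)) else 0)"
      by (auto simp: sum_negf[symmetric] intro!: sum.mono_neutral_cong_right)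
    finally show ?thesis by auto
  qed
  have z: "M1 $$ (k, l) = 0" if l: "l < m" and j: "k < j" "j < m" "M $$ (j, l) \<noteq> 0" for j l
  proof -
    have "(\<Sum>j'\<in>{k<..<m}. t j' * M $$ (j', l)) = (\<Sum>j'\<in>{k<..<m}. if j' = j then t j * M $$ (j, l) else 0)"
    proof (rule sum.cong)
      fix j' assume "j' \<in> {k<..<m}"
      thus "t j' * M $$ (j', l) = (if j' = j then t j * M $$ (j, l) else 0)"
        using monomial_colD[OF mon _ j(3), of j'] l j by (cases "M $$ (j', l) = 0") auto
    qed simp
    also have "\<dots> = t j * M $$ (j, l)" using j by (simp add: sum.delta)
    also have "t j = (\<Sum>l'<m. if l' = l then M $$ (k, l) / M $$ (j, l) else 0)"
      unfolding t_def
    proof (rule sum.cong)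
      fix l' assume "l' \<in> {..<m}"
      thus "M $$ (k, l') / M $$ (j, l') = (if l' = l then M $$ (k, l) / M $$ (j, l) else 0)"
        using monomial_rowD[OF mon _ j(3), of l'] l j by (cases "M $$ (j, l') = 0") auto
    qed simp
    also have "\<dots> = M $$ (k, l) / M $$ (j, l)" using l by (simp add: sum.delta)
    finally show ?thesis using M1[OF k l] j by simp
  qed
  show ?thesis
  proof (cases "\<forall>l<m. M1 $$ (k, l) = 0")
    case True
    have "M1 * 1\<^sub>m m = M1" using M1c by simp
    moreover have "monomial_from m k M1"
    proof (rule monomial_fromI)
      fix i j l assume *: "k \<le> i" "i < m" "j < m" "l < m" "M1 $$ (i, j) \<noteq> 0" "M1 $$ (i, l) \<noteq> 0"
      hence "i \<noteq> k" using True by auto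
      with * M1[of i] show "j = l" using monomial_rowD[OF mon, of i j l] by auto
    next
      fix i i' j assume *: "k \<le> i" "i < m" "k \<le> i'" "i' < m" "j < m" "M1 $$ (i, j) \<noteq> 0" "M1 $$ (i', j) \<noteq> 0"
      hence "i \<noteq> k" "i' \<noteq> k" using True by auto
      with * M1[of i] M1[of i'] show "i = i'" using monomial_colD[OF mon, of i j i'] by auto
    qed
    ultimately show ?thesis using that[of a "1\<^sub>m m"] a by (simp add: M1_def)
  next
    case False
    define p where "p = (LEAST l. l < m \<and> M1 $$ (k, l) \<noteq> 0)"
    have p: "p < m" "M1 $$ (k, p) \<noteq> 0"
      using LeastI_ex[of "\<lambda>l. l < m \<and> M1 $$ (k, l) \<noteq> 0"] False unfolding p_def by auto
    have p_least: "M1 $$ (k, l) = 0" if "l < p" for l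
      using not_less_Least[of l "\<lambda>l. l < m \<and> M1 $$ (k, l) \<noteq> 0"] that p unfolding p_def by auto
    define b where "b = mat m m (\<lambda>(i, l). if i = l then 1 else if i = p \<and> p < l then - M1 $$ (k, l) / M1 $$ (k, p) else 0)"
    have b: "b \<in> unitri m" unfolding b_def by (rule unitriI) auto
    define M2 where "M2 = M1 * b"
    have M2: "M2 $$ (i, l) = M1 $$ (i, l) - (if p < l then M1 $$ (i, p) * M1 $$ (k, l) / M1 $$ (k, p) else 0)"
      if "i < m" "l < m" for i l
    proof -
      have "M2 $$ (i, l) = (\<Sum>j<m. M1 $$ (i, j) * b $$ (j, l))"
        unfolding M2_def by (rule mult_mat_entry[OF M1c unitri_carrier[OF b] that])
      also have "\<dots> = (\<Sum>j<m. (if j = l then M1 $$ (i, j) else 0) +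
          (if j = p then (if p < l then - (M1 $$ (i, p) * M1 $$ (k, l) / M1 $$ (k, p)) else 0) else 0))"
        by (rule sum.cong) (use that in \<open>auto simp: b_def\<close>)
      finally show ?thesis using that p by (simp add: sum.distrib sum.delta)
    qed
    have low: "M2 $$ (i, l) = M $$ (i, l)" if "k < i" "i < m" "l < m" for i l
      using z[OF p(1) that(1,2)] p that M2 M1 by auto
    have rowk: "M2 $$ (k, l) = (if l = p then M1 $$ (k, p) else 0)" if "l < m" for l
      using M2[OF k that] p p_least[of l] by (cases l p rule: linorder_cases) auto
    have "monomial_from m k M2"
    proof (rule monomial_fromI)
      fix i j l assume *: "k \<le> i" "i < m" "j < m" "l < m" "M2 $$ (i, j) \<noteq> 0" "M2 $$ (i, l) \<noteq> 0"
      show "j = l"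
      proof (cases "i = k")
        case True with * rowk show ?thesis by (auto split: if_splits)
      next
        case False
        with * have "M $$ (i, j) \<noteq> 0" "M $$ (i, l) \<noteq> 0" using low by auto
        from monomial_rowD[OF mon this] False * show ?thesis by auto
      qed
    next
      fix i i' j assume *: "k \<le> i" "i < m" "k \<le> i'" "i' < m" "j < m" "M2 $$ (i, j) \<noteq> 0" "M2 $$ (i', j) \<noteq> 0"
      have no: False if "k < i" "i < m" "M2 $$ (i, j) \<noteq> 0" "M2 $$ (k, j) \<noteq> 0" for i
        using z[OF *(5) that(1,2)] low[OF that(1,2) *(5)] that rowk[OF *(5)] p by (auto split: if_splits)
      consider "i = k" "i' = k" | "k < i" "i' = k" | "k < i'" "i = k" | "k < i" "k < i'" using * by force
      thus "i = i'"
      proof cases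
        case 4
        with * have "M $$ (i, j) \<noteq> 0" "M $$ (i', j) \<noteq> 0" using low by auto
        from monomial_colD[OF mon this] 4 * show ?thesis by auto
      qed (use no * in auto)
    qed
    thus ?thesis using that[OF a b] by (simp add: M2_def M1_def)
  qed
qed

lemma monomial_exists:
  fixes A :: "'a::{field,finite} mat"
  assumes A: "A \<in> carrier_mat m m"
  obtains a b M where "a \<in> unitri m" "b \<in> unitri m" "M \<in> carrier_mat m m" "monomial m M" "A = a * M * b"
proof -
  \<comment> \<open>\<open>m - k\<close> is truncated at 0, so the induction may run beyond
    \<open>m\<close>, where nothing is left to do.\<close>
  have "\<exists>a\<in>unitri m. \<exists>b\<in>unitri m. monomial_from m (m - k) (a * A * b)" for k
  proof (induction k)
    case 0
    show ?case by (rule bexI[of _ "1\<^sub>m m"])+ (auto simp: monomial_from_def)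
  next
    case (Suc k)
    then obtain a b where ab: "a \<in> unitri m" "b \<in> unitri m" and mon: "monomial_from m (m - k) (a * A * b)"
      by blast
    show ?case
    proof (cases "k < m")
      case False
      with Suc show ?thesis by simp
    next
      case True
      note [simp] = carrier_matD[OF unitri_carrier[OF ab(1)]] carrier_matD[OF unitri_carrier[OF ab(2)]] carrier_matD[OF A]
      obtain a' b' where ab': "a' \<in> unitri m" "b' \<in> unitri m"
        "monomial_from m (m - Suc k) (a' * (a * A * b) * b')"
        using monomial_step[of "a * A * b" m "m - Suc k"] mon True by (auto simp: Suc_diff_Suc)
      note [simp] = carrier_matD[OF unitri_carrier[OF ab'(1)]] carrier_matD[OF unitri_carrier[OF ab'(2)]]
      have "a' * (a * A * b) * b' = (a' * a) * A * (b * b')"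
        by (simp add: mat_assoc)
      with ab' ab show ?thesis using unitri_mult by metis
    qed
  qed
  from this[of m] obtain a b where ab: "a \<in> unitri m" "b \<in> unitri m" "monomial m (a * A * b)" by auto
  obtain a' where a': "a' \<in> unitri m" "a' * a = 1\<^sub>m m" using unitri_inverse[OF ab(1)] by metis
  obtain b' where b': "b' \<in> unitri m" "b * b' = 1\<^sub>m m" using unitri_inverse[OF ab(2)] by metis
  note [simp] = carrier_matD[OF unitri_carrier[OF ab(1)]] carrier_matD[OF unitri_carrier[OF ab(2)]] carrier_matD[OF A]
    carrier_matD[OF unitri_carrier[OF a'(1)]] carrier_matD[OF unitri_carrier[OF b'(1)]]
  have "A = a' * (a * A * b) * b'"
    using a' b' by (simp add: mat_assoc mat_inverse_mult[OF a'(2)])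
  with that[OF a'(1) b'(1) _ ab(3)] show ?thesis by simp
qed

context unipotent_classical
begin

section \<open>Matrix positions of roots\<close>

text \<open>\<open>sp\<close> and \<open>od\<close> stand for equations that the simplifier would otherwise use to eliminate the
  parameter \<open>c\<close>; for the same reason the size \<open>m\<close> is bounded from both sides.\<close>

definition sp :: bool where "sp \<longleftrightarrow> c = Sp"
definition od :: bool where "od \<longleftrightarrow> c = O_odd"

lemma sp_od: "sp \<Longrightarrow> \<not> od"
  unfolding sp_def od_def by simp

lemma rk_od: "od \<Longrightarrow> rk c = 1" "\<not> od \<Longrightarrow> rk c = 0"
  unfolding rk_def od_def by simp_all

lemma m_bounds: "m \<le> 2 * n + rk c" "2 * n + rk c \<le> m"
  by (simp_all add: m_eq)

lemma eps_sp: "eps a = (if sp \<and> n \<le> a then - 1 else 1)"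
  by (simp add: eps_def sp_def)

lemma pos_m: "pos c n i = (if i > 0 then nat (i - 1) else if i = 0 then n else nat (int m + i))"
  by (simp add: pos_def m_def)

lemma munit_m: "munit c n i j = mat m m (\<lambda>(a, b). if a = pos c n i \<and> b = pos c n j then 1 else 0)"
  by (simp add: munit_def m_def)

lemma root_mat_Plus: "root_mat c n (Plus i j) =
     (if sp then munit c n i (- j) + munit c n j (- i) else munit c n i (- j) - munit c n j (- i))"
  by (simp add: sp_def)

text \<open>\<open>rp \<alpha>\<close> is the position of the positive entry of \<open>\<alpha>\<close> in 0-based matrix indices; \<open>mir\<close> sends it to the
  position of the other entry, and fixes it exactly if \<open>\<alpha> = 2\<epsilon>\<^sub>i\<close>.\<close>

definition rp :: "root \<Rightarrow> nat \<times> nat" where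
  "rp \<alpha> = (pos c n (fst (pos_entry c n \<alpha>)), pos c n (snd (pos_entry c n \<alpha>)))"

definition mir :: "nat \<times> nat \<Rightarrow> nat \<times> nat" where
  "mir e = (m - 1 - snd e, m - 1 - fst e)"

text \<open>Representatives of the orbits of \<open>mir\<close> on the positions above the diagonal
  where a skew matrix can be nonzero. On the antidiagonal, which \<open>mir\<close> fixes, a skew
  matrix vanishes in the orthogonal case, hence the extra \<open>sp\<close>.\<close>

definition RP :: "(nat \<times> nat) set" where
  "RP = {(a, b). a < n \<and> a < b \<and> (a + b < m - 1 \<or> a + b = m - 1 \<and> sp)}"

text \<open>The label 0 has to be dropped where it does not exist, for otherwise \<open>pos\<close>
  would not be injective.\<close>

definition labels :: "int set" where
  "labels = {i. 1 \<le> \<bar>i\<bar> \<and> \<bar>i\<bar> \<le> int n \<or> i = 0 \<and> od}"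

lemma pos_inj: "i \<in> labels \<Longrightarrow> j \<in> labels \<Longrightarrow> pos c n i = pos c n j \<Longrightarrow> i = j"
  using m_bounds rk_od by (auto simp: labels_def pos_m split: if_splits)

lemma pos_simps:
  "pos c n (int a + 1) = a" "a < m \<Longrightarrow> pos c n (- int a - 1) = m - 1 - a" "pos c n 0 = n"
  by (simp_all add: pos_m nat_diff_distrib flip: of_nat_diff)

lemma roots_cases:
  assumes "\<alpha> \<in> roots c n"
  obtains a b where "\<alpha> = Diff (int a + 1) (int b + 1)" "a < b" "b < n"
  | a b where "\<alpha> = Plus (int a + 1) (int b + 1)" "a < b" "b < n"
  | a where "\<alpha> = Twice (int a + 1)" "a < n" "sp"
  | a where "\<alpha> = Single (int a + 1)" "a < n" "od"
proof -
  have ex: "\<exists>a. i = int a + 1" if "1 \<le> i" for i :: int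
    using that by (intro exI[of _ "nat (i - 1)"]) simp
  consider i j where "\<alpha> = Diff i j" "1 \<le> i" "i < j" "j \<le> int n"
    | i j where "\<alpha> = Plus i j" "1 \<le> i" "i < j" "j \<le> int n"
    | i where "\<alpha> = Twice i" "1 \<le> i" "i \<le> int n" "c = Sp"
    | i where "\<alpha> = Single i" "1 \<le> i" "i \<le> int n" "c = O_odd"
    using assms by (cases c) (auto simp: roots_def)
  thus ?thesis
  proof cases
    case (1 i j)
    with ex[of i] ex[of j] obtain a b where "i = int a + 1" "j = int b + 1" by auto
    with 1 that(1)[of a b] show ?thesis by auto
  next
    case (2 i j)
    with ex[of i] ex[of j] obtain a b where "i = int a + 1" "j = int b + 1" by auto
    with 2 that(2)[of a b] show ?thesis by auto
  next
    case (3 i)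
    with ex[of i] obtain a where "i = int a + 1" by auto
    with 3(1,3) that(3)[of a] 3(4)[folded sp_def] show ?thesis by auto
  next
    case (4 i)
    with ex[of i] obtain a where "i = int a + 1" by auto
    with 4(1,3) that(4)[of a] 4(4)[folded od_def] show ?thesis by auto
  qed
qed

lemma roots_intros:
  "a < b \<Longrightarrow> b < n \<Longrightarrow> Diff (int a + 1) (int b + 1) \<in> roots c n"
  "a < b \<Longrightarrow> b < n \<Longrightarrow> Plus (int a + 1) (int b + 1) \<in> roots c n"
  "a < n \<Longrightarrow> sp \<Longrightarrow> Twice (int a + 1) \<in> roots c n"
  "a < n \<Longrightarrow> od \<Longrightarrow> Single (int a + 1) \<in> roots c n"
  unfolding sp_def od_def by (auto simp: roots_def)

lemma pos_entry_nat:
  "a < b \<Longrightarrow> b < n \<Longrightarrow> pos_entry c n (Diff (int a + 1) (int b + 1)) = (int a + 1, int b + 1)"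
  "a < b \<Longrightarrow> b < n \<Longrightarrow> pos_entry c n (Plus (int a + 1) (int b + 1)) = (int a + 1, - int b - 1)"
  "a < n \<Longrightarrow> pos_entry c n (Twice (int a + 1)) = (int a + 1, - int a - 1)"
  "a < n \<Longrightarrow> od \<Longrightarrow> pos_entry c n (Single (int a + 1)) = (int a + 1, 0)"
  using pos_entry_simps(4)[of "int a + 1" n] unfolding od_def by (simp_all add: pos_entry_simps(1-3))

lemma rp_simps:
  "a < b \<Longrightarrow> b < n \<Longrightarrow> rp (Diff (int a + 1) (int b + 1)) = (a, b)"
  "a < b \<Longrightarrow> b < n \<Longrightarrow> rp (Plus (int a + 1) (int b + 1)) = (a, m - 1 - b)"
  "a < n \<Longrightarrow> rp (Twice (int a + 1)) = (a, m - 1 - a)"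
  "a < n \<Longrightarrow> od \<Longrightarrow> rp (Single (int a + 1)) = (a, n)"
  using m_eq by (simp_all add: rp_def pos_entry_nat pos_simps)

lemma rp_in_RP: "\<alpha> \<in> roots c n \<Longrightarrow> rp \<alpha> \<in> RP"
  unfolding RP_def using m_bounds rk_od by (elim roots_cases) (auto simp: rp_simps)

lemma rp_inj:
  assumes "\<alpha> \<in> roots c n" "\<beta> \<in> roots c n" "rp \<alpha> = rp \<beta>"
  shows "\<alpha> = \<beta>"
  using assms(1)
proof (cases rule: roots_cases)
  case 1
  from assms(2) show ?thesis
    by (cases rule: roots_cases) (use 1 assms(3) m_bounds rk_od in \<open>auto simp: rp_simps\<close>)
next
  case 2
  from assms(2) show ?thesis
    by (cases rule: roots_cases) (use 2 assms(3) m_bounds rk_od in \<open>auto simp: rp_simps\<close>)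
next
  case 3
  from assms(2) show ?thesis
    by (cases rule: roots_cases) (use 3 assms(3) m_bounds rk_od in \<open>auto simp: rp_simps\<close>)
next
  case 4
  from assms(2) show ?thesis
    by (cases rule: roots_cases) (use 4 assms(3) m_bounds rk_od in \<open>auto simp: rp_simps\<close>)
qed

lemma rp_surj:
  assumes "e \<in> RP"
  obtains \<alpha> where "\<alpha> \<in> roots c n" "rp \<alpha> = e"
proof -
  obtain a b where e: "e = (a, b)" and ab: "a < n" "a < b" "a + b < m - 1 \<or> a + b = m - 1 \<and> sp"
    using assms by (auto simp: RP_def)
  consider "b < n" | "b = n" "od" | "sp" "a + b = m - 1" | "n + rk c \<le> b" "a + b < m - 1"
    using ab rk_od by (cases od; cases "b < n"; cases "b = n") auto
  thus ?thesis
  proof cases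
    case 1
    with ab show ?thesis using that[OF roots_intros(1)] by (auto simp: e rp_simps)
  next
    case 2
    with ab show ?thesis using that[OF roots_intros(4)] by (auto simp: e rp_simps)
  next
    case 3
    with ab m_eq show ?thesis using that[OF roots_intros(3), of a] by (auto simp: e rp_simps)
  next
    case 4
    have "b = m - 1 - (m - 1 - b)" "a < m - 1 - b" "m - 1 - b < n"
      using 4 ab m_eq rk_od by (cases od; auto)+
    then obtain b' where "b = m - 1 - b'" "a < b'" "b' < n" by blast
    with that[OF roots_intros(2), of a b'] show ?thesis by (simp add: e rp_simps)
  qed
qed

lemma entries_pos:
  assumes "\<alpha> \<in> roots c n"
  shows "(\<lambda>(i, j). (pos c n i, pos c n j)) ` entries \<alpha> = {rp \<alpha>, mir (rp \<alpha>)}"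
    and "entries \<alpha> \<subseteq> labels \<times> labels"
  unfolding mir_def using assms m_bounds rk_od
  by (elim roots_cases; auto simp: rp_simps pos_simps labels_def)+

lemma mir_mir: "fst e < m \<Longrightarrow> snd e < m \<Longrightarrow> mir (mir e) = e"
  by (auto simp: mir_def prod_eq_iff)

lemma RP_bounds: "e \<in> RP \<Longrightarrow> fst e < m \<and> snd e < m \<and> fst e < snd e"
  unfolding RP_def using m_bounds rk_od sp_od by (auto simp: )

text \<open>\<open>mir\<close> reflects in the antidiagonal, and \<open>RP\<close> lies on one side
  of it, boundary included.\<close>

lemma RP_mir: "e \<in> RP \<Longrightarrow> mir e \<in> RP \<Longrightarrow> mir e = e"
  unfolding RP_def mir_def using m_bounds rk_od sp_od by (auto simp: )

lemma RP_self_mir: "e \<in> RP \<Longrightarrow> mir e = e \<Longrightarrow> eps (fst e) * eps (snd e) = - 1"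
  unfolding RP_def mir_def using m_bounds rk_od sp_od by (auto simp:  eps_sp split: if_splits)

lemma root_mat_carrier: "\<alpha> \<in> roots c n \<Longrightarrow> (root_mat c n \<alpha> :: 'a mat) \<in> carrier_mat m m"
  by (erule roots_cases) (auto simp: munit_m root_mat_Plus simp del: root_mat.simps(2))

lemma mir_eq:
  assumes "a < m" "b < m" "x < m" "y < m"
  shows "mir (a, b) = (x, y) \<longleftrightarrow> (a, b) = (m - 1 - y, m - 1 - x)"
  unfolding mir_def using assms by auto

lemma munit_carrier [simp]: "munit c n i j \<in> carrier_mat m m" "dim_row (munit c n i j) = m" "dim_col (munit c n i j) = m"
  by (simp_all add: munit_m)

lemma munit_index:
  "a < m \<Longrightarrow> b < m \<Longrightarrow> munit c n i j $$ (a, b) = (if (a, b) = (pos c n i, pos c n j) then 1 else 0)"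
  by (simp add: munit_m)

lemma if_sum_exclusive:
  "e \<noteq> f \<Longrightarrow> (e0 = f \<Longrightarrow> k = k') \<Longrightarrow>
   (if e0 = e then 1 else 0) + (if e0 = f then k else 0) = (if e0 = e then 1 else if e0 = f then k' else (0 :: 'a))"
  by auto

text \<open>The unit at \<open>rp \<alpha>\<close> minus its adjoint, for all kinds of roots at
  once: \<open>eps\<close> produces the signs that \<open>root_mat\<close> distinguishes by case. At
  a self-mirrored position the adjoint is not subtracted, so the entry is 1 and not 2;
  \<open>phit\<close> makes up for this later.\<close>

lemma root_mat_index:
  assumes "\<alpha> \<in> roots c n" and ab: "a < m" "b < m"
  shows "(root_mat c n \<alpha> :: 'a mat) $$ (a, b) =
    (if (a, b) = rp \<alpha> then 1 else if mir (a, b) = rp \<alpha> then - (eps a * eps b) else 0)"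
  using assms(1)
proof (cases rule: roots_cases)
  case (1 x y)
  hence xy: "x < m" "y < m" using m_eq by auto
  have *: "(x, y) \<noteq> (m - 1 - y, m - 1 - x)" "eps (m - 1 - y) * eps (m - 1 - x) = 1"
    using 1 m_eq unfolding eps_flip[OF xy(2,1)] by (auto simp: eps_sp)
  have "(root_mat c n \<alpha> :: 'a mat) $$ (a, b) =
      (if (a, b) = (x, y) then 1 else 0) + (if (a, b) = (m - 1 - y, m - 1 - x) then - 1 else 0)"
    using 1 ab xy by (simp add: munit_index pos_simps)
  also have "\<dots> = (if (a, b) = (x, y) then 1 else if (a, b) = (m - 1 - y, m - 1 - x) then - (eps a * eps b) else 0)"
    by (rule if_sum_exclusive[OF *(1)]) (metis *(2) prod.inject)
  finally show ?thesis unfolding 1(1) rp_simps(1)[OF 1(2,3)] mir_eq[OF ab xy] .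
next
  case (2 x y)
  define z where "z = m - 1 - y"
  have xy: "x < m" "z < m" and z: "m - 1 - z = y" using m_eq 2 by (auto simp: z_def)
  have *: "(x, z) \<noteq> (y, m - 1 - x)" "eps y * eps (m - 1 - x) = (if sp then - 1 else 1)"
    using 2 m_eq by (auto simp: z_def eps_sp)
  have "(root_mat c n \<alpha> :: 'a mat) $$ (a, b) =
      (if (a, b) = (x, z) then 1 else 0) + (if (a, b) = (y, m - 1 - x) then (if sp then 1 else - 1) else 0)"
    using 2 ab xy m_eq by (simp add: munit_index pos_simps root_mat_Plus z_def del: root_mat.simps(2))
  also have "\<dots> = (if (a, b) = (x, z) then 1 else if (a, b) = (y, m - 1 - x) then - (eps a * eps b) else 0)"
    by (rule if_sum_exclusive[OF *(1)]) (metis *(2) prod.inject minus_minus)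
  finally show ?thesis unfolding 2(1) rp_simps(2)[OF 2(2,3)] z_def[symmetric] mir_eq[OF ab xy] z .
next
  case (3 x)
  have xy: "x < m" "m - 1 - x < m" using m_eq 3 by auto
  have "m - 1 - (m - 1 - x) = x" using xy by simp
  thus ?thesis
    using 3 ab xy unfolding 3(1) rp_simps(3)[OF 3(2)] mir_eq[OF ab xy] by (simp add: munit_index pos_simps)
next
  case (4 x)
  have xy: "x < m" "n < m" using m_eq 4 rk_od by auto
  have n: "m - 1 - n = n" using m_eq 4 rk_od by auto
  have *: "(x, n) \<noteq> (n, m - 1 - x)" "eps n * eps (m - 1 - x) = 1"
    using 4 sp_od by (auto simp: eps_sp)
  have "(root_mat c n \<alpha> :: 'a mat) $$ (a, b) =
      (if (a, b) = (x, n) then 1 else 0) + (if (a, b) = (n, m - 1 - x) then - 1 else 0)"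
    using 4 ab xy by (simp add: munit_index pos_simps)
  also have "\<dots> = (if (a, b) = (x, n) then 1 else if (a, b) = (n, m - 1 - x) then - (eps a * eps b) else 0)"
    by (rule if_sum_exclusive[OF *(1)]) (metis *(2) prod.inject)
  finally show ?thesis unfolding 4(1) rp_simps(4)[OF 4(2,3)] mir_eq[OF ab xy] n .
qed

lemma finite_roots: "finite (roots c n)"
proof (rule finite_imageD)
  show "inj_on rp (roots c n)" by (intro inj_onI rp_inj)
  have "rp ` roots c n \<subseteq> {..<m} \<times> {..<m}"
  proof (rule image_subsetI)
    fix \<alpha> assume "\<alpha> \<in> roots c n"
    from RP_bounds[OF rp_in_RP[OF this]] show "rp \<alpha> \<in> {..<m} \<times> {..<m}" by (simp add: mem_Times_iff)
  qed
  thus "finite (rp ` roots c n)" by (rule finite_subset) simp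
qed

section \<open>Basic pairs and skew monomial matrices\<close>

lemma e_mat_carrier [simp]: "e_mat c n D \<phi> \<in> carrier_mat m m"
  by (simp add: e_mat_def m_def)

lemma e_mat_dim [simp]: "dim_row (e_mat c n D \<phi>) = m" "dim_col (e_mat c n D \<phi>) = m"
  by (simp_all add: e_mat_def m_def)

lemma e_mat_index:
  fixes \<phi> :: "root \<Rightarrow> 'a"
  assumes D: "D \<subseteq> roots c n" and ab: "a < m" "b < m"
  shows "e_mat c n D \<phi> $$ (a, b) =
    (\<Sum>\<alpha>\<in>D. \<phi> \<alpha> * (if (a, b) = rp \<alpha> then 1 else if mir (a, b) = rp \<alpha> then - (eps a * eps b) else 0 :: 'a))"
proof -
  have "e_mat c n D \<phi> $$ (a, b) = (\<Sum>\<alpha>\<in>D. (\<phi> \<alpha> \<cdot>\<^sub>m root_mat c n \<alpha>) $$ (a, b))"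
    using ab by (simp add: e_mat_def flip: m_def)
  also have "\<dots> = (\<Sum>\<alpha>\<in>D. \<phi> \<alpha> * (if (a, b) = rp \<alpha> then 1 else if mir (a, b) = rp \<alpha> then - (eps a * eps b) else 0))"
  proof (rule sum.cong[OF refl])
    fix \<alpha> assume "\<alpha> \<in> D"
    hence \<alpha>: "\<alpha> \<in> roots c n" using D by auto
    have "(\<phi> \<alpha> \<cdot>\<^sub>m root_mat c n \<alpha>) $$ (a, b) = \<phi> \<alpha> * root_mat c n \<alpha> $$ (a, b)"
      using ab root_mat_carrier[OF \<alpha>] by simp
    thus "(\<phi> \<alpha> \<cdot>\<^sub>m root_mat c n \<alpha>) $$ (a, b) =
        \<phi> \<alpha> * (if (a, b) = rp \<alpha> then 1 else if mir (a, b) = rp \<alpha> then - (eps a * eps b) else 0)"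
      unfolding root_mat_index[OF \<alpha> ab] .
  qed
  finally show ?thesis .
qed

lemma rp_mir_eq:
  assumes "\<alpha> \<in> roots c n" "\<beta> \<in> roots c n" "mir (rp \<alpha>) = rp \<beta>"
  shows "\<alpha> = \<beta>"
  using RP_mir[OF rp_in_RP[OF assms(1)]] rp_in_RP[OF assms(2)] assms rp_inj by metis

lemma e_mat_rp:
  fixes \<phi> :: "root \<Rightarrow> 'a"
  assumes D: "D \<subseteq> roots c n" and \<alpha>: "\<alpha> \<in> roots c n"
  shows "e_mat c n D \<phi> $$ rp \<alpha> = (if \<alpha> \<in> D then \<phi> \<alpha> else 0)"
proof -
  have fin: "finite D" using D finite_roots finite_subset by blast
  obtain a b where ab: "rp \<alpha> = (a, b)" by force
  have lt: "a < m" "b < m" using RP_bounds[OF rp_in_RP[OF \<alpha>]] by (auto simp: ab)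
  have "e_mat c n D \<phi> $$ rp \<alpha> = (\<Sum>\<beta>\<in>D. if \<beta> = \<alpha> then \<phi> \<alpha> else 0)"
    unfolding ab e_mat_index[OF D lt]
  proof (rule sum.cong[OF refl])
    fix \<beta> assume "\<beta> \<in> D"
    hence \<beta>: "\<beta> \<in> roots c n" using D by auto
    have "(a, b) = rp \<beta> \<longleftrightarrow> \<beta> = \<alpha>" using rp_inj[OF \<alpha> \<beta>] ab by auto
    moreover have "mir (a, b) = rp \<beta> \<Longrightarrow> \<beta> = \<alpha>" using rp_mir_eq[OF \<alpha> \<beta>] ab by auto
    ultimately show "\<phi> \<beta> * (if (a, b) = rp \<beta> then 1 else if mir (a, b) = rp \<beta> then - (eps a * eps b) else 0) =
        (if \<beta> = \<alpha> then \<phi> \<alpha> else 0)"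
      by (cases "\<beta> = \<alpha>") auto
  qed
  thus ?thesis using fin by (simp add: sum.delta)
qed

lemma e_mat_nonzeroD:
  fixes \<phi> :: "root \<Rightarrow> 'a"
  assumes D: "D \<subseteq> roots c n" and ab: "a < m" "b < m" and "e_mat c n D \<phi> $$ (a, b) \<noteq> 0"
  obtains \<alpha> where "\<alpha> \<in> D" "(a, b) \<in> {rp \<alpha>, mir (rp \<alpha>)}"
proof -
  from assms(4)[unfolded e_mat_index[OF D ab]] obtain \<alpha> where \<alpha>: "\<alpha> \<in> D"
    "\<phi> \<alpha> * (if (a, b) = rp \<alpha> then 1 else if mir (a, b) = rp \<alpha> then - (eps a * eps b) else 0) \<noteq> 0"
    by (meson sum.not_neutral_contains_not_neutral)
  show ?thesis
  proof (rule that[OF \<alpha>(1)])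
    have "(a, b) = rp \<alpha> \<or> mir (a, b) = rp \<alpha>" using \<alpha>(2) by (auto split: if_splits)
    thus "(a, b) \<in> {rp \<alpha>, mir (rp \<alpha>)}" using mir_mir[of "(a, b)"] ab by auto
  qed
qed

lemma dag_index_mir:
  assumes "e \<in> {..<m} \<times> {..<m}"
  shows "dag A $$ e = eps (fst e) * eps (snd e) * A $$ mir e"
  using assms by (cases e) (simp add: dag_index mir_def)

lemma dag_e_mat:
  fixes \<phi> :: "root \<Rightarrow> 'a"
  assumes D: "D \<subseteq> roots c n"
  shows "dag (e_mat c n D \<phi>) = - e_mat c n D \<phi>"
proof (rule eq_matI)
  fix a b assume "a < dim_row (- e_mat c n D \<phi>)" "b < dim_col (- e_mat c n D \<phi>)"
  hence ab: "a < m" "b < m" by auto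
  obtain a' b' where m': "mir (a, b) = (a', b')" by force
  hence ab': "a' < m" "b' < m" using ab unfolding mir_def by auto
  have mm: "mir (a', b') = (a, b)" using mir_mir[of "(a, b)"] ab m' by simp
  have ee: "eps a' * eps b' = eps a * eps b"
    using m' eps_flip[of b a] ab unfolding mir_def by (auto simp: mult.commute)
  have "dag (e_mat c n D \<phi>) $$ (a, b) = eps a * eps b * e_mat c n D \<phi> $$ (a', b')"
    using dag_index_mir[of "(a, b)"] ab m' by simp
  also have "\<dots> = (\<Sum>\<alpha>\<in>D. eps a * eps b * (\<phi> \<alpha> * (if (a', b') = rp \<alpha> then 1 else if (a, b) = rp \<alpha> then - (eps a * eps b) else 0)))"
    unfolding e_mat_index[OF D ab'] mm ee by (rule sum_distrib_left)
  also have "\<dots> = (\<Sum>\<alpha>\<in>D. - (\<phi> \<alpha> * (if (a, b) = rp \<alpha> then 1 else if (a', b') = rp \<alpha> then - (eps a * eps b) else 0)))"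
  proof (rule sum.cong[OF refl])
    fix \<alpha> assume "\<alpha> \<in> D"
    hence \<alpha>: "rp \<alpha> \<in> RP" using D rp_in_RP by auto
    have *: "eps a * eps b = - 1" if "(a, b) = rp \<alpha>" "(a', b') = rp \<alpha>"
      using RP_self_mir[OF \<alpha>] that m' by (metis fst_conv snd_conv)
    have **: "eps a * eps b * (\<phi> \<alpha> * (eps a * eps b)) = \<phi> \<alpha>" by (simp add: mult_ac)
    show "eps a * eps b * (\<phi> \<alpha> * (if (a', b') = rp \<alpha> then 1 else if (a, b) = rp \<alpha> then - (eps a * eps b) else 0)) =
        - (\<phi> \<alpha> * (if (a, b) = rp \<alpha> then 1 else if (a', b') = rp \<alpha> then - (eps a * eps b) else 0))"
      using * ** by (cases "(a, b) = rp \<alpha>"; cases "(a', b') = rp \<alpha>") (simp_all add: mult_ac)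
  qed
  also have "\<dots> = - e_mat c n D \<phi> $$ (a, b)"
    unfolding e_mat_index[OF D ab] m' by (rule sum_negf)
  finally show "dag (e_mat c n D \<phi>) $$ (a, b) = (- e_mat c n D \<phi>) $$ (a, b)" using ab by simp
qed auto

lemma e_mat_strict:
  fixes \<phi> :: "root \<Rightarrow> 'a"
  assumes D: "D \<subseteq> roots c n" and "b \<le> a" "a < m"
  shows "e_mat c n D \<phi> $$ (a, b) = 0"
proof (rule ccontr)
  assume "e_mat c n D \<phi> $$ (a, b) \<noteq> 0"
  from e_mat_nonzeroD[OF D _ _ this] assms obtain \<alpha> where "\<alpha> \<in> D" "(a, b) \<in> {rp \<alpha>, mir (rp \<alpha>)}" by auto
  moreover from this have "rp \<alpha> \<in> RP" using rp_in_RP D by auto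
  ultimately show False using RP_bounds[of "rp \<alpha>"] assms unfolding mir_def by (cases "rp \<alpha>") auto
qed

lemma entries_cases:
  assumes "\<alpha> \<in> roots c n" "e \<in> {rp \<alpha>, mir (rp \<alpha>)}"
  obtains i j where "(i, j) \<in> entries \<alpha>" "e = (pos c n i, pos c n j)" "i \<in> labels" "j \<in> labels"
proof -
  have "e \<in> (\<lambda>(i, j). (pos c n i, pos c n j)) ` entries \<alpha>"
    using entries_pos(1)[OF assms(1)] assms(2) by simp
  then obtain i j where "(i, j) \<in> entries \<alpha>" "e = (pos c n i, pos c n j)" by auto
  with entries_pos(2)[OF assms(1)] that show ?thesis by blast
qed

lemma basic_monomial:
  fixes \<phi> :: "root \<Rightarrow> 'a"
  assumes "basic c n D"
  shows "monomial m (e_mat c n D \<phi>)"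
proof (rule monomial_fromI)
  have D: "D \<subseteq> roots c n" and f: "inj_on fst (\<Union>\<alpha>\<in>D. entries \<alpha>)" and s: "inj_on snd (\<Union>\<alpha>\<in>D. entries \<alpha>)"
    using assms by (auto simp: basic_def)
  have ex: "\<exists>i j. (i, j) \<in> (\<Union>\<alpha>\<in>D. entries \<alpha>) \<and> (a, b) = (pos c n i, pos c n j) \<and> i \<in> labels \<and> j \<in> labels"
    if nz: "e_mat c n D \<phi> $$ (a, b) \<noteq> 0" and ab: "a < m" "b < m" for a b
    by (rule e_mat_nonzeroD[OF D ab nz], rule entries_cases) (use D in blast)+
  {
    fix i j l assume *: "i < m" "j < m" "l < m" "e_mat c n D \<phi> $$ (i, j) \<noteq> 0" "e_mat c n D \<phi> $$ (i, l) \<noteq> 0"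
    from ex[OF *(4) *(1,2)] obtain x y where 1: "(x, y) \<in> (\<Union>\<alpha>\<in>D. entries \<alpha>)"
      "i = pos c n x" "j = pos c n y" "x \<in> labels" by blast
    from ex[OF *(5) *(1,3)] obtain x' y' where 2: "(x', y') \<in> (\<Union>\<alpha>\<in>D. entries \<alpha>)"
      "i = pos c n x'" "l = pos c n y'" "x' \<in> labels" by blast
    have "x = x'" using pos_inj 1 2 by auto
    with inj_onD[OF f _ 1(1) 2(1)] 1 2 show "j = l" by simp
  }
  {
    fix i i' j assume *: "i < m" "i' < m" "j < m" "e_mat c n D \<phi> $$ (i, j) \<noteq> 0" "e_mat c n D \<phi> $$ (i', j) \<noteq> 0"
    from ex[OF *(4) *(1,3)] obtain x y where 1: "(x, y) \<in> (\<Union>\<alpha>\<in>D. entries \<alpha>)"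
      "i = pos c n x" "j = pos c n y" "y \<in> labels" by blast
    from ex[OF *(5) *(2,3)] obtain x' y' where 2: "(x', y') \<in> (\<Union>\<alpha>\<in>D. entries \<alpha>)"
      "i' = pos c n x'" "j = pos c n y'" "y' \<in> labels" by blast
    have "y = y'" using pos_inj 1 2 by auto
    with inj_onD[OF s _ 1(1) 2(1)] 1 2 show "i = i'" by simp
  }
qed

lemma eq_neg_self: "x = - x \<longleftrightarrow> x = (0 :: 'a)"
proof -
  have "x = - x \<longleftrightarrow> 2 * x = 0" unfolding eq_neg_iff_add_eq_0 mult_2 by (rule refl)
  thus ?thesis using two_neq_0 by simp
qed

text \<open>A skew matrix is determined by the positions with \<open>a + b \<le> m - 1\<close>.
  Above the diagonal these are the positions of roots, so \<open>D\<close> and \<open>\<phi>\<close>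
  can be read off; the exceptions are the antidiagonal positions for the orthogonal groups, where
  skewness makes an entry equal to its own negative.\<close>

lemma skew_monomial_e_mat:
  assumes M: "M \<in> carrier_mat m m" and mon: "monomial m M" and dagM: "dag M = - M"
    and strict: "\<And>a b. b \<le> a \<Longrightarrow> a < m \<Longrightarrow> M $$ (a, b) = 0"
  obtains D and \<phi> :: "root \<Rightarrow> 'a" where "(D, \<phi>) \<in> basic_pairs c n" "M = e_mat c n D \<phi>"
proof -
  define D where "D = {\<alpha> \<in> roots c n. M $$ rp \<alpha> \<noteq> 0}"
  define \<phi> where "\<phi> = restrict (\<lambda>\<alpha>. M $$ rp \<alpha>) D"
  have D: "D \<subseteq> roots c n" by (auto simp: D_def)
  have M_mir: "M $$ (a, b) = - (eps a * eps b * M $$ mir (a, b))" if "a < m" "b < m" for a b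
  proof -
    have "dag M $$ (a, b) = - M $$ (a, b)" unfolding dagM using M that by simp
    with dag_index_mir[of "(a, b)" M] that show ?thesis by (metis SigmaI fst_conv lessThan_iff minus_minus snd_conv)
  qed
  have nz: "M $$ e \<noteq> 0" if "e \<in> {rp \<alpha>, mir (rp \<alpha>)}" "\<alpha> \<in> D" for e \<alpha>
  proof -
    obtain a b where ab: "rp \<alpha> = (a, b)" by force
    have lt: "a < m" "b < m" using RP_bounds[OF rp_in_RP[of \<alpha>]] that(2) D by (auto simp: ab)
    have "M $$ (a, b) \<noteq> 0" using that(2) by (simp add: D_def ab)
    with M_mir[OF lt] that(1) show ?thesis by (auto simp: ab)
  qed
  have ent: "M $$ (pos c n i, pos c n j) \<noteq> 0 \<and> pos c n i < m \<and> pos c n j < m \<and> i \<in> labels \<and> j \<in> labels"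
    if "(i, j) \<in> (\<Union>\<alpha>\<in>D. entries \<alpha>)" for i j
  proof -
    from that obtain \<alpha> where \<alpha>: "\<alpha> \<in> D" "(i, j) \<in> entries \<alpha>" by auto
    hence r: "\<alpha> \<in> roots c n" using D by auto
    have e: "(pos c n i, pos c n j) \<in> {rp \<alpha>, mir (rp \<alpha>)}"
      using entries_pos(1)[OF r] \<alpha>(2) by (metis (mono_tags, lifting) case_prod_conv image_eqI)
    moreover have "pos c n i < m \<and> pos c n j < m"
      using e RP_bounds[OF rp_in_RP[OF r]] unfolding mir_def by (cases "rp \<alpha>") auto
    ultimately show ?thesis using nz[OF e \<alpha>(1)] entries_pos(2)[OF r] \<alpha>(2) by auto
  qed
  have "basic c n D"
    unfolding basic_def
  proof (intro conjI D inj_onI)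
    fix e e' assume e: "e \<in> (\<Union>\<alpha>\<in>D. entries \<alpha>)" "e' \<in> (\<Union>\<alpha>\<in>D. entries \<alpha>)" "fst e = fst e'"
    obtain i j j' where ij: "e = (i, j)" "e' = (i, j')" using e(3) by (metis prod.collapse)
    have "pos c n j = pos c n j'"
      using monomial_rowD[OF mon, of "pos c n i"] ent[of i j] ent[of i j'] e ij by auto
    thus "e = e'" using pos_inj ent[of i j] ent[of i j'] e ij by auto
  next
    fix e e' assume e: "e \<in> (\<Union>\<alpha>\<in>D. entries \<alpha>)" "e' \<in> (\<Union>\<alpha>\<in>D. entries \<alpha>)" "snd e = snd e'"
    obtain i i' j where ij: "e = (i, j)" "e' = (i', j)" using e(3) by (metis prod.collapse)
    have "pos c n i = pos c n i'"
      using monomial_colD[OF mon, of "pos c n i" "pos c n j"] ent[of i j] ent[of i' j] e ij by auto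
    thus "e = e'" using pos_inj ent[of i j] ent[of i' j] e ij by auto
  qed
  hence pair: "(D, \<phi>) \<in> basic_pairs c n"
    by (auto simp: basic_pairs_def \<phi>_def D_def)
  have E_mir: "e_mat c n D \<phi> $$ (a, b) = - (eps a * eps b * e_mat c n D \<phi> $$ mir (a, b))" if "a < m" "b < m" for a b
  proof -
    have "dag (e_mat c n D \<phi>) $$ (a, b) = - e_mat c n D \<phi> $$ (a, b)" unfolding dag_e_mat[OF D] using that by simp
    with dag_index_mir[of "(a, b)" "e_mat c n D \<phi>"] that show ?thesis by (metis SigmaI fst_conv lessThan_iff minus_minus snd_conv)
  qed
  have half: "e_mat c n D \<phi> $$ (a, b) = M $$ (a, b)" if ab: "a < m" "b < m" "a + b \<le> m - 1" for a b
  proof (cases "a < b")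
    case False
    thus ?thesis using strict[of b a] e_mat_strict[OF D, of b a] ab by simp
  next
    case True
    show ?thesis
    proof (cases "(a, b) \<in> RP")
      case True
      then obtain \<alpha> where \<alpha>: "\<alpha> \<in> roots c n" "rp \<alpha> = (a, b)" using rp_surj by metis
      show ?thesis using e_mat_rp[OF D \<alpha>(1), of \<phi>] \<alpha> by (auto simp: D_def \<phi>_def)
    next
      case notRP: False
      have "rk c \<le> 1" using rk_cases by auto
      hence s: "a + b = m - 1" "\<not> sp" using notRP True ab m_eq unfolding RP_def by auto
      hence mir: "mir (a, b) = (a, b)" unfolding mir_def using ab by auto
      have eps: "eps a * eps b = 1" using s by (simp add: eps_sp)
      have "M $$ (a, b) = - M $$ (a, b)" "e_mat c n D \<phi> $$ (a, b) = - e_mat c n D \<phi> $$ (a, b)"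
        using M_mir[OF ab(1,2)] E_mir[OF ab(1,2)] unfolding mir eps mult_1 .
      thus ?thesis by (simp only: eq_neg_self)
    qed
  qed
  have "M = e_mat c n D \<phi>"
  proof (rule eq_matI)
    fix a b assume "a < dim_row (e_mat c n D \<phi>)" "b < dim_col (e_mat c n D \<phi>)"
    hence ab: "a < m" "b < m" by auto
    show "M $$ (a, b) = e_mat c n D \<phi> $$ (a, b)"
    proof (cases "a + b \<le> m - 1")
      case True with half ab show ?thesis by simp
    next
      case False
      obtain a' b' where m': "mir (a, b) = (a', b')" by force
      hence "a' < m" "b' < m" "a' + b' \<le> m - 1" using ab False unfolding mir_def by auto
      from half[OF this] show ?thesis unfolding M_mir[OF ab] E_mir[OF ab] m' by simp
    qed
  qed (use M in auto)
  with pair that show ?thesis by blast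
qed

text \<open>At \<open>rp \<alpha>\<close> no root other than \<open>\<alpha>\<close> contributes,
  and the values of \<open>\<phi>\<close> are nonzero, so these entries reveal the set and the map;
  outside the set both maps are \<open>undefined\<close>.\<close>

lemma e_mat_inj:
  fixes \<phi> \<phi>' :: "root \<Rightarrow> 'a"
  assumes P: "(D, \<phi>) \<in> basic_pairs c n" "(D', \<phi>') \<in> basic_pairs c n"
    and eq: "\<And>\<alpha>. \<alpha> \<in> roots c n \<Longrightarrow> e_mat c n D \<phi> $$ rp \<alpha> = e_mat c n D' \<phi>' $$ rp \<alpha>"
  shows "D = D'" "\<phi> = \<phi>'"
proof -
  have D: "D \<subseteq> roots c n" "D' \<subseteq> roots c n" and \<phi>: "\<phi> \<in> D \<rightarrow>\<^sub>E (UNIV - {0})" "\<phi>' \<in> D' \<rightarrow>\<^sub>E (UNIV - {0})"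
    using P by (auto simp: basic_pairs_def basic_def)
  have e: "(if \<alpha> \<in> D then \<phi> \<alpha> else 0) = (if \<alpha> \<in> D' then \<phi>' \<alpha> else 0)" if "\<alpha> \<in> roots c n" for \<alpha>
    using eq[OF that] e_mat_rp[OF D(1) that] e_mat_rp[OF D(2) that] by metis
  show DD: "D = D'"
  proof (intro equalityI subsetI)
    fix \<alpha> assume "\<alpha> \<in> D"
    thus "\<alpha> \<in> D'" using e[of \<alpha>] D PiE_mem[OF \<phi>(1), of \<alpha>] by (auto split: if_splits)
  next
    fix \<alpha> assume "\<alpha> \<in> D'"
    thus "\<alpha> \<in> D" using e[of \<alpha>] D PiE_mem[OF \<phi>(2), of \<alpha>] by (auto split: if_splits)
  qed
  show "\<phi> = \<phi>'"
  proof
    fix \<alpha> show "\<phi> \<alpha> = \<phi>' \<alpha>"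
      using e[of \<alpha>] D \<phi> unfolding DD by (cases "\<alpha> \<in> D'") (auto simp: PiE_def extensional_def)
  qed
qed

section \<open>Superclasses\<close>

lemma V_dim [simp]: "a \<in> V \<Longrightarrow> dim_row a = m" "a \<in> V \<Longrightarrow> dim_col a = m"
  by (auto simp: V_def dest: unitri_dim)

lemma UD:
  assumes "x \<in> U"
  shows "x \<in> V" "x * dag x = 1\<^sub>m m" "dag x * x = 1\<^sub>m m"
proof -
  show 1: "x \<in> V" "x * dag x = 1\<^sub>m m" using assms by (auto simp: U_set_eq)
  show "dag x * x = 1\<^sub>m m"
    using mat_mult_left_right_inverse[OF V_carrier[OF 1(1)] dag_carrier 1(2)] .
qed

lemma UI: "x \<in> V \<Longrightarrow> x * dag x = 1\<^sub>m m \<Longrightarrow> x \<in> U"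
  by (simp add: U_set_eq)

lemma finite_U [simp]: "finite U"
  by (rule finite_subset[OF _ finite_V]) (auto dest: UD)

lemma U_one [simp]: "1\<^sub>m m \<in> U"
  by (rule UI) auto

lemma U_dag [simp]:
  assumes "x \<in> U"
  shows "dag x \<in> U"
  using UD[OF assms] by (intro UI) auto

lemma U_mult [simp]:
  assumes "x \<in> U" "y \<in> U"
  shows "x * y \<in> U"
proof (rule UI)
  note x = UD[OF assms(1)] and y = UD[OF assms(2)]
  show "x * y \<in> V" using x y by simp
  have "x * y * dag (x * y) = x * (y * (dag y * dag x))"
    using x y by (simp add: dag_mult mat_assoc)
  also have "\<dots> = 1\<^sub>m m" using mat_inverse_mult[OF y(2), of "dag x"] x y by simp
  finally show "x * y * dag (x * y) = 1\<^sub>m m" .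
qed

lemma U_grp_simps: "carrier (U_grp c n) = U" "mult (U_grp c n) = (*)" "one (U_grp c n) = (1\<^sub>m m :: 'a mat)"
  by (simp_all add: U_grp_def U_def m_def)

lemma group_U: "group (U_grp c n :: 'a mat monoid)"
  by (rule groupI) (use UD in \<open>force simp: U_grp_simps mat_assoc intro: U_dag U_mult\<close>)+

lemma inv_U: "x \<in> U \<Longrightarrow> m_inv (U_grp c n) x = dag x"
  using group.inv_equality[OF group_U, of "dag x" x] UD[of x] by (simp add: U_grp_simps)

lemma superclass_iff:
  "x \<in> superclass c n D \<phi> \<longleftrightarrow> x \<in> U \<and> (\<exists>a\<in>V. \<exists>b\<in>V. x - 1\<^sub>m m = a * e_mat c n D \<phi> * b)"
  unfolding superclass_def U_def V_def m_def[symmetric] by simp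

lemma basic_pairsD:
  "(D, \<phi>) \<in> basic_pairs c n \<Longrightarrow> basic c n D" "(D, \<phi>) \<in> basic_pairs c n \<Longrightarrow> D \<subseteq> roots c n"
  by (auto simp: basic_pairs_def basic_def)

lemma V_cancel:
  assumes eq: "a * M * b = N" and ab: "a \<in> V" "b \<in> V" and M: "M \<in> carrier_mat m m"
  obtains a' b' where "a' \<in> V" "b' \<in> V" "M = a' * N * b'"
proof -
  obtain a' where a': "a' \<in> V" "a' * a = 1\<^sub>m m" using V_inverse[OF ab(1)] by metis
  obtain b' where b': "b' \<in> V" "b * b' = 1\<^sub>m m" using V_inverse[OF ab(2)] by metis
  have [simp]: "dim_row M = m" "dim_col M = m" using M by auto
  have "a' * N * b' = M"
    unfolding eq[symmetric] using a' b' ab by (simp add: mat_assoc mat_inverse_mult[OF a'(2)])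
  with that a' b' show ?thesis by metis
qed

lemma monomial_unique_V:
  assumes M: "M \<in> carrier_mat m m" "M' \<in> carrier_mat m m" "monomial m M" "monomial m M'"
    and ab: "a \<in> V" "b \<in> V" and eq: "a * M * b = M'"
  shows "M = M'"
proof (rule eq_matI)
  fix i j assume "i < dim_row M'" "j < dim_col M'"
  hence "i < m" "j < m" using M by auto
  thus "M $$ (i, j) = M' $$ (i, j)"
    using monomial_unique[OF _ M ab[unfolded V_def], of "\<lambda>_ _. True" i j] eq
    by (simp add: lower_closed_def)
qed (use M in auto)

lemma superclass_unique:
  fixes \<phi> \<phi>' :: "root \<Rightarrow> 'a"
  assumes P: "(D, \<phi>) \<in> basic_pairs c n" "(D', \<phi>') \<in> basic_pairs c n"
    and x: "x \<in> superclass c n D \<phi>" "x \<in> superclass c n D' \<phi>'"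
  shows "D = D' \<and> \<phi> = \<phi>'"
proof -
  obtain a b where ab: "a \<in> V" "b \<in> V" "x - 1\<^sub>m m = a * e_mat c n D \<phi> * b"
    using x(1) by (auto simp: superclass_iff)
  obtain a' b' where ab': "a' \<in> V" "b' \<in> V" "x - 1\<^sub>m m = a' * e_mat c n D' \<phi>' * b'"
    using x(2) by (auto simp: superclass_iff)
  have "a * e_mat c n D \<phi> * b = a' * e_mat c n D' \<phi>' * b'" using ab(3) ab'(3) by simp
  from V_cancel[OF this ab(1,2) e_mat_carrier] obtain a1 b1 where
    1: "a1 \<in> V" "b1 \<in> V" "e_mat c n D \<phi> = a1 * (a' * e_mat c n D' \<phi>' * b') * b1" by metis
  have eq: "(a1 * a') * e_mat c n D' \<phi>' * (b' * b1) = e_mat c n D \<phi>"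
    using 1 ab' by (simp add: mat_assoc)
  have "e_mat c n D' \<phi>' = e_mat c n D \<phi>"
    by (rule monomial_unique_V[OF e_mat_carrier e_mat_carrier basic_monomial basic_monomial _ _ eq])
      (use P ab' 1(1,2) in \<open>auto dest: basic_pairsD\<close>)
  with e_mat_inj[OF P] show ?thesis by metis
qed

lemma dag_monomial:
  assumes M: "M \<in> carrier_mat m m" and mon: "monomial m M"
  shows "monomial m (- dag M)"
proof (rule monomial_fromI)
  have nz: "M $$ (m - 1 - j, m - 1 - i) \<noteq> 0" if "(- dag M) $$ (i, j) \<noteq> 0" "i < m" "j < m" for i j
    using that by (simp add: dag_index)
  {
    fix i j l assume "i < m" "j < m" "l < m" "(- dag M) $$ (i, j) \<noteq> 0" "(- dag M) $$ (i, l) \<noteq> 0"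
    with monomial_colD[OF mon nz[of i j] nz[of i l]] show "j = l" by auto
  next
    fix i i' j assume "i < m" "i' < m" "j < m" "(- dag M) $$ (i, j) \<noteq> 0" "(- dag M) $$ (i', j) \<noteq> 0"
    with monomial_rowD[OF mon nz[of i j] nz[of i' j]] show "i = i'" by auto
  }
qed

lemma U_minus_one_strict:
  assumes "x \<in> V" "j \<le> i" "i < m"
  shows "(x - 1\<^sub>m m) $$ (i, j) = 0"
  using unitriD(2,3)[OF assms(1)[unfolded V_def], of i] unitriD(2)[OF assms(1)[unfolded V_def], of j i] assms
  by (cases "i = j") auto

lemma lower_closed_le: "lower_closed (\<lambda>i j. j \<le> i)"
  by (auto simp: lower_closed_def)

text \<open>Since \<open>dag x\<close> inverts \<open>x\<close>, the adjoint of
  \<open>N = x - 1\<close> is \<open>- (dag x * N)\<close>. Hence \<open>- dag M\<close> lies in the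
  same double coset as \<open>M\<close>, and as it is monomial too, the two coincide.\<close>

lemma superclass_exists:
  assumes x: "x \<in> U"
  obtains D \<phi> where "(D, \<phi>) \<in> basic_pairs c n" "x \<in> superclass c n D \<phi>"
proof -
  note xU = UD[OF x]
  have xc [simp]: "dim_row x = m" "dim_col x = m" using V_dim[OF xU(1)] by auto
  define N where "N = x - 1\<^sub>m m"
  have Nc: "N \<in> carrier_mat m m" by (auto simp: N_def)
  hence [simp]: "dim_row N = m" "dim_col N = m" by auto
  obtain a b M where ab: "a \<in> V" "b \<in> V" and M: "M \<in> carrier_mat m m" "monomial m M" and N: "N = a * M * b"
    using monomial_exists[OF Nc] unfolding V_def by metis
  from V_cancel[OF N[symmetric] ab M(1)] obtain a' b' where
    ab': "a' \<in> V" "b' \<in> V" and MN: "M = a' * N * b'" by metis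
  have [simp]: "dim_row M = m" "dim_col M = m" using M by auto
  have strict: "M $$ (i, j) = 0" if "j \<le> i" "i < m" for i j
    unfolding MN
    by (rule lower_closed_mult_right[OF lower_closed_le _ _ lower_closed_mult_left[OF lower_closed_le Nc]])
      (use that ab' U_minus_one_strict[OF xU(1)] in \<open>auto simp: N_def V_def[symmetric] simp del: index_mult_mat(1)\<close>)
  have "dag N = - (dag x * N)"
    using xU by (auto simp: N_def dag_minus mat_alg)
  hence "dag M = - (dag b' * dag x * N * dag a')"
    unfolding MN using ab' by (simp add: dag_mult mat_assoc)
  hence "- dag M = (dag b' * dag x * a) * M * (b * dag a')"
    using ab ab' by (simp add: N mat_assoc)
  hence eq: "(dag b' * dag x * a) * M * (b * dag a') = - dag M" ..
  have "M = - dag M"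
    by (rule monomial_unique_V[OF M(1) _ M(2) dag_monomial[OF M] _ _ eq]) (use ab ab' xU in auto)
  hence "dag M = - M" using uminus_uminus_mat by metis
  from skew_monomial_e_mat[OF M this strict] obtain D and \<phi> :: "root \<Rightarrow> 'a"
    where "(D, \<phi>) \<in> basic_pairs c n" "M = e_mat c n D \<phi>" by metis
  with that x ab N show ?thesis unfolding superclass_iff N_def by blast
qed

section \<open>Representatives with prescribed \<open>a_mat\<close>\<close>

lemma U_elt_unique:
  assumes "(x, v, w) \<in> params c n" "(x', v', w') \<in> params c n"
    and eq: "U_elt c n x v w = (U_elt c n x' v' w' :: 'a mat)"
  shows "x = x' \<and> v = v' \<and> w = w'"
proof -
  have x: "x \<in> unitri n" "v \<in> carrier_mat n (rk c)" "w \<in> carrier_mat n n"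
    and x': "x' \<in> unitri n" "v' \<in> carrier_mat n (rk c)" "w' \<in> carrier_mat n n"
    using assms by (auto simp: params_iff)
  have [simp]: "dim_row x = n" "dim_col x = n" "dim_row x' = n" "dim_col x' = n"
    using unitri_carrier[OF x(1)] unitri_carrier[OF x'(1)] by auto
  obtain y where y: "the (mat_inverse x) = y" "y \<in> unitri n" using inverse_the[OF x(1)] by metis
  obtain y' where y': "the (mat_inverse x') = y'" "y' \<in> unitri n" using inverse_the[OF x'(1)] by metis
  have [simp]: "dim_row y = n" "dim_col y = n" "dim_row y' = n" "dim_col y' = n"
    using unitri_carrier[OF y(2)] unitri_carrier[OF y'(2)] by auto
  have "x = x' \<and> x * v = x' * v' \<and> x * w = x' * w'"
    using eq unfolding U_elt_def y y'
    by (subst (asm) upper_block_inject[of _ n _ "rk c"]) (use x x' in auto)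
  with inj_onD[OF unitri_mult_inj[OF x(1)]] x x' show ?thesis by metis
qed

text \<open>For \<open>rk c = 0\<close> the matrix \<open>v\<close> has no columns and the
  correction term is zero, so the formula with the correction holds in both cases of
  \<open>a_mat\<close>.\<close>

lemma a_mat_U_elt:
  assumes "(x, v, w) \<in> params c n"
  shows "a_mat c n (U_elt c n x v w :: 'a mat) =
    upper_block (x - 1\<^sub>m n) v (w + (1/2) \<cdot>\<^sub>m (v * transpose_mat v * Jmat n)) (0\<^sub>m (rk c) (rk c))
      (- (transpose_mat v * Jmat n)) (- (Jmat n * transpose_mat (x - 1\<^sub>m n) * Jmat n))"
proof -
  have "(THE (x', v', w'). (x', v', w') \<in> params c n \<and> U_elt c n x v w = U_elt c n x' v' w') = (x, v, w)"
    by (rule the_equality) (use assms U_elt_unique[OF assms] in auto)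
  moreover have "w = w + (1/2) \<cdot>\<^sub>m (v * transpose_mat v * Jmat n)" if "rk c = 0"
    using assms that by (intro eq_matI) (auto simp: params_iff scalar_prod_def)
  ultimately show ?thesis unfolding a_mat_def by auto
qed

lemma mat_add_diff_cancel:
  assumes "A \<in> carrier_mat k l" "B \<in> carrier_mat k l"
  shows "A + B - A = (B :: 'a mat)" "B + A - A = B" "A - B + B = A"
  by (rule eq_matI; use assms in auto)+

lemma skew_blocks:
  assumes e: "e \<in> carrier_mat m m" and strict: "\<And>i j. j \<le> i \<Longrightarrow> i < m \<Longrightarrow> e $$ (i, j) = 0"
    and dag: "dag e = - e"
  obtains A v W where "A \<in> carrier_mat n n" "\<And>i j. j \<le> i \<Longrightarrow> i < n \<Longrightarrow> A $$ (i, j) = 0"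
    "v \<in> carrier_mat n (rk c)" "W \<in> carrier_mat n n"
    "sg \<cdot>\<^sub>m (Jmat n * transpose_mat W) = - (W * Jmat n)"
    "e = upper_block A v W (0\<^sub>m (rk c) (rk c)) (- (transpose_mat v * Jmat n)) (- (Jmat n * transpose_mat A * Jmat n))"
proof -
  have ec: "e \<in> carrier_mat (2 * n + rk c) (2 * n + rk c)" using e m_eq by simp
  have "upper_triangular e" using strict e by (auto simp: upper_triangular_def)
  from upper_block_decompose[OF ec this] obtain A B C D E F where
    car: "A \<in> carrier_mat n n" "B \<in> carrier_mat n (rk c)" "C \<in> carrier_mat n n"
    "D \<in> carrier_mat (rk c) (rk c)" "E \<in> carrier_mat (rk c) n" "F \<in> carrier_mat n n"
    and eb: "e = upper_block A B C D E F" by metis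
  have [simp]: "dim_row A = n" "dim_col A = n" "dim_row B = n" "dim_col B = rk c" "dim_row C = n" "dim_col C = n"
    "dim_row D = rk c" "dim_col D = rk c" "dim_row E = rk c" "dim_col E = n" "dim_row F = n" "dim_col F = n"
    using car by auto
  note ix = upper_block_index[OF car]
  have A0: "A $$ (i, j) = 0" if "j \<le> i" "i < n" for i j
    using strict[of j i] that m_eq by (simp add: eb ix)
  have "D $$ (i, j) = 0" if "i < rk c" "j < rk c" for i j
    using strict[of "n + j" "n + i"] that m_eq rk_cases by (simp add: eb ix)
  hence D: "D = 0\<^sub>m (rk c) (rk c)" by (intro eq_matI) auto
  let ?J = "Jmat n :: 'a mat"
  have neg: "- upper_block A B C D E F = upper_block (- A) (- B) (- C) (- D) (- E) (- F)"
  proof (rule eq_matI)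
    fix i j assume "i < dim_row (upper_block (- A) (- B) (- C) (- D) (- E) (- F))" 
      "j < dim_col (upper_block (- A) (- B) (- C) (- D) (- E) (- F))"
    hence "i < 2 * n + rk c" "j < 2 * n + rk c" by (auto simp: upper_block_def)
    thus "(- upper_block A B C D E F) $$ (i, j) = upper_block (- A) (- B) (- C) (- D) (- E) (- F) $$ (i, j)"
      using ec unfolding eb by (subst upper_block_index[of _ n _ "rk c"]) (auto simp: ix)
  qed (auto simp: upper_block_def)
  have "upper_block (?J * transpose_mat F * ?J) (?J * transpose_mat E)
      (sg \<cdot>\<^sub>m (?J * transpose_mat C * ?J)) (transpose_mat D)
      (transpose_mat B * ?J) (?J * transpose_mat A * ?J) = upper_block (- A) (- B) (- C) (- D) (- E) (- F)"
    using dag unfolding eb dag_upper_block[OF car] neg .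
  hence eqs: "sg \<cdot>\<^sub>m (?J * transpose_mat C * ?J) = - C" "transpose_mat B * ?J = - E" "?J * transpose_mat A * ?J = - F"
    by (subst (asm) upper_block_inject[of _ n _ "rk c"]; simp)+
  have "sg \<cdot>\<^sub>m (?J * transpose_mat C) = (sg \<cdot>\<^sub>m (?J * transpose_mat C * ?J)) * ?J"
    by (simp add: mat_alg)
  also have "\<dots> = - (C * ?J)" unfolding eqs(1) by simp
  finally have "sg \<cdot>\<^sub>m (?J * transpose_mat C) = - (C * ?J)" .
  moreover have "E = - (transpose_mat B * ?J)" "F = - (?J * transpose_mat A * ?J)" unfolding eqs by simp_all
  ultimately show ?thesis using that[OF car(1) A0 car(2,3)] eb D by metis
qed

text \<open>When \<open>W\<close> is corrected, \<open>Jmat n * transpose_mat W\<close> and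
  \<open>W * Jmat n\<close> each lose half of \<open>v * transpose_mat v\<close>, which turns the
  homogeneous condition on \<open>W\<close> into the condition of \<open>params\<close>. This is the
  origin of the 1/2 in \<open>a_mat\<close>.\<close>

lemma params_of_skew:
  assumes x: "x \<in> unitri n" and v: "v \<in> carrier_mat n (rk c)" and W: "W \<in> carrier_mat n n"
    and skewW: "sg \<cdot>\<^sub>m (Jmat n * transpose_mat W) = - (W * Jmat n)"
  shows "(x, v, W - (1/2) \<cdot>\<^sub>m (v * transpose_mat v * Jmat n)) \<in> params c n"
proof -
  let ?J = "Jmat n :: 'a mat"
  let ?S = "v * transpose_mat v"
  define w where "w = W - (1/2) \<cdot>\<^sub>m (?S * ?J)"
  have [simp]: "dim_row v = n" "dim_col v = rk c" "dim_row W = n" "dim_col W = n" "dim_row w = n" "dim_col w = n"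
    using v W by (auto simp: w_def)
  have S: "sg \<cdot>\<^sub>m ?S = ?S"
  proof (cases "rk c = 0")
    case True
    hence "?S = 0\<^sub>m n n" by (intro eq_matI) (auto simp: scalar_prod_def)
    thus ?thesis by simp
  next
    case False
    hence "sg = 1" unfolding sg_def rk_def by (auto split: if_splits)
    thus ?thesis by (intro eq_matI) auto
  qed
  have "sg \<cdot>\<^sub>m (?J * transpose_mat w) = sg \<cdot>\<^sub>m (?J * transpose_mat W) - (1/2) \<cdot>\<^sub>m (sg \<cdot>\<^sub>m ?S)"
    by (rule eq_matI) (auto simp: w_def mat_alg transpose_minus transpose_smult_mat mat_transpose_mult algebra_simps simp del: index_mult_mat(1))
  moreover have "w * ?J = W * ?J - (1/2) \<cdot>\<^sub>m ?S"
    by (simp add: w_def mat_alg)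
  ultimately have "sg \<cdot>\<^sub>m (?J * transpose_mat w) + ?S + w * ?J = - (W * ?J) - (1/2) \<cdot>\<^sub>m ?S + ?S + (W * ?J - (1/2) \<cdot>\<^sub>m ?S)"
    unfolding S skewW by simp
  also have "\<dots> = 0\<^sub>m n n"
    using two_neq_0 by (intro eq_matI) (auto simp: field_simps simp del: index_mult_mat(1))
  finally show ?thesis
    unfolding params_iff w_def[symmetric] using x by simp
qed

lemma skew_representative:
  assumes e: "e \<in> carrier_mat m m" and strict: "\<And>i j. j \<le> i \<Longrightarrow> i < m \<Longrightarrow> e $$ (i, j) = 0"
    and dag: "dag e = - e"
  obtains z a b where "z \<in> U" "a_mat c n z = e" "a \<in> V" "b \<in> V" "z - 1\<^sub>m m = a * e * b"
proof -
  obtain A v W where A: "A \<in> carrier_mat n n" and A0: "\<And>i j. j \<le> i \<Longrightarrow> i < n \<Longrightarrow> A $$ (i, j) = 0"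
    and vW: "v \<in> carrier_mat n (rk c)" "W \<in> carrier_mat n n"
    and W: "sg \<cdot>\<^sub>m (Jmat n * transpose_mat W) = - (W * Jmat n)"
    and eb: "e = upper_block A v W (0\<^sub>m (rk c) (rk c)) (- (transpose_mat v * Jmat n)) (- (Jmat n * transpose_mat A * Jmat n))"
    using skew_blocks[OF assms] by metis
  let ?J = "Jmat n :: 'a mat"
  let ?S = "v * transpose_mat v"
  define x where "x = 1\<^sub>m n + A"
  define w where "w = W - (1/2) \<cdot>\<^sub>m (?S * ?J)"
  have [simp]: "dim_row A = n" "dim_col A = n" "dim_row v = n" "dim_col v = rk c" "dim_row W = n" "dim_col W = n"
    "dim_row x = n" "dim_col x = n" "dim_row w = n" "dim_col w = n"
    using A vW by (auto simp: x_def w_def)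
  have x: "x \<in> unitri n"
    using A0 by (intro unitriI) (auto simp: x_def)
  obtain y where y: "the (mat_inverse x) = y" "y \<in> unitri n" "x * y = 1\<^sub>m n" "y * x = 1\<^sub>m n"
    using inverse_the[OF x] .
  have [simp]: "dim_row y = n" "dim_col y = n" using unitri_carrier[OF y(2)] by auto
  have xA: "x - 1\<^sub>m n = A" unfolding x_def by (rule mat_add_diff_cancel) auto
  have wW: "w + (1/2) \<cdot>\<^sub>m (?S * ?J) = W" unfolding w_def by (rule mat_add_diff_cancel) auto
  have p: "(x, v, w) \<in> params c n"
    unfolding w_def by (rule params_of_skew[OF x vW W])
  define z where "z = (U_elt c n x v w :: 'a mat)"
  have zU: "z \<in> U" unfolding z_def U_def U_set_def using p by blast
  have az: "a_mat c n z = e"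
    unfolding z_def a_mat_U_elt[OF p] xA wW eb ..
  \<comment> \<open>The first row of \<open>a\<close> supplies the factor \<open>x\<close>, and its
    middle block, meeting the block \<open>- (transpose_mat v * ?J)\<close> of \<open>e\<close>,
    turns \<open>x * W\<close> into \<open>x * w\<close>. \<open>b\<close> removes the factor
    \<open>x\<close> again from the first block, where it commutes with \<open>A = x - 1\<close>.
    The last block of \<open>a\<close> turns the last block of \<open>e\<close> into that of
    \<open>z - 1\<close>.\<close>
  define a where "a = upper_block x ((1/2) \<cdot>\<^sub>m (x * v)) (0\<^sub>m n n) (1\<^sub>m (rk c)) (0\<^sub>m (rk c) n) (?J * transpose_mat y * ?J)"
  define b where "b = upper_block y (0\<^sub>m n (rk c)) (0\<^sub>m n n) (1\<^sub>m (rk c)) (0\<^sub>m (rk c) n) (1\<^sub>m n)"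
  have ab: "a \<in> V" "b \<in> V"
    unfolding a_def b_def V_def m_eq[THEN arg_cong[of _ _ unitri]]
    by (rule upper_block_unitri[OF x unitri_one Jmat_transpose_unitri[OF y(2)]]; simp)
      (rule upper_block_unitri[OF y(2) unitri_one unitri_one]; simp)
  have yx: "transpose_mat y * transpose_mat x = 1\<^sub>m n" using y(3) by (simp flip: mat_transpose_mult)
  have yA: "transpose_mat y * transpose_mat A = 1\<^sub>m n - transpose_mat y"
    unfolding xA[symmetric] by (simp add: transpose_minus mat_alg yx)
  have zero: "- 0\<^sub>m k l = (0\<^sub>m k l :: 'a mat)" for k l by (rule eq_matI) auto
  have "a * e * b = upper_block (x * A * y) (x * v) (x * W + (1/2) \<cdot>\<^sub>m (x * v) * (- (transpose_mat v * ?J)))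
      (0\<^sub>m (rk c) (rk c)) (- (transpose_mat v * ?J)) ((?J * transpose_mat y * ?J) * (- (?J * transpose_mat A * ?J)))"
    unfolding a_def b_def eb
    by (subst upper_block_mult[of _ n _ "rk c"]; simp add: zero)+
  moreover have "x * A * y = x - 1\<^sub>m n"
    unfolding xA[symmetric] using y by (simp add: mat_alg mat_inverse_mult[OF y(3)])
  moreover have "x * W + (1/2) \<cdot>\<^sub>m (x * v) * (- (transpose_mat v * ?J)) = x * w"
    unfolding w_def by (rule eq_matI) (auto simp: mat_alg simp del: index_mult_mat(1))
  moreover have "(?J * transpose_mat y * ?J) * (- (?J * transpose_mat A * ?J)) = ?J * transpose_mat y * ?J - 1\<^sub>m n"
  proof -
    have "(?J * transpose_mat y * ?J) * (- (?J * transpose_mat A * ?J)) = - (?J * (transpose_mat y * transpose_mat A) * ?J)"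
      by (simp add: mat_assoc)
    also have "\<dots> = ?J * transpose_mat y * ?J - 1\<^sub>m n"
      unfolding yA by (rule eq_matI) (auto simp: mat_alg simp del: index_mult_mat(1))
    finally show ?thesis .
  qed
  moreover have "z - 1\<^sub>m m = upper_block (x - 1\<^sub>m n) (x * v) (x * w) (0\<^sub>m (rk c) (rk c)) (- (transpose_mat v * ?J))
      (?J * transpose_mat y * ?J - 1\<^sub>m n)"
  proof (rule eq_matI)
    have zb: "z = upper_block x (x * v) (x * w) (1\<^sub>m (rk c)) (- (transpose_mat v * ?J)) (?J * transpose_mat y * ?J)"
      by (simp add: z_def U_elt_def y(1))
    fix i j assume "i < dim_row (upper_block (x - 1\<^sub>m n) (x * v) (x * w) (0\<^sub>m (rk c) (rk c)) (- (transpose_mat v * ?J))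
      (?J * transpose_mat y * ?J - 1\<^sub>m n))" "j < dim_col (upper_block (x - 1\<^sub>m n) (x * v) (x * w) (0\<^sub>m (rk c) (rk c)) (- (transpose_mat v * ?J))
      (?J * transpose_mat y * ?J - 1\<^sub>m n))"
    hence ij: "i < 2 * n + rk c" "j < 2 * n + rk c" by (auto simp: upper_block_def)
    have "(z - 1\<^sub>m m) $$ (i, j) = z $$ (i, j) - (if i = j then 1 else 0)"
      using ij m_eq V_dim[OF UD(1)[OF zU]] by simp
    also have "\<dots> = upper_block (x - 1\<^sub>m n) (x * v) (x * w) (0\<^sub>m (rk c) (rk c)) (- (transpose_mat v * ?J))
      (?J * transpose_mat y * ?J - 1\<^sub>m n) $$ (i, j)"
      unfolding zb using ij
      by (subst (1 2) upper_block_index[of _ n _ "rk c"]) (auto simp del: index_mult_mat(1))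
    finally show "(z - 1\<^sub>m m) $$ (i, j) = \<dots>" .
  qed (auto simp: upper_block_def m_eq)
  ultimately have "z - 1\<^sub>m m = a * e * b" by simp
  with that zU az ab show ?thesis by blast
qed

lemma a_mat_inj:
  assumes z: "z \<in> U" "z' \<in> U" and eq: "a_mat c n z = a_mat c n z'"
  shows "z = z'"
proof -
  obtain x v w where p: "(x, v, w) \<in> params c n" "z = U_elt c n x v w"
    using z(1) unfolding U_def U_set_def by auto
  obtain x' v' w' where p': "(x', v', w') \<in> params c n" "z' = U_elt c n x' v' w'"
    using z(2) unfolding U_def U_set_def by auto
  have c1: "x \<in> carrier_mat n n" "v \<in> carrier_mat n (rk c)" "w \<in> carrier_mat n n"
    using p(1) unfolding params_iff by (auto dest: unitri_carrier)
  have c2: "x' \<in> carrier_mat n n" "v' \<in> carrier_mat n (rk c)" "w' \<in> carrier_mat n n"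
    using p'(1) unfolding params_iff by (auto dest: unitri_carrier)
  have eqs: "x - 1\<^sub>m n = x' - 1\<^sub>m n \<and> v = v' \<and> w + (1/2) \<cdot>\<^sub>m (v * transpose_mat v * Jmat n) = w' + (1/2) \<cdot>\<^sub>m (v' * transpose_mat v' * Jmat n)"
    using eq unfolding p(2) p'(2) a_mat_U_elt[OF p(1)] a_mat_U_elt[OF p'(1)]
    by (subst (asm) upper_block_inject[of _ n _ "rk c"]) (use c1 c2 in auto)
  have "x = x - 1\<^sub>m n + 1\<^sub>m n" "x' = x' - 1\<^sub>m n + 1\<^sub>m n"
    using mat_add_diff_cancel(3)[of x n n "1\<^sub>m n"] mat_add_diff_cancel(3)[of x' n n "1\<^sub>m n"] c1 c2 by auto
  hence "x = x'" using eqs by metis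
  moreover have "w = w + (1/2) \<cdot>\<^sub>m (v * transpose_mat v * Jmat n) - (1/2) \<cdot>\<^sub>m (v * transpose_mat v * Jmat n)"
    "w' = w' + (1/2) \<cdot>\<^sub>m (v * transpose_mat v * Jmat n) - (1/2) \<cdot>\<^sub>m (v * transpose_mat v * Jmat n)"
    by (rule mat_add_diff_cancel(2)[symmetric, of _ n n]; use c1 c2 in auto)+
  hence "w = w'" using eqs by metis
  ultimately show ?thesis using p(2) p'(2) eqs by simp
qed

lemma z_rep_superclass:
  fixes \<phi> :: "root \<Rightarrow> 'a"
  assumes "(D, \<phi>) \<in> basic_pairs c n"
  shows "z_rep c n D \<phi> \<in> superclass c n D \<phi>"
proof -
  note D = basic_pairsD(2)[OF assms]
  obtain z a b where z: "z \<in> U" "a_mat c n z = e_mat c n D \<phi>" "a \<in> V" "b \<in> V" "z - 1\<^sub>m m = a * e_mat c n D \<phi> * b"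
    using skew_representative[OF e_mat_carrier e_mat_strict[OF D] dag_e_mat[OF D]] by metis
  have "z_rep c n D \<phi> = z"
    unfolding z_rep_def U_def[symmetric]
  proof (rule the_equality)
    show "z \<in> U \<and> a_mat c n z = e_mat c n D \<phi>" using z by simp
    fix z' assume "z' \<in> U \<and> a_mat c n z' = e_mat c n D \<phi>"
    thus "z' = z" using a_mat_inj z by metis
  qed
  thus ?thesis using z unfolding superclass_iff by blast
qed

section \<open>Elementary characters\<close>

lemma theta_add: "\<theta> (a + b) = \<theta> a * \<theta> b"
  using additive by (simp add: additive_char_def)

lemma theta_sum: "finite A \<Longrightarrow> \<theta> (\<Sum>x\<in>A. f x) = (\<Prod>x\<in>A. \<theta> (f x))"
proof (induction A rule: finite_induct)
  case empty
  have "\<theta> 0 * \<theta> 0 = \<theta> 0 * 1" "\<theta> 0 \<noteq> 0" using theta_add[of 0 0] additive by (simp_all add: additive_char_def)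
  thus ?case by (simp only: mult_cancel_left) simp
qed (simp add: theta_add)

lemma theta_0 [simp]: "\<theta> 0 = 1"
  using theta_sum[of "{}"] by simp

lemma theta_scale_nontrivial:
  assumes "k \<noteq> 0"
  obtains s where "\<theta> (s * k) \<noteq> 1"
proof -
  obtain a where a: "\<theta> a \<noteq> 1" using nontrivial by blast
  have "a / k * k = a" using assms by simp
  thus ?thesis using that[of "a / k"] a by simp
qed

text \<open>Substituting along \<open>\<tau>\<close> multiplies the sum by
  \<open>\<theta> k\<close>, which is not 1. Every vanishing character sum below arises in this
  way.\<close>

lemma theta_sum_vanishes:
  assumes "bij_betw \<tau> S S" and "\<And>x. x \<in> S \<Longrightarrow> f (\<tau> x) = f x + k" and "\<theta> k \<noteq> 1"
  shows "(\<Sum>x\<in>S. \<theta> (f x)) = 0"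
proof -
  have "(\<Sum>x\<in>S. \<theta> (f x)) = (\<Sum>x\<in>S. \<theta> (f (\<tau> x)))"
    by (rule sum.reindex_bij_betw[OF assms(1), symmetric])
  also have "\<dots> = (\<Sum>x\<in>S. \<theta> (f x)) * \<theta> k"
    using assms(2) by (simp add: theta_add sum_distrib_right)
  finally show ?thesis using assms(3) by (metis mult_cancel_left1)
qed

section \<open>Testing membership in a root subgroup by sums over \<open>Q\<close>\<close>

definition addE :: "nat \<Rightarrow> nat \<Rightarrow> 'a \<Rightarrow> 'a mat \<Rightarrow> 'a mat" where
  "addE k l s A = mat m m (\<lambda>(x, y). A $$ (x, y) + (if x = k \<and> y = l then s else 0))"

lemma addE_dim [simp]: "dim_row (addE k l s A) = m" "dim_col (addE k l s A) = m"
  by (simp_all add: addE_def)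

lemma addE_index: "x < m \<Longrightarrow> y < m \<Longrightarrow> addE k l s A $$ (x, y) = A $$ (x, y) + (if x = k \<and> y = l then s else 0)"
  by (simp add: addE_def)

lemma addE_V: "a \<in> V \<Longrightarrow> k < l \<Longrightarrow> l < m \<Longrightarrow> addE k l s a \<in> V"
  unfolding V_def by (intro unitriI) (auto simp: addE_index unitriD)

lemma addE_inverse: "A \<in> carrier_mat m m \<Longrightarrow> addE k l (- s) (addE k l s A) = A"
  by (rule eq_matI) (auto simp: addE_index)

lemma mult_addE_index:
  assumes "A \<in> carrier_mat m m" "B \<in> carrier_mat m m" "x < m" "k < m" "l < m"
  shows "(A * addE k l s B) $$ (x, l) = (A * B) $$ (x, l) + s * A $$ (x, k)"
proof -
  have "(A * addE k l s B) $$ (x, l) = (\<Sum>y<m. A $$ (x, y) * addE k l s B $$ (y, l))"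
    by (rule mult_mat_entry) (use assms in auto)
  also have "\<dots> = (\<Sum>y<m. A $$ (x, y) * B $$ (y, l) + (if y = k then s * A $$ (x, y) else 0))"
    by (rule sum.cong) (use assms in \<open>auto simp: addE_index algebra_simps\<close>)
  also have "\<dots> = (\<Sum>y<m. A $$ (x, y) * B $$ (y, l)) + s * A $$ (x, k)"
    using assms by (simp add: sum.distrib sum.delta)
  also have "(\<Sum>y<m. A $$ (x, y) * B $$ (y, l)) = (A * B) $$ (x, l)"
    by (rule mult_mat_entry[symmetric]) (use assms in auto)
  finally show ?thesis .
qed

lemma addE_mult_index:
  assumes "A \<in> carrier_mat m m" "B \<in> carrier_mat m m" "y < m" "k < m" "l < m"
  shows "(addE k l s A * B) $$ (k, y) = (A * B) $$ (k, y) + s * B $$ (l, y)"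
proof -
  have "(addE k l s A * B) $$ (k, y) = (\<Sum>x<m. addE k l s A $$ (k, x) * B $$ (x, y))"
    by (rule mult_mat_entry) (use assms in auto)
  also have "\<dots> = (\<Sum>x<m. A $$ (k, x) * B $$ (x, y) + (if x = l then s * B $$ (x, y) else 0))"
    by (rule sum.cong) (use assms in \<open>auto simp: addE_index algebra_simps\<close>)
  also have "\<dots> = (\<Sum>x<m. A $$ (k, x) * B $$ (x, y)) + s * B $$ (l, y)"
    using assms by (simp add: sum.distrib sum.delta)
  also have "(\<Sum>x<m. A $$ (k, x) * B $$ (x, y)) = (A * B) $$ (k, y)"
    by (rule mult_mat_entry[symmetric]) (use assms in auto)
  finally show ?thesis .
qed

lemma mult_entry_single:
  assumes "A \<in> carrier_mat m m" "B \<in> carrier_mat m m" "x < m" "y < m" "k < m"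
    and "\<And>z. z < m \<Longrightarrow> z \<noteq> k \<Longrightarrow> A $$ (x, z) = 0 \<or> B $$ (z, y) = 0"
  shows "(A * B) $$ (x, y) = A $$ (x, k) * B $$ (k, y)"
proof -
  have "(A * B) $$ (x, y) = (\<Sum>z<m. A $$ (x, z) * B $$ (z, y))"
    by (rule mult_mat_entry) (use assms in auto)
  also have "\<dots> = (\<Sum>z\<in>{k}. A $$ (x, z) * B $$ (z, y))"
  proof (rule sum.mono_neutral_right)
    show "\<forall>z\<in>{..<m} - {k}. A $$ (x, z) * B $$ (z, y) = 0"
      using assms(6) by fastforce
  qed (use assms(5) in auto)
  finally show ?thesis by simp
qed

lemma V_entries:
  assumes "a \<in> V"
  shows "j < i \<Longrightarrow> i < m \<Longrightarrow> a $$ (i, j) = 0" "i < m \<Longrightarrow> a $$ (i, i) = 1"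
  using unitriD[OF assms[unfolded V_def]] by auto

text \<open>All subgroups \<open>U\<^sub>\<alpha>\<close> have the form \<open>stab i j t\<close>: for \<open>\<epsilon>\<^sub>i + \<epsilon>\<^sub>j\<close> the condition on row \<open>j\<close> becomes a
  condition on column \<open>-j\<close>, because \<open>x\<^sup>-\<^sup>1 = x\<^sup>\<dagger>\<close>, and \<open>t = n\<close> separates the two conditions.\<close>

definition Q :: "nat \<Rightarrow> nat \<Rightarrow> nat \<Rightarrow> ('a mat \<times> 'a mat) set" where
  "Q i j t = {(a, b) \<in> V \<times> V. (\<forall>k. i < k \<and> k < t \<longrightarrow> a $$ (i, k) = 0) \<and> (\<forall>k. t \<le> k \<and> k < j \<longrightarrow> b $$ (k, j) = 0)}"

definition stab :: "nat \<Rightarrow> nat \<Rightarrow> nat \<Rightarrow> 'a mat \<Rightarrow> bool" where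
  "stab i j t y \<longleftrightarrow> (\<forall>k. i < k \<and> k < t \<longrightarrow> y $$ (i, k) = 0) \<and> (\<forall>k. t \<le> k \<and> k < j \<longrightarrow> y $$ (k, j) = 0)"

lemma finite_Q [simp]: "finite (Q i j t)"
  by (rule finite_subset[of _ "V \<times> V"]) (auto simp: Q_def)

lemma one_in_Q: "t \<le> j \<Longrightarrow> j < m \<Longrightarrow> (1\<^sub>m m, 1\<^sub>m m) \<in> Q i j t"
  by (auto simp: Q_def)

text \<open>Apart from the diagonal, row \<open>i\<close> of \<open>a\<close> lives in columns from
  \<open>t\<close> on, and the rows of the strictly upper triangular \<open>N\<close> with these
  indices vanish in columns before \<open>t\<close>. For column \<open>j\<close> the extra
  hypothesis takes over this role.\<close>

lemma Q_left:
  assumes "(a, b) \<in> Q i j t" "i < t" "t \<le> j" "j < m" and N: "N \<in> carrier_mat m m"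
    and strict: "\<And>k l. l \<le> k \<Longrightarrow> k < m \<Longrightarrow> N $$ (k, l) = 0"
    and l: "l < t \<or> l = j \<and> (\<forall>k. t \<le> k \<and> k < j \<longrightarrow> N $$ (k, j) = 0)"
  shows "(a * N) $$ (i, l) = N $$ (i, l)"
proof -
  have a: "a \<in> V" "\<And>k. i < k \<Longrightarrow> k < t \<Longrightarrow> a $$ (i, k) = 0" using assms(1) by (auto simp: Q_def)
  have "(a * N) $$ (i, l) = a $$ (i, i) * N $$ (i, l)"
  proof (rule mult_entry_single)
    fix z assume z: "z < m" "z \<noteq> i"
    show "a $$ (i, z) = 0 \<or> N $$ (z, l) = 0"
      using z V_entries(1)[OF a(1), of z i] a(2)[of z] strict[of l z] l assms(2-4)
      by (cases "z < i"; cases "z < t"; cases "z < j") auto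
  qed (use a N assms(2-4) l in auto)
  thus ?thesis using V_entries(2)[OF a(1)] assms(2-4) by simp
qed

lemma Q_right:
  assumes "(a, b) \<in> Q i j t" "i < t" "t \<le> j" "j < m" and N: "N \<in> carrier_mat m m"
    and strict: "\<And>k l. l \<le> k \<Longrightarrow> k < m \<Longrightarrow> N $$ (k, l) = 0"
    and k: "t \<le> k" "k < j"
  shows "(N * b) $$ (k, j) = N $$ (k, j)"
proof -
  have b: "b \<in> V" "\<And>k. t \<le> k \<Longrightarrow> k < j \<Longrightarrow> b $$ (k, j) = 0" using assms(1) by (auto simp: Q_def)
  have "(N * b) $$ (k, j) = N $$ (k, j) * b $$ (j, j)"
  proof (rule mult_entry_single)
    fix z assume z: "z < m" "z \<noteq> j"
    show "N $$ (k, z) = 0 \<or> b $$ (z, j) = 0"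
      using z V_entries(1)[OF b(1), of j z] b(2)[of z] strict[of z k] k assms(2-4)
      by (cases "j < z"; cases "z < t") auto
  qed (use b N assms(2-4) k in auto)
  thus ?thesis using V_entries(2)[OF b(1)] assms(2-4) by simp
qed

lemma Q_value:
  assumes ab: "(a, b) \<in> Q i j t" and t: "i < t" "t \<le> j" "j < m" and N: "N \<in> carrier_mat m m"
    and strict: "\<And>k l. l \<le> k \<Longrightarrow> k < m \<Longrightarrow> N $$ (k, l) = 0"
    and N0: "\<And>l. i < l \<Longrightarrow> l < t \<Longrightarrow> N $$ (i, l) = 0" "\<And>k. t \<le> k \<Longrightarrow> k < j \<Longrightarrow> N $$ (k, j) = 0"
  shows "(a * N * b) $$ (i, j) = N $$ (i, j)"
proof -
  have b: "b \<in> V" "a \<in> V" "\<And>k. t \<le> k \<Longrightarrow> k < j \<Longrightarrow> b $$ (k, j) = 0" using ab by (auto simp: Q_def)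
  have "(a * N * b) $$ (i, j) = (a * N) $$ (i, j) * b $$ (j, j)"
  proof (rule mult_entry_single)
    fix l assume l: "l < m" "l \<noteq> j"
    have "(a * N) $$ (i, l) = 0" if "l < t"
    proof -
      have "N $$ (i, l) = 0" using N0(1)[of l] strict[of l i] that t l by (cases "l \<le> i") auto
      thus ?thesis using Q_left[OF ab t N strict, of l] that by simp
    qed
    thus "(a * N) $$ (i, l) = 0 \<or> b $$ (l, j) = 0"
      using V_entries(1)[OF b(1), of j l] b(3)[of l] l by (cases "l < t"; cases "l < j") auto
  qed (use b N t in auto)
  thus ?thesis using Q_left[OF ab t N strict, of j] N0(2) V_entries(2)[OF b(1)] t by simp
qed

text \<open>The coordinates left free in \<open>Q\<close> are dual to the conditions of
  \<open>stab\<close>. An entry \<open>y $$ (i, l) \<noteq> 0\<close> with \<open>i < l < t\<close>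
  is the coefficient of the free entry \<open>b $$ (l, j)\<close>, and
  \<open>y $$ (k, j) \<noteq> 0\<close> with \<open>t \<le> k < j\<close> that of the free entry
  \<open>a $$ (i, k)\<close>; varying the free entry makes the sum vanish. Without such an
  obstruction neither \<open>a\<close> nor \<open>b\<close> affects the position
  \<open>(i, j)\<close>.\<close>

lemma Q_sum:
  assumes y: "y \<in> V" and t: "i < t" "t \<le> j" "j < m" and r: "r \<noteq> 0"
  shows "(\<Sum>(a, b)\<in>Q i j t. \<theta> (r * (a * (y - 1\<^sub>m m) * b) $$ (i, j))) =
    (if stab i j t y then of_nat (card (Q i j t)) * \<theta> (r * y $$ (i, j)) else 0)"
proof -
  define N where "N = y - 1\<^sub>m m"
  have N: "N \<in> carrier_mat m m" using y by (simp add: N_def)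
  have strict: "N $$ (k, l) = 0" if "l \<le> k" "k < m" for k l
    unfolding N_def by (rule U_minus_one_strict[OF y that])
  have Ny: "N $$ (k, l) = y $$ (k, l)" if "k < l" "l < m" for k l
    using that y by (simp add: N_def)
  show ?thesis
  proof (cases "stab i j t y")
    case True
    have "(a * N * b) $$ (i, j) = y $$ (i, j)" if ab: "(a, b) \<in> Q i j t" for a b
      using Q_value[OF ab t N strict] True Ny t by (simp add: stab_def del: index_mult_mat(1))
    hence "(\<Sum>(a, b)\<in>Q i j t. \<theta> (r * (a * N * b) $$ (i, j))) = (\<Sum>(a, b)\<in>Q i j t. \<theta> (r * y $$ (i, j)))"
      by (intro sum.cong) auto
    thus ?thesis using True by (simp add: N_def[symmetric] case_prod_unfold)
  next
    case False
    have "(\<Sum>p\<in>Q i j t. \<theta> (r * (fst p * N * snd p) $$ (i, j))) = 0"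
    proof (cases "\<exists>l. i < l \<and> l < t \<and> y $$ (i, l) \<noteq> 0")
      case True
      then obtain l where l: "i < l" "l < t" "y $$ (i, l) \<noteq> 0" by blast
      with r obtain s where s: "\<theta> (s * (r * y $$ (i, l))) \<noteq> 1" using theta_scale_nontrivial[of "r * y $$ (i, l)"] by auto
      show ?thesis
      proof (rule theta_sum_vanishes[of "\<lambda>p. (fst p, addE l j s (snd p))"])
        show "bij_betw (\<lambda>p. (fst p, addE l j s (snd p))) (Q i j t) (Q i j t)"
          by (rule bij_betw_byWitness[of _ "\<lambda>p. (fst p, addE l j (- s) (snd p))"])
            (use l t in \<open>auto simp: Q_def addE_V addE_index addE_inverse addE_inverse[of _ _ _ "- s", simplified]\<close>)
        fix p assume p: "p \<in> Q i j t"
        hence ab: "(fst p, snd p) \<in> Q i j t" "fst p \<in> V" "snd p \<in> V" by (auto simp: Q_def)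
        have "(fst p * N * addE l j s (snd p)) $$ (i, j) = (fst p * N * snd p) $$ (i, j) + s * (fst p * N) $$ (i, l)"
          by (rule mult_addE_index) (use ab N t l in auto)
        also have "(fst p * N) $$ (i, l) = y $$ (i, l)"
          using Q_left[OF ab(1) t N strict, of l] Ny[of i l] l t by simp
        finally show "r * (fst (fst p, addE l j s (snd p)) * N * snd (fst p, addE l j s (snd p))) $$ (i, j) =
            r * (fst p * N * snd p) $$ (i, j) + s * (r * y $$ (i, l))" by (simp add: algebra_simps del: index_mult_mat(1))
      qed (rule s)
    next
      case nex: False
      then obtain k where k: "t \<le> k" "k < j" "y $$ (k, j) \<noteq> 0" using False by (auto simp: stab_def)
      with r obtain s where s: "\<theta> (s * (r * y $$ (k, j))) \<noteq> 1" using theta_scale_nontrivial[of "r * y $$ (k, j)"] by auto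
      show ?thesis
      proof (rule theta_sum_vanishes[of "\<lambda>p. (addE i k s (fst p), snd p)"])
        show "bij_betw (\<lambda>p. (addE i k s (fst p), snd p)) (Q i j t) (Q i j t)"
          by (rule bij_betw_byWitness[of _ "\<lambda>p. (addE i k (- s) (fst p), snd p)"])
            (use k t in \<open>auto simp: Q_def addE_V addE_index addE_inverse addE_inverse[of _ _ _ "- s", simplified]\<close>)
        fix p assume p: "p \<in> Q i j t"
        hence ab: "(fst p, snd p) \<in> Q i j t" "fst p \<in> V" "snd p \<in> V" by (auto simp: Q_def)
        have "(addE i k s (fst p) * N * snd p) $$ (i, j) = (addE i k s (fst p) * (N * snd p)) $$ (i, j)"
          using ab N by (subst mat_assoc) auto
        also have "\<dots> = (fst p * (N * snd p)) $$ (i, j) + s * (N * snd p) $$ (k, j)"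
          by (rule addE_mult_index) (use ab N t k in auto)
        also have "(N * snd p) $$ (k, j) = y $$ (k, j)"
          using Q_right[OF ab(1) t N strict k(1,2)] Ny[of k j] k t by simp
        also have "fst p * (N * snd p) = fst p * N * snd p"
          using ab N by (subst mat_assoc) auto
        finally show "r * (fst (addE i k s (fst p), snd p) * N * snd (addE i k s (fst p), snd p)) $$ (i, j) =
            r * (fst p * N * snd p) $$ (i, j) + s * (r * y $$ (k, j))" by (simp add: algebra_simps del: index_mult_mat(1))
      qed (rule s)
    qed
    thus ?thesis using False by (simp add: N_def[symmetric] case_prod_unfold)
  qed
qed

text \<open>These entries are free parameters of \<open>U\<close>: they are those of
  \<open>x\<close> and of \<open>x * v\<close>, and \<open>w\<close> is completed by
  \<open>params_of_skew\<close> with \<open>W = 0\<close>.\<close>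

lemma U_prescribed_rows:
  fixes f :: "nat \<Rightarrow> nat \<Rightarrow> 'a"
  obtains h where "h \<in> U" "\<And>p q. p < n \<Longrightarrow> p < q \<Longrightarrow> q < n + rk c \<Longrightarrow> h $$ (p, q) = f p q"
proof -
  define x where "x = mat n n (\<lambda>(p, q). if p = q then 1 else if p < q then f p q else 0)"
  have x: "x \<in> unitri n" unfolding x_def by (rule unitriI) auto
  obtain y where y: "the (mat_inverse x) = y" "y \<in> unitri n" "x * y = 1\<^sub>m n" "y * x = 1\<^sub>m n"
    using inverse_the[OF x] .
  define u where "u = mat n (rk c) (\<lambda>(p, k). f p (n + k))"
  have [simp]: "dim_row x = n" "dim_col x = n" "dim_row y = n" "dim_col y = n" "dim_row u = n" "dim_col u = rk c"
    using unitri_carrier[OF y(2)] by (auto simp: x_def u_def)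
  define v where "v = y * u"
  define w where "w = 0\<^sub>m n n - (1/2) \<cdot>\<^sub>m (v * transpose_mat v * Jmat n)"
  have p: "(x, v, w) \<in> params c n"
    unfolding w_def by (rule params_of_skew[OF x]) (simp_all add: v_def, rule eq_matI, simp_all)
  have [simp]: "dim_row v = n" "dim_col v = rk c" "dim_row w = n" "dim_col w = n" by (auto simp: v_def w_def)
  define h where "h = (U_elt c n x v w :: 'a mat)"
  have hU: "h \<in> U" unfolding h_def U_def U_set_def using p by blast
  have xv: "x * v = u" unfolding v_def by (rule mat_inverse_mult[OF y(3)]) auto
  have "h $$ (p, q) = f p q" if "p < n" "p < q" "q < n + rk c" for p q
    unfolding h_def U_elt_def y(1) xv using that
    by (subst upper_block_index[of _ n _ "rk c"]) (auto simp: x_def u_def)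
  with that hU show ?thesis by blast
qed

text \<open>\<open>a * dag h = 1 + (a - h) * dag h\<close>, and row \<open>i\<close> of
  \<open>a - h\<close> is zero before column \<open>t\<close>, so upper triangularity of
  \<open>dag h\<close> leaves only the identity there; symmetrically for
  \<open>h * b = 1 + h * (b - dag h)\<close>.\<close>

lemma U_into_Q:
  assumes ab: "a \<in> V" "b \<in> V" and t: "i < t" "t \<le> j" "j < m"
    and h: "h \<in> U" "\<And>k. i < k \<Longrightarrow> k < t \<Longrightarrow> h $$ (i, k) = a $$ (i, k)"
      "\<And>k. t \<le> k \<Longrightarrow> k < j \<Longrightarrow> dag h $$ (k, j) = b $$ (k, j)"
  shows "(a * dag h, h * b) \<in> Q i j t"
proof -
  note hU = UD[OF h(1)]
  have [simp]: "dim_row a = m" "dim_col a = m" "dim_row b = m" "dim_col b = m" "dim_row h = m" "dim_col h = m"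
    using ab hU by auto
  have "(a * dag h) $$ (i, k) = 0" if k: "i < k" "k < t" for k
  proof -
    have "a * dag h = (a - h) * dag h + h * dag h"
      by (simp add: mat_alg mat_add_diff_cancel(3)[of _ m m])
    hence "(a * dag h) $$ (i, k) = ((a - h) * dag h) $$ (i, k) + (1\<^sub>m m) $$ (i, k)"
      unfolding hU(2) using k t by (simp del: index_mult_mat(1))
    also have "((a - h) * dag h) $$ (i, k) = (a - h) $$ (i, i) * dag h $$ (i, k)"
    proof (rule mult_entry_single)
      fix z assume z: "z < m" "z \<noteq> i"
      show "(a - h) $$ (i, z) = 0 \<or> dag h $$ (z, k) = 0"
        using z k t h(2)[of z] V_entries(1)[OF ab(1), of z i] V_entries(1)[OF hU(1), of z i]
          V_entries(1)[OF V_dag[OF hU(1)], of k z]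
        by (cases "z < i"; cases "z < t") auto
    qed (use k t in auto)
    also have "(a - h) $$ (i, i) = 0" using V_entries(2)[OF ab(1), of i] V_entries(2)[OF hU(1), of i] t by simp
    finally show ?thesis using k t by simp
  qed
  moreover have "(h * b) $$ (k, j) = 0" if k: "t \<le> k" "k < j" for k
  proof -
    have "h * b = h * (b - dag h) + h * dag h"
      by (simp add: mat_alg mat_add_diff_cancel(3)[of _ m m])
    hence "(h * b) $$ (k, j) = (h * (b - dag h)) $$ (k, j) + (1\<^sub>m m) $$ (k, j)"
      unfolding hU(2) using k t by (simp del: index_mult_mat(1))
    also have "(h * (b - dag h)) $$ (k, j) = h $$ (k, j) * (b - dag h) $$ (j, j)"
    proof (rule mult_entry_single)
      fix z assume z: "z < m" "z \<noteq> j"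
      show "h $$ (k, z) = 0 \<or> (b - dag h) $$ (z, j) = 0"
        using z k t h(3)[of z] V_entries(1)[OF ab(2), of j z] V_entries(1)[OF hU(1), of z k]
          V_entries(1)[OF V_dag[OF hU(1)], of j z]
        by (cases "z < k"; cases "z < j") auto
    qed (use k t in auto)
    also have "(b - dag h) $$ (j, j) = 0" using V_entries(2)[OF ab(2), of j] V_entries(2)[OF V_dag[OF hU(1)], of j] t by simp
    finally show ?thesis using k t by simp
  qed
  ultimately show ?thesis using ab hU by (auto simp: Q_def simp del: index_mult_mat(1))
qed

text \<open>\<open>t = j\<close> leaves only a row condition and serves
  \<open>\<epsilon>\<^sub>i - \<epsilon>\<^sub>j\<close> and \<open>\<epsilon>\<^sub>i\<close>, and
  with \<open>j = n\<close> also \<open>2\<epsilon>\<^sub>i\<close>, where the second matrix of a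
  pair is a dummy; the other alternative serves
  \<open>\<epsilon>\<^sub>i + \<epsilon>\<^sub>j\<close>. There \<open>p\<close> must differ from
  \<open>i\<close>: row \<open>i\<close> of \<open>h\<close> and column \<open>j\<close> of
  \<open>dag h\<close> are prescribed at the same time, and for \<open>p = i\<close> they would be
  the same data.\<close>

definition admissible :: "nat \<Rightarrow> nat \<Rightarrow> nat \<Rightarrow> bool" where
  "admissible i j t \<longleftrightarrow> i < t \<and> t \<le> j \<and> j < m \<and> i < n \<and>
     (t = j \<and> j \<le> n \<or> t = n \<and> (\<exists>p. i < p \<and> p < n \<and> j = m - 1 - p))"

lemma U_into_Q_exists:
  assumes ab: "a \<in> V" "b \<in> V" and adm: "admissible i j t"
  obtains g where "g \<in> U" "(a * g, dag g * b) \<in> Q i j t"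
proof -
  have t: "i < t" "t \<le> j" "j < m" "i < n" using adm by (auto simp: admissible_def)
  consider "t = j" "j \<le> n" | p where "t = n" "i < p" "p < n" "j = m - 1 - p"
    using adm by (auto simp: admissible_def)
  then obtain h where h: "h \<in> U" "\<And>k. i < k \<Longrightarrow> k < t \<Longrightarrow> h $$ (i, k) = a $$ (i, k)"
    "\<And>k. t \<le> k \<Longrightarrow> k < j \<Longrightarrow> dag h $$ (k, j) = b $$ (k, j)"
  proof cases
    case 1
    obtain h where "h \<in> U" "\<And>p q. p < n \<Longrightarrow> p < q \<Longrightarrow> q < n + rk c \<Longrightarrow> h $$ (p, q) = a $$ (p, q)"
      using U_prescribed_rows[of "\<lambda>p q. a $$ (p, q)"] by metis
    with 1 t that show ?thesis by auto
  next
    case (2 p)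
    \<comment> \<open>Column \<open>j\<close> of \<open>dag h\<close> is row \<open>p\<close> of
      \<open>h\<close> reflected, so this row is filled with the reflected column of
      \<open>b\<close>, while row \<open>i\<close> copies \<open>a\<close>.\<close>
    define f where "f = (\<lambda>r q. if r = p then eps (m - 1 - q) * eps j * b $$ (m - 1 - q, j) else a $$ (r, q))"
    obtain h where h: "h \<in> U" "\<And>p q. p < n \<Longrightarrow> p < q \<Longrightarrow> q < n + rk c \<Longrightarrow> h $$ (p, q) = f p q"
      using U_prescribed_rows[of f] by metis
    show ?thesis
    proof (rule that[OF h(1)])
      fix k assume "i < k" "k < t"
      thus "h $$ (i, k) = a $$ (i, k)" using h(2)[of i k] 2 t by (simp add: f_def)
    next
      fix k assume k: "t \<le> k" "k < j"
      hence lt: "k < m" "p < m - 1 - k" "m - 1 - k < n + rk c" "m - 1 - (m - 1 - k) = k" "m - 1 - j = p"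
        using 2 t m_eq by auto
      have "dag h $$ (k, j) = eps k * eps j * f p (m - 1 - k)"
        using h(2)[OF 2(3) lt(2,3)] lt t by (simp add: dag_index)
      hence "dag h $$ (k, j) = eps k * eps j * (eps k * eps j * b $$ (k, j))"
        unfolding f_def lt(4) by simp
      thus "dag h $$ (k, j) = b $$ (k, j)" by (simp add: mult_ac)
    qed
  qed
  from U_into_Q[OF ab t(1-3) h] that[of "dag h"] h(1) UD(1)[OF h(1)] show ?thesis by simp
qed

text \<open>All solutions arise from one solution \<open>h\<close> by left multiplication. This
  replaces \<open>(a, b)\<close> by a pair \<open>(q1, q2)\<close> in \<open>Q\<close>, and such a
  pair does not influence whether \<open>(q1 * g, dag g * q2)\<close> lies in \<open>Q\<close>, so
  the count no longer depends on \<open>a\<close> and \<open>b\<close>.\<close>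

lemma count_Q:
  assumes ab: "a \<in> V" "b \<in> V" and adm: "admissible i j t"
  shows "card {g \<in> U. (a * g, dag g * b) \<in> Q i j t} = card {g \<in> U. (g, dag g) \<in> Q i j t}"
proof -
  have t: "i < t" "t \<le> j" "j < m" "i < n" using adm by (auto simp: admissible_def)
  obtain h where h: "h \<in> U" "(a * h, dag h * b) \<in> Q i j t"
    using U_into_Q_exists[OF ab adm] .
  note hU = UD[OF h(1)]
  define q1 q2 where "q1 = a * h" and "q2 = dag h * b"
  have q: "q1 \<in> V" "q2 \<in> V" "\<And>k. i < k \<Longrightarrow> k < t \<Longrightarrow> q1 $$ (i, k) = 0" "\<And>k. t \<le> k \<Longrightarrow> k < j \<Longrightarrow> q2 $$ (k, j) = 0"
    using h(2) by (auto simp: Q_def q1_def q2_def)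
  have key: "(a * (h * g), dag (h * g) * b) \<in> Q i j t \<longleftrightarrow> (g, dag g) \<in> Q i j t" if g: "g \<in> U" for g
  proof -
    note gU = UD[OF g]
    have e: "a * (h * g) = q1 * g" "dag (h * g) * b = dag g * q2"
      using ab hU gU by (simp_all add: q1_def q2_def dag_mult mat_assoc)
    have 1: "(q1 * g) $$ (i, k) = g $$ (i, k)" if k: "k < t" for k
    proof -
      have "(q1 * g) $$ (i, k) = q1 $$ (i, i) * g $$ (i, k)"
      proof (rule mult_entry_single)
        fix z assume "z < m" "z \<noteq> i"
        thus "q1 $$ (i, z) = 0 \<or> g $$ (z, k) = 0"
          using k t q(3)[of z] V_entries(1)[OF q(1), of z i] V_entries(1)[OF gU(1), of k z]
          by (cases "z < i"; cases "z < t") auto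
      qed (use k t q gU in auto)
      thus ?thesis using V_entries(2)[OF q(1), of i] t by simp
    qed
    have 2: "(dag g * q2) $$ (k, j) = dag g $$ (k, j)" if k: "t \<le> k" "k < j" for k
    proof -
      have "(dag g * q2) $$ (k, j) = dag g $$ (k, j) * q2 $$ (j, j)"
      proof (rule mult_entry_single)
        fix z assume "z < m" "z \<noteq> j"
        thus "dag g $$ (k, z) = 0 \<or> q2 $$ (z, j) = 0"
          using k t q(4)[of z] V_entries(1)[OF q(2), of j z] V_entries(1)[OF V_dag[OF gU(1)], of z k]
          by (cases "z < t"; cases "z < j") auto
      qed (use k t q gU in auto)
      thus ?thesis using V_entries(2)[OF q(2), of j] t by simp
    qed
    show ?thesis unfolding e using 1 2 q gU by (auto simp: Q_def simp del: index_mult_mat(1))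
  qed
  have inj: "inj_on ((*) h) {g \<in> U. (g, dag g) \<in> Q i j t}"
    using unitri_mult_inj[of h m m] hU UD(1) unfolding V_def by (auto intro: inj_on_subset)
  have "{g \<in> U. (a * g, dag g * b) \<in> Q i j t} = (*) h ` {g \<in> U. (g, dag g) \<in> Q i j t}"
  proof (intro equalityI subsetI)
    fix g assume g: "g \<in> {g \<in> U. (a * g, dag g * b) \<in> Q i j t}"
    hence "g \<in> U" by simp
    note gU = UD[OF this]
    have e: "g = h * (dag h * g)" using mat_inverse_mult[OF hU(2), of g] hU gU by simp
    have "dag h * g \<in> U" using g h by simp
    with key[OF this] g e show "g \<in> (*) h ` {g \<in> U. (g, dag g) \<in> Q i j t}" by auto
  qed (use key h in auto)
  thus ?thesis using card_image[OF inj] by simp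
qed

text \<open>Each pair of \<open>V \<times> V\<close> is hit equally often when \<open>Q\<close> is
  translated by all \<open>g\<close>; the multiplicity is the one of \<open>count_Q\<close>.\<close>

lemma sum_over_U_Q:
  assumes adm: "admissible i j t"
  shows "(\<Sum>g\<in>U. \<Sum>(a, b)\<in>Q i j t. F (a * dag g) (g * b) :: complex) =
    of_nat (card {g \<in> U. (g, dag g) \<in> Q i j t}) * (\<Sum>(a, b)\<in>V \<times> V. F a b)"
proof -
  have "(\<Sum>(a, b)\<in>Q i j t. F (a * dag g) (g * b)) =
      (\<Sum>(a, b)\<in>V \<times> V. if (a * g, dag g * b) \<in> Q i j t then F a b else 0)" if g: "g \<in> U" for g
  proof -
    note gU = UD[OF g]
    have "(\<Sum>p\<in>Q i j t. F (fst p * dag g) (g * snd p)) = (\<Sum>p | p \<in> V \<times> V \<and> (fst p * g, dag g * snd p) \<in> Q i j t. F (fst p) (snd p))"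
    proof (rule sum.reindex_bij_witness[of _ "\<lambda>p. (fst p * g, dag g * snd p)" "\<lambda>p. (fst p * dag g, g * snd p)"])
      fix p assume "p \<in> Q i j t"
      hence p: "p \<in> Q i j t" "fst p \<in> V" "snd p \<in> V" by (auto simp: Q_def)
      have "fst p * dag g * g = fst p" "dag g * (g * snd p) = snd p"
        using p gU mat_inverse_mult[OF gU(3), of "snd p"] by (simp_all add: mat_assoc)
      with p gU show "(fst (fst p * dag g, g * snd p) * g, dag g * snd (fst p * dag g, g * snd p)) = p"
        "(fst p * dag g, g * snd p) \<in> {p. p \<in> V \<times> V \<and> (fst p * g, dag g * snd p) \<in> Q i j t}" by auto
    next
      fix p assume p: "p \<in> {p. p \<in> V \<times> V \<and> (fst p * g, dag g * snd p) \<in> Q i j t}"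
      hence pV: "fst p \<in> V" "snd p \<in> V" by (auto simp: mem_Times_iff)
      have "fst p * g * dag g = fst p" "g * (dag g * snd p) = snd p"
        using pV gU mat_inverse_mult[OF gU(2), of "snd p"] by (simp_all add: mat_assoc)
      with p show "(fst (fst p * g, dag g * snd p) * dag g, g * snd (fst p * g, dag g * snd p)) = p"
        "(fst p * g, dag g * snd p) \<in> Q i j t" by auto
    qed simp
    also have "\<dots> = (\<Sum>p\<in>V \<times> V. if (fst p * g, dag g * snd p) \<in> Q i j t then F (fst p) (snd p) else 0)"
      by (subst sum.inter_filter) auto
    finally show ?thesis by (simp add: case_prod_unfold)
  qed
  hence "(\<Sum>g\<in>U. \<Sum>(a, b)\<in>Q i j t. F (a * dag g) (g * b)) =
      (\<Sum>g\<in>U. \<Sum>(a, b)\<in>V \<times> V. if (a * g, dag g * b) \<in> Q i j t then F a b else 0)"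
    by simp
  also have "\<dots> = (\<Sum>(a, b)\<in>V \<times> V. \<Sum>g\<in>U. if (a * g, dag g * b) \<in> Q i j t then F a b else 0)"
    unfolding case_prod_unfold by (rule sum.swap)
  also have "\<dots> = (\<Sum>(a, b)\<in>V \<times> V. of_nat (card {g \<in> U. (g, dag g) \<in> Q i j t}) * F a b)"
  proof (rule sum.cong[OF refl], clarify)
    fix a b assume ab: "a \<in> V" "b \<in> V"
    show "(\<Sum>g\<in>U. if (a * g, dag g * b) \<in> Q i j t then F a b else 0) = of_nat (card {g \<in> U. (g, dag g) \<in> Q i j t}) * F a b"
      unfolding count_Q[OF ab adm, symmetric] by (simp add: sum.inter_filter[symmetric])
  qed
  finally show ?thesis by (simp add: sum_distrib_left case_prod_unfold)
qed

text \<open>The summand of an induced character, extended by 0 outside \<open>H\<close>, is a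
  normalised sum over \<open>Q\<close>; conjugation by \<open>g\<close> passes to the pair as a
  translation, and summing over \<open>g\<close> spreads \<open>Q\<close> over all of
  \<open>V \<times> V\<close>. \<open>G\<close> stays abstract because it is used with
  \<open>y - 1\<close> for most roots and with \<open>S y\<close> for
  \<open>2\<epsilon>\<^sub>i\<close>.\<close>

lemma induced_stab_formula:
  assumes adm: "admissible i j t" and H: "H = {y \<in> U. stab i j t y}" and x: "x \<in> U"
    and sum: "\<And>y. y \<in> U \<Longrightarrow> (\<Sum>(a, b)\<in>Q i j t. \<theta> (G y a b)) =
      (if stab i j t y then of_nat (card (Q i j t)) * f y else 0)"
    and conj: "\<And>g a b. g \<in> U \<Longrightarrow> a \<in> V \<Longrightarrow> b \<in> V \<Longrightarrow> G (dag g * x * g) a b = G x (a * dag g) (g * b)"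
  shows "induced (U_grp c n) H f x =
    of_nat (card {g \<in> U. (g, dag g) \<in> Q i j t}) / (of_nat (card H) * of_nat (card (Q i j t))) *
    (\<Sum>(a, b)\<in>V \<times> V. \<theta> (G x a b))"
proof -
  have t: "i < t" "t \<le> j" "j < m" using adm by (auto simp: admissible_def)
  have Q0: "card (Q i j t) \<noteq> 0" using one_in_Q[OF t(2,3)] by auto
  have "(\<Sum>g \<in> {g \<in> U. dag g * x * g \<in> H}. f (dag g * x * g)) =
      (\<Sum>g\<in>U. if dag g * x * g \<in> H then f (dag g * x * g) else 0)"
    by (rule sum.inter_filter) simp
  also have "\<dots> = (\<Sum>g\<in>U. (1 / of_nat (card (Q i j t))) * (\<Sum>(a, b)\<in>Q i j t. \<theta> (G x (a * dag g) (g * b))))"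
  proof (rule sum.cong[OF refl])
    fix g assume g: "g \<in> U"
    have yU: "dag g * x * g \<in> U" using g x by simp
    have "(\<Sum>(a, b)\<in>Q i j t. \<theta> (G x (a * dag g) (g * b))) = (\<Sum>(a, b)\<in>Q i j t. \<theta> (G (dag g * x * g) a b))"
      using conj[OF g] by (intro sum.cong) (auto simp: Q_def)
    thus "(if dag g * x * g \<in> H then f (dag g * x * g) else 0) =
        (1 / of_nat (card (Q i j t))) * (\<Sum>(a, b)\<in>Q i j t. \<theta> (G x (a * dag g) (g * b)))"
      using sum[OF yU] Q0 yU by (simp add: H)
  qed
  also have "\<dots> = (1 / of_nat (card (Q i j t))) * (of_nat (card {g \<in> U. (g, dag g) \<in> Q i j t}) *
      (\<Sum>(a, b)\<in>V \<times> V. \<theta> (G x a b)))"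
    unfolding sum_distrib_left[symmetric] sum_over_U_Q[OF adm, of "\<lambda>a b. \<theta> (G x a b)"] ..
  finally have main: "(\<Sum>g \<in> {g \<in> U. dag g * x * g \<in> H}. f (dag g * x * g)) = \<dots>" .
  have "induced (U_grp c n) H f x =
      1 / of_nat (card H) * (\<Sum>g \<in> {g \<in> U. dag g * x * g \<in> H}. f (dag g * x * g))"
    unfolding induced_def U_grp_simps
    by (intro arg_cong2[of _ _ _ _ "(*)"] refl sum.cong) (auto simp: inv_U)
  thus ?thesis unfolding main by simp
qed

section \<open>The skew part and the roots \<open>2\<epsilon>\<^sub>i\<close>\<close>

definition S :: "'a mat \<Rightarrow> 'a mat" where "S y = (1/2) \<cdot>\<^sub>m (y - dag y)"

text \<open>The Lie algebra of \<open>U\<close>.\<close>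

definition skew :: "'a mat set" where
  "skew = {s \<in> carrier_mat m m. dag s = - s \<and> (\<forall>i<m. \<forall>j\<le>i. s $$ (i, j) = 0)}"

lemma S_skew:
  assumes "y \<in> V"
  shows "S y \<in> skew"
proof -
  have "dag (S y) = - S y"
    using assms unfolding S_def
    by (simp add: dag_smult dag_minus) (rule eq_matI; auto simp: algebra_simps)
  moreover have "S y $$ (i, j) = 0" if "i < m" "j \<le> i" for i j
    using V_entries(1)[OF assms, of j i] V_entries(1)[OF V_dag[OF assms], of j i]
      V_entries(2)[OF assms, of i] V_entries(2)[OF V_dag[OF assms], of i] that assms
    by (cases "i = j") (auto simp: S_def)
  ultimately show ?thesis using assms by (simp add: skew_def S_def)
qed

lemma S_conj:
  assumes "x \<in> U" "g \<in> U"
  shows "S (dag g * x * g) = dag g * S x * g"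
  using UD[OF assms(1)] UD[OF assms(2)] by (simp add: S_def dag_mult mat_alg)

lemma row_inverse:
  assumes y: "y \<in> U" and t: "i < k" "k < t" "t \<le> m" and z: "\<And>k. i < k \<Longrightarrow> k < t \<Longrightarrow> y $$ (i, k) = 0"
  shows "dag y $$ (i, k) = 0"
proof -
  note yU = UD[OF y]
  have "(y * dag y) $$ (i, k) = y $$ (i, i) * dag y $$ (i, k)"
  proof (rule mult_entry_single)
    fix l assume "l < m" "l \<noteq> i"
    thus "y $$ (i, l) = 0 \<or> dag y $$ (l, k) = 0"
      using V_entries(1)[OF yU(1), of l i] z[of l] V_entries(1)[OF V_dag[OF yU(1)], of k l] t
      by (cases "l < i"; cases "l < t") auto
  qed (use yU t in auto)
  thus ?thesis unfolding yU(2) using V_entries(2)[OF yU(1), of i] t by simp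
qed

text \<open>By induction along the row: once the earlier entries vanish,
  \<open>y * dag y = 1\<close> at \<open>(i, k)\<close> reads
  \<open>dag y $$ (i, k) + y $$ (i, k) = 0\<close>, while the vanishing of \<open>S y\<close> makes
  the two summands equal; as 2 is invertible, both are 0.\<close>

lemma S_row_zero_iff:
  assumes y: "y \<in> U" and i: "i < n" "n \<le> m"
  shows "(\<forall>k. i < k \<and> k < n \<longrightarrow> S y $$ (i, k) = 0) \<longleftrightarrow> (\<forall>k. i < k \<and> k < n \<longrightarrow> y $$ (i, k) = 0)"
proof -
  note yU = UD[OF y]
  have Sy: "S y $$ (i, k) = (1/2) * (y $$ (i, k) - dag y $$ (i, k))" if "k < m" for k
    using that yU i by (simp add: S_def)
  show ?thesis
  proof
    assume y0: "\<forall>k. i < k \<and> k < n \<longrightarrow> y $$ (i, k) = 0"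
    show "\<forall>k. i < k \<and> k < n \<longrightarrow> S y $$ (i, k) = 0"
    proof (intro allI impI)
      fix k assume k: "i < k \<and> k < n"
      hence "k < m" using i by simp
      from Sy[OF this] show "S y $$ (i, k) = 0" using row_inverse[OF y, of i k n] y0 k i by simp
    qed
  next
    assume S0: "\<forall>k. i < k \<and> k < n \<longrightarrow> S y $$ (i, k) = 0"
    have "y $$ (i, k) = 0" if "i < k" "k < n" for k
      using that
    proof (induction k rule: less_induct)
      case (less k)
      have km: "k < m" "i < m" using less.prems i by auto
      have "(y * dag y) $$ (i, k) = (\<Sum>z<m. y $$ (i, z) * dag y $$ (z, k))"
        by (rule mult_mat_entry) (use yU km in auto)
      also have "\<dots> = (\<Sum>z\<in>{i, k}. y $$ (i, z) * dag y $$ (z, k))"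
      proof (rule sum.mono_neutral_right)
        show "\<forall>z\<in>{..<m} - {i, k}. y $$ (i, z) * dag y $$ (z, k) = 0"
        proof
          fix z assume z: "z \<in> {..<m} - {i, k}"
          show "y $$ (i, z) * dag y $$ (z, k) = 0"
            using z V_entries(1)[OF yU(1), of z i] less.IH[of z] V_entries(1)[OF V_dag[OF yU(1)], of k z] km less.prems
            by (cases "z < i"; cases "z < k") auto
        qed
      qed (use km in auto)
      also have "\<dots> = dag y $$ (i, k) + y $$ (i, k)"
        using V_entries(2)[OF yU(1) km(2)] V_entries(2)[OF V_dag[OF yU(1)] km(1)] less.prems by simp
      finally have sum0: "dag y $$ (i, k) + y $$ (i, k) = 0" unfolding yU(2) using km less.prems by simp
      have "dag y $$ (i, k) = y $$ (i, k)"
        using S0 less.prems Sy[OF km(1)] two_neq_0 by simp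
      from sum0[unfolded this] have "2 * y $$ (i, k) = 0" unfolding mult_2 .
      thus ?case using two_neq_0 by simp
    qed
    thus "\<forall>k. i < k \<and> k < n \<longrightarrow> y $$ (i, k) = 0" by blast
  qed
qed

lemma skew_index:
  assumes "s \<in> skew" "i < m" "j < m"
  shows "s $$ (i, j) = - (eps i * eps j * s $$ (m - 1 - j, m - 1 - i))"
proof -
  have "dag s $$ (i, j) = - s $$ (i, j)" using assms by (auto simp: skew_def)
  thus ?thesis using dag_index[OF assms(2,3), of s] by simp
qed

lemma dag_addE:
  assumes "A \<in> carrier_mat m m" "k < m" "l < m"
  shows "dag (addE k l s A) = addE (m - 1 - l) (m - 1 - k) (eps k * eps l * s) (dag A)"
proof (rule eq_matI)
  fix x y assume "x < dim_row (addE (m - 1 - l) (m - 1 - k) (eps k * eps l * s) (dag A))"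
    "y < dim_col (addE (m - 1 - l) (m - 1 - k) (eps k * eps l * s) (dag A))"
  hence xy: "x < m" "y < m" by auto
  have iff: "m - 1 - y = k \<and> m - 1 - x = l \<longleftrightarrow> x = m - 1 - l \<and> y = m - 1 - k" using xy assms by auto
  have e: "eps x * eps y = eps k * eps l" if "x = m - 1 - l" "y = m - 1 - k"
    unfolding that using eps_flip[OF assms(3,2)] by (simp add: mult.commute)
  have "dag (addE k l s A) $$ (x, y) = eps x * eps y * (A $$ (m - 1 - y, m - 1 - x) + (if m - 1 - y = k \<and> m - 1 - x = l then s else 0))"
    using xy by (simp add: dag_index addE_index)
  also have "\<dots> = dag A $$ (x, y) + (if x = m - 1 - l \<and> y = m - 1 - k then eps k * eps l * s else 0)"
    unfolding iff using e xy by (auto simp: dag_index algebra_simps)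
  finally show "dag (addE k l s A) $$ (x, y) = addE (m - 1 - l) (m - 1 - k) (eps k * eps l * s) (dag A) $$ (x, y)"
    using xy by (simp add: addE_index)
qed auto

text \<open>With \<open>b = dag a\<close> the matrix in the middle should be skew, so
  \<open>S y\<close> takes the place of \<open>y - 1\<close>; by \<open>S_row_zero_iff\<close> both
  are subject to the same row condition. An obstruction in column \<open>l < n\<close> is detected
  by the free entry of \<open>a\<close> in column \<open>m - 1 - l\<close>. This entry occurs,
  reflected, in \<open>dag a\<close> as well, and as \<open>S y\<close> is skew the two
  contributions reinforce each other, whence the factor 2.\<close>

lemma Q_sum_twice:
  assumes y: "y \<in> U" and sp: sp and i: "i < n" and r: "r \<noteq> 0"
  shows "(\<Sum>(a, b)\<in>Q i n n. \<theta> (r * (a * S y * dag a) $$ (i, m - 1 - i))) =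
    (if stab i n n y then of_nat (card (Q i n n)) * \<theta> (r * y $$ (i, m - 1 - i)) else 0)"
proof -
  note yU = UD[OF y]
  define j where "j = m - 1 - i"
  have m: "m = 2 * n" using m_eq rk_od sp_od[OF sp] by simp
  have j: "i < n" "n \<le> j" "j < m" "m - 1 - j = i" using i m by (auto simp: j_def)
  have nm: "n \<le> m" "n < m" using i m by auto
  have Ss: "S y \<in> skew" using S_skew[OF yU(1)] .
  hence Sc: "S y \<in> carrier_mat m m" and strict: "\<And>k l. l \<le> k \<Longrightarrow> k < m \<Longrightarrow> S y $$ (k, l) = 0"
    by (auto simp: skew_def)
  have mirror: "S y $$ (k, j) = - S y $$ (i, m - 1 - k)" if "n \<le> k" "k < m" for k
    using skew_index[OF Ss that(2) j(3)] that j sp unfolding j(4) by (simp add: eps_sp)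
  have Qd: "(a, dag a) \<in> Q i j n" if "(a, b) \<in> Q i n n" for a b
  proof -
    have a: "a \<in> V" "\<And>k. i < k \<Longrightarrow> k < n \<Longrightarrow> a $$ (i, k) = 0" using that by (auto simp: Q_def)
    have "dag a $$ (k, j) = 0" if "n \<le> k" "k < j" for k
    proof -
      have "i < m - 1 - k" "m - 1 - k < n" "k < m" using that m j(3,4) by linarith+
      thus ?thesis using a(2)[of "m - 1 - k"] j by (simp add: dag_index)
    qed
    thus ?thesis using a by (auto simp: Q_def)
  qed
  show ?thesis
  proof (cases "stab i n n y")
    case True
    have S0: "S y $$ (i, l) = 0" if "i < l" "l < n" for l
      using True S_row_zero_iff[OF y i nm(1)] that by (auto simp: stab_def)
    have S1: "S y $$ (k, j) = 0" if "n \<le> k" "k < j" for k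
    proof -
      have "i < m - 1 - k" "m - 1 - k < n" "k < m" using that m j(3,4) by linarith+
      thus ?thesis using mirror[OF that(1)] S0 by simp
    qed
    have im: "i < m" using i nm by simp
    \<comment> \<open>On the antidiagonal \<open>dag\<close> changes the sign for \<open>Sp\<close>,
      so the half in \<open>S\<close> cancels against the doubling.\<close>
    have "dag y $$ (i, j) = eps i * eps j * y $$ (i, j)"
      using dag_index[OF im j(3), of y] unfolding j(4) j_def[symmetric] .
    hence "dag y $$ (i, j) = - y $$ (i, j)"
      using j i sp by (simp add: eps_sp)
    hence "S y $$ (i, j) = y $$ (i, j)"
      using yU j nm two_neq_0 by (simp add: S_def)
    hence "(a * S y * dag a) $$ (i, j) = y $$ (i, j)" if "(a, b) \<in> Q i n n" for a b
      using Q_value[OF Qd[OF that] j(1-3) Sc strict S0 S1] by simp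
    hence "(\<Sum>(a, b)\<in>Q i n n. \<theta> (r * (a * S y * dag a) $$ (i, j))) = (\<Sum>(a, b)\<in>Q i n n. \<theta> (r * y $$ (i, j)))"
      by (intro sum.cong) (auto simp del: index_mult_mat(1))
    thus ?thesis using True by (simp add: j_def case_prod_unfold)
  next
    case False
    then obtain l where l: "i < l" "l < n" "S y $$ (i, l) \<noteq> 0"
      using S_row_zero_iff[OF y i nm(1)] by (auto simp: stab_def)
    define k where "k = m - 1 - l"
    have k: "n \<le> k" "k < j" "i < k" "k < m" "m - 1 - k = l" using l m by (auto simp: k_def j_def)
    have "- (2 * (r * S y $$ (i, l))) \<noteq> 0" using r l two_neq_0 by simp
    then obtain s where s: "\<theta> (s * - (2 * (r * S y $$ (i, l)))) \<noteq> 1" using theta_scale_nontrivial by metis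
    have "(\<Sum>p\<in>Q i n n. \<theta> (r * (fst p * S y * dag (fst p)) $$ (i, j))) = 0"
    proof (rule theta_sum_vanishes[of "\<lambda>p. (addE i k s (fst p), snd p)"])
      show "bij_betw (\<lambda>p. (addE i k s (fst p), snd p)) (Q i n n) (Q i n n)"
        by (rule bij_betw_byWitness[of _ "\<lambda>p. (addE i k (- s) (fst p), snd p)"])
          (use k nm in \<open>auto simp: Q_def addE_V addE_index addE_inverse addE_inverse[of _ _ _ "- s", simplified]\<close>)
      fix p assume p: "p \<in> Q i n n"
      obtain a b where ab: "p = (a, b)" by force
      let ?a = "addE i k s a"
      have aV: "a \<in> V" using p by (auto simp: Q_def ab)
      have a': "(?a, b) \<in> Q i n n" using p k nm by (auto simp: Q_def ab addE_V addE_index)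
      have da: "dag ?a = addE l j (- s) (dag a)"
      proof -
        have "dag ?a = addE l j (eps i * eps k * s) (dag a)"
          using dag_addE[OF V_carrier[OF aV] _ k(4), of i s] k unfolding k(5) j_def[symmetric] by simp
        thus ?thesis using k i sp by (simp add: eps_sp)
      qed
      \<comment> \<open>Only \<open>dag a\<close> is split off first, with the modified
        \<open>a\<close> still on the left, so a term quadratic in \<open>s\<close> would have to
        come from \<open>(?a * S y) $$ (i, l)\<close>; \<open>Q_left\<close> shows that this entry
        is unaffected by the modification.\<close>
      have "(?a * S y * dag ?a) $$ (i, j) = (?a * S y * dag a) $$ (i, j) + (- s) * (?a * S y) $$ (i, l)"
        unfolding da by (rule mult_addE_index) (use aV Sc j l nm in auto)
      also have "(?a * S y) $$ (i, l) = S y $$ (i, l)"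
        using Q_left[OF Qd[OF a'] j(1-3) Sc strict, of l] l by simp
      also have "(?a * S y * dag a) $$ (i, j) = (?a * (S y * dag a)) $$ (i, j)"
        using aV Sc by (subst mat_assoc) auto
      also have "\<dots> = (a * (S y * dag a)) $$ (i, j) + s * (S y * dag a) $$ (k, j)"
        by (rule addE_mult_index) (use aV Sc j k nm in auto)
      also have "(S y * dag a) $$ (k, j) = - S y $$ (i, l)"
        using Q_right[OF Qd[of a b] j(1-3) Sc strict k(1,2)] p mirror[OF k(1,4)] k(5) by (simp add: ab)
      also have "a * (S y * dag a) = a * S y * dag a"
        using aV Sc by (subst mat_assoc) auto
      finally have fin: "(?a * S y * dag ?a) $$ (i, j) =
          (a * S y * dag a) $$ (i, j) + s * - S y $$ (i, l) + - s * S y $$ (i, l)" .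
      have alg: "r * (v + s * - w + - s * w) = r * v + s * - (2 * (r * w))" for v w
        by (simp add: algebra_simps)
      show "r * (fst (addE i k s (fst p), snd p) * S y * dag (fst (addE i k s (fst p), snd p))) $$ (i, j) =
          r * (fst p * S y * dag (fst p)) $$ (i, j) + s * - (2 * (r * S y $$ (i, l)))"
        unfolding ab fst_conv fin by (rule alg)
    qed (rule s)
    thus ?thesis using False by (simp add: j_def case_prod_unfold)
  qed
qed

section \<open>Elementary characters as sums over \<open>V \<times> V\<close>\<close>

lemma int_positions:
  "(\<forall>k. int a + 1 < k \<and> k < int b + 1 \<longrightarrow> P (pos c n k)) \<longleftrightarrow> (\<forall>k. a < k \<and> k < b \<longrightarrow> P k)" (is ?A)
  "(\<forall>k. int a + 1 < k \<and> k \<le> int b \<longrightarrow> P (pos c n k)) \<longleftrightarrow> (\<forall>k. a < k \<and> k < b \<longrightarrow> P k)" (is ?B)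
proof -
  have "(\<forall>k. int a + 1 < k \<and> k \<le> int b \<longrightarrow> P (pos c n k)) \<longleftrightarrow> (\<forall>k. int a + 1 < k \<and> k < int b + 1 \<longrightarrow> P (pos c n k))"
    by (simp add: zle_add1_eq_le)
  moreover show ?A
  proof (intro iffI allI impI)
    fix k assume *: "\<forall>k. int a + 1 < k \<and> k < int b + 1 \<longrightarrow> P (pos c n k)" "a < k \<and> k < b"
    have "P (pos c n (int k + 1))" using * by simp
    thus "P k" by (simp add: pos_simps)
  next
    fix k assume *: "\<forall>k. a < k \<and> k < b \<longrightarrow> P k" "int a + 1 < k \<and> k < int b + 1"
    define k' where "k' = nat (k - 1)"
    have "k = int k' + 1" "a < k'" "k' < b" using *(2) by (auto simp: k'_def)
    thus "P (pos c n k)" using *(1) by (simp add: pos_simps)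
  qed
  ultimately show ?B by simp
qed

lemma ent_pos: "ent c n y i k = y $$ (pos c n i, pos c n k)"
  by (simp add: ent_def)

lemma column_zero_iff:
  assumes y: "y \<in> U" and b: "b < n"
  shows "(\<forall>l. b < l \<and> l < n + rk c \<longrightarrow> y $$ (b, l) = 0) \<longleftrightarrow>
    (\<forall>k. n \<le> k \<and> k < m - 1 - b \<longrightarrow> y $$ (k, m - 1 - b) = 0)" (is "?L y \<longleftrightarrow> ?R y")
proof -
  have inv: "?L (dag z)" if "?L z" "z \<in> U" for z
    using row_inverse[OF that(2), of b _ "n + rk c"] that(1) m_eq by auto
  have "?L y \<longleftrightarrow> ?L (dag y)"
    using inv[of y] inv[of "dag y"] y UD(1)[OF y] by auto
  also have "\<dots> \<longleftrightarrow> ?R y"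
  proof (intro iffI allI impI)
    fix k assume *: "?L (dag y)" "n \<le> k \<and> k < m - 1 - b"
    have lt: "b < m - 1 - k" "m - 1 - k < n + rk c" "m - 1 - k < m" "b < m" "m - 1 - (m - 1 - k) = k"
      using * b m_eq by auto
    have "dag y $$ (b, m - 1 - k) = 0" using *(1) lt by blast
    thus "y $$ (k, m - 1 - b) = 0" unfolding dag_index[OF lt(4,3)] lt(5) by (auto simp: eps_sp split: if_splits)
  next
    fix l assume *: "?R y" "b < l \<and> l < n + rk c"
    have lt: "n \<le> m - 1 - l" "m - 1 - l < m - 1 - b" "l < m" "b < m"
      using * b m_eq by auto
    have "y $$ (m - 1 - l, m - 1 - b) = 0" using *(1) lt by blast
    thus "dag y $$ (b, l) = 0" unfolding dag_index[OF lt(4,3)] by simp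
  qed
  finally show ?thesis .
qed

text \<open>For \<open>2\<epsilon>\<^sub>i\<close> the parameters of \<open>stab\<close> are
  \<open>i n n\<close> and not the positive entry: the column condition is then empty, and the one
  on the row is all that \<open>U_root\<close> asks for.\<close>

lemma U_root_stab:
  assumes "\<alpha> \<in> roots c n"
  obtains t where "mir (rp \<alpha>) \<noteq> rp \<alpha>" "admissible (fst (rp \<alpha>)) (snd (rp \<alpha>)) t"
      "U_root c n \<alpha> = {y \<in> U. stab (fst (rp \<alpha>)) (snd (rp \<alpha>)) t y}"
  | i where "sp" "i < n" "rp \<alpha> = (i, m - 1 - i)" "mir (rp \<alpha>) = rp \<alpha>" "U_root c n \<alpha> = {y \<in> U. stab i n n y}"
  using assms
proof (cases rule: roots_cases)
  case (1 a b)
  have rp: "rp \<alpha> = (a, b)" using 1 rp_simps by simp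
  have mir: "mir (a, b) \<noteq> (a, b)" unfolding mir_def using 1 m_eq by auto
  have adm: "admissible a b b" unfolding admissible_def using 1 m_eq by auto
  have "U_root c n \<alpha> = {y \<in> U. stab a b b y}"
    using int_positions(1)[of a b "\<lambda>k. y $$ (a, k) = 0" for y]
    unfolding 1(1) U_root.simps ent_pos pos_simps stab_def U_def by auto
  with that(1)[of b] show ?thesis using mir adm unfolding rp by simp
next
  case (2 a b)
  define j where "j = m - 1 - b"
  have rp: "rp \<alpha> = (a, j)" using 2 rp_simps by (simp add: j_def)
  have mir: "mir (a, j) \<noteq> (a, j)" unfolding mir_def j_def using 2 m_eq by auto
  have "\<exists>p. a < p \<and> p < n \<and> j = m - 1 - p" using 2 by (intro exI[of _ b]) (simp add: j_def)
  hence adm: "admissible a j n" using 2 m_eq unfolding admissible_def by (auto simp: j_def)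
  have l: "(\<forall>l. (int b + 1 < l \<and> l \<le> int n) \<or> (c = O_odd \<and> l = 0) \<longrightarrow> y $$ (b, pos c n l) = 0) \<longleftrightarrow>
      (\<forall>l. b < l \<and> l < n + rk c \<longrightarrow> y $$ (b, l) = 0)" (is "?A \<longleftrightarrow> ?B") for y
  proof -
    have "?A \<longleftrightarrow> (\<forall>l. int b + 1 < l \<and> l \<le> int n \<longrightarrow> y $$ (b, pos c n l) = 0) \<and> (od \<longrightarrow> y $$ (b, n) = 0)"
      using pos_simps(3) unfolding od_def by auto
    also have "\<dots> \<longleftrightarrow> (\<forall>k. b < k \<and> k < n \<longrightarrow> y $$ (b, k) = 0) \<and> (od \<longrightarrow> y $$ (b, n) = 0)"
      using int_positions(2)[of b n "\<lambda>k. y $$ (b, k) = 0"] by simp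
    also have "\<dots> \<longleftrightarrow> ?B"
    proof (cases od)
      case True
      have "k < n + 1 \<longleftrightarrow> k < n \<or> k = n" for k by auto
      with True 2 show ?thesis unfolding rk_od(1)[OF True] by auto
    qed (simp add: rk_od(2))
    finally show ?thesis .
  qed
  have "U_root c n \<alpha> = {y \<in> U. stab a j n y}"
    unfolding 2(1) U_root.simps ent_pos pos_simps stab_def U_def[symmetric] l
      int_positions(2)[of a n "\<lambda>k. y $$ (a, k) = 0" for y]
  proof (rule Collect_cong)
    fix y :: "'a mat"
    show "(y \<in> U \<and> (\<forall>k. a < k \<and> k < n \<longrightarrow> y $$ (a, k) = 0) \<and> (\<forall>l. b < l \<and> l < n + rk c \<longrightarrow> y $$ (b, l) = 0)) =
        (y \<in> U \<and> (\<forall>k. a < k \<and> k < n \<longrightarrow> y $$ (a, k) = 0) \<and> (\<forall>k. n \<le> k \<and> k < j \<longrightarrow> y $$ (k, j) = 0))"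
      by (cases "y \<in> U") (simp_all only: column_zero_iff[OF _ 2(3), of y, folded j_def] simp_thms)
  qed
  with that(1)[of n] show ?thesis using mir adm unfolding rp by simp
next
  case (3 a)
  have rp: "rp \<alpha> = (a, m - 1 - a)" using 3 rp_simps by simp
  have mir: "mir (rp \<alpha>) = rp \<alpha>" unfolding rp mir_def using 3 m_eq by auto
  have "U_root c n \<alpha> = {y \<in> U. stab a n n y}"
    using int_positions(2)[of a n "\<lambda>k. y $$ (a, k) = 0" for y]
    unfolding 3(1) U_root.simps ent_pos pos_simps stab_def U_def by auto
  with that(2)[OF 3(3,2) rp mir] show ?thesis .
next
  case (4 a)
  have rp: "rp \<alpha> = (a, n)" using 4 rp_simps by simp
  have mir: "mir (a, n) \<noteq> (a, n)" unfolding mir_def using 4 m_eq rk_od(1) by auto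
  have adm: "admissible a n n" unfolding admissible_def using 4 m_eq rk_od(1) by auto
  have "U_root c n \<alpha> = {y \<in> U. stab a n n y}"
    using int_positions(2)[of a n "\<lambda>k. y $$ (a, k) = 0" for y]
    unfolding 4(1) U_root.simps ent_pos pos_simps stab_def U_def by auto
  with that(1)[of n] show ?thesis using mir adm unfolding rp by simp
qed

lemma lambda_char_rp: "lambda_char c n \<theta> \<alpha> r = (\<lambda>y. \<theta> (r * y $$ rp \<alpha>))"
  by (rule ext) (simp add: lambda_char_def ent_pos rp_def)

definition moment :: "root \<Rightarrow> 'a mat \<Rightarrow> 'a mat \<Rightarrow> 'a mat \<Rightarrow> 'a" where
  "moment \<alpha> x a b = (if mir (rp \<alpha>) = rp \<alpha> then a * S x * dag a else a * (x - 1\<^sub>m m) * b) $$ rp \<alpha>"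

text \<open>\<open>C\<close> collects the group orders. Only its independence of \<open>x\<close>
  matters: constancy on superclasses and orthogonality are insensitive to scalar factors, and the
  norm in the theorem is never evaluated.\<close>

lemma elem_char_moment:
  assumes \<alpha>: "\<alpha> \<in> roots c n" and r: "r \<noteq> 0"
  shows "\<exists>C. \<forall>x\<in>U. elem_char c n \<theta> \<alpha> r x = C * (\<Sum>(a, b)\<in>V \<times> V. \<theta> (r * moment \<alpha> x a b))"
  using \<alpha>
proof (cases rule: U_root_stab)
  case (1 t)
  obtain i j where ij: "rp \<alpha> = (i, j)" by force
  have adm: "admissible i j t" using 1(2) by (simp add: ij)
  hence t: "i < t" "t \<le> j" "j < m" by (auto simp: admissible_def)
  have H: "U_root c n \<alpha> = {y \<in> U. stab i j t y}" using 1(3) by (simp add: ij)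
  define C where "C = (of_nat (card {g \<in> U. (g, dag g) \<in> Q i j t}) /
      (of_nat (card (U_root c n \<alpha> :: 'a mat set)) * of_nat (card (Q i j t))) :: complex)"
  show ?thesis
  proof (intro exI[of _ C] ballI)
    fix x assume x: "x \<in> U"
    note xU = UD[OF x]
    have conj: "r * (a * (dag g * x * g - 1\<^sub>m m) * b) $$ (i, j) = r * (a * dag g * (x - 1\<^sub>m m) * (g * b)) $$ (i, j)"
      if "g \<in> U" "a \<in> V" "b \<in> V" for g a b
    proof -
      note gU = UD[OF that(1)]
      have "dag g * x * g - 1\<^sub>m m = dag g * (x - 1\<^sub>m m) * g"
        using gU xU by (simp add: mat_alg)
      hence "a * (dag g * x * g - 1\<^sub>m m) * b = a * dag g * (x - 1\<^sub>m m) * (g * b)"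
        using that gU xU by (simp add: mat_assoc)
      thus ?thesis by simp
    qed
    have "elem_char c n \<theta> \<alpha> r x = C *
        (\<Sum>(a, b)\<in>V \<times> V. \<theta> (r * (a * (x - 1\<^sub>m m) * b) $$ (i, j)))"
      unfolding elem_char_def lambda_char_rp ij C_def
    proof (rule induced_stab_formula[where G = "\<lambda>y a b. r * (a * (y - 1\<^sub>m m) * b) $$ (i, j)", OF adm H x])
      fix y assume "y \<in> U"
      thus "(\<Sum>(a, b)\<in>Q i j t. \<theta> (r * (a * (y - 1\<^sub>m m) * b) $$ (i, j))) =
          (if stab i j t y then of_nat (card (Q i j t)) * \<theta> (r * y $$ (i, j)) else 0)"
        using Q_sum[OF UD(1) t r] by blast
    qed (rule conj)
    also have "(\<Sum>(a, b)\<in>V \<times> V. \<theta> (r * (a * (x - 1\<^sub>m m) * b) $$ (i, j))) = (\<Sum>(a, b)\<in>V \<times> V. \<theta> (r * moment \<alpha> x a b))"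
      using 1(1) by (simp add: moment_def ij)
    finally show "elem_char c n \<theta> \<alpha> r x = C * (\<Sum>(a, b)\<in>V \<times> V. \<theta> (r * moment \<alpha> x a b))" .
  qed
next
  case (2 i)
  have m: "m = 2 * n" using m_eq rk_od(2) sp_od[OF 2(1)] by simp
  have adm: "admissible i n n" unfolding admissible_def using 2 m by auto
  define C where "C = (of_nat (card {g \<in> U. (g, dag g) \<in> Q i n n}) /
      (of_nat (card (U_root c n \<alpha> :: 'a mat set)) * of_nat (card (Q i n n))) :: complex)"
  show ?thesis
  proof (intro exI[of _ C] ballI)
    fix x assume x: "x \<in> U"
    note xU = UD[OF x]
    have Sx [simp]: "dim_row (S x) = m" "dim_col (S x) = m" using xU by (simp_all add: S_def)
    have conj: "r * (a * S (dag g * x * g) * dag a) $$ (i, m - 1 - i) = r * (a * dag g * S x * dag (a * dag g)) $$ (i, m - 1 - i)"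
      if "g \<in> U" "a \<in> V" "b \<in> V" for g a b :: "'a mat"
    proof -
      note gU = UD[OF that(1)]
      have "a * S (dag g * x * g) * dag a = a * dag g * S x * dag (a * dag g)"
        unfolding S_conj[OF x that(1)] using that gU by (simp add: mat_assoc dag_mult)
      thus ?thesis by simp
    qed
    have "elem_char c n \<theta> \<alpha> r x = C *
        (\<Sum>(a, b)\<in>V \<times> V. \<theta> (r * (a * S x * dag a) $$ (i, m - 1 - i)))"
      unfolding elem_char_def lambda_char_rp 2(3) C_def
    proof (rule induced_stab_formula[where G = "\<lambda>y a b. r * (a * S y * dag a) $$ (i, m - 1 - i)", OF adm 2(5) x])
      fix y assume "y \<in> U"
      thus "(\<Sum>(a, b)\<in>Q i n n. \<theta> (r * (a * S y * dag a) $$ (i, m - 1 - i))) =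
          (if stab i n n y then of_nat (card (Q i n n)) * \<theta> (r * y $$ (i, m - 1 - i)) else 0)"
        by (rule Q_sum_twice[OF _ 2(1,2) r])
    qed (rule conj)
    also have "(\<Sum>(a, b)\<in>V \<times> V. \<theta> (r * (a * S x * dag a) $$ (i, m - 1 - i))) = (\<Sum>(a, b)\<in>V \<times> V. \<theta> (r * moment \<alpha> x a b))"
      unfolding moment_def if_P[OF 2(4)] unfolding 2(3) ..
    finally show "elem_char c n \<theta> \<alpha> r x = C * (\<Sum>(a, b)\<in>V \<times> V. \<theta> (r * moment \<alpha> x a b))" .
  qed
qed

section \<open>The Cayley transform\<close>

lemma skew_V:
  assumes "s \<in> skew"
  shows "1\<^sub>m m - s \<in> V"
  unfolding V_def using assms by (intro unitriI) (auto simp: skew_def)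

lemma skew_dim [simp]: "s \<in> skew \<Longrightarrow> dim_row s = m" "s \<in> skew \<Longrightarrow> dim_col s = m"
  by (auto simp: skew_def)

text \<open>The Cayley correspondence \<open>x = (1 + s) (1 - s)\<^sup>-\<^sup>1\<close>, with \<open>k = (1 - s)\<^sup>-\<^sup>1\<close>.\<close>

definition cayley :: "'a mat \<Rightarrow> 'a mat \<Rightarrow> 'a mat \<Rightarrow> bool" where
  "cayley x s k \<longleftrightarrow> s \<in> skew \<and> k \<in> V \<and> k * (1\<^sub>m m - s) = 1\<^sub>m m \<and> (1\<^sub>m m - s) * k = 1\<^sub>m m \<and> x = 2 \<cdot>\<^sub>m k - 1\<^sub>m m"

lemma mat_sum_diff:
  assumes "A \<in> carrier_mat m m" "B \<in> carrier_mat m m"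
  shows "(A + B) + (A - B) = 2 \<cdot>\<^sub>m (A :: 'a mat)" "(A + B) - (A - B) = 2 \<cdot>\<^sub>m (B :: 'a mat)"
  by (rule eq_matI; use assms in simp)+

text \<open>Everything comes from inserting two forms of 1, namely \<open>k * (1 - s)\<close> and
  its adjoint \<open>(1 + s) * dag k\<close>, into \<open>k\<close> and \<open>dag k\<close>. The
  sum \<open>k + dag k = 2 k (dag k)\<close> amounts to \<open>x * dag x = 1\<close>, the difference
  \<open>k - dag k = 2 k s (dag k)\<close> is \<open>S x\<close>, and \<open>k = 1 + s k\<close>
  gives \<open>x - 1\<close>.\<close>

lemma cayley_facts:
  assumes "cayley x s k"
  shows "x \<in> U" "x - 1\<^sub>m m = 2 \<cdot>\<^sub>m (s * k)" "S x = 2 \<cdot>\<^sub>m (k * s * dag k)"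
proof -
  have s1: "s \<in> skew" and k: "k \<in> V" and ks: "k * (1\<^sub>m m - s) = 1\<^sub>m m" and sk: "(1\<^sub>m m - s) * k = 1\<^sub>m m"
    and x: "x = 2 \<cdot>\<^sub>m k - 1\<^sub>m m" using assms unfolding cayley_def by blast+
  have s: "s \<in> skew" "dag s = - s" using s1 unfolding skew_def by blast+
  have [simp]: "dim_row s = m" "dim_col s = m" "dim_row k = m" "dim_col k = m"
    using s1 k by simp_all
  have k1: "k - s * k = 1\<^sub>m m" using sk by (simp add: mat_alg)
  have dk: "(1\<^sub>m m + s) * dag k = 1\<^sub>m m"
  proof -
    have "dag (k * (1\<^sub>m m - s)) = (1\<^sub>m m - dag s) * dag k" by (simp add: dag_mult dag_minus)
    also have "1\<^sub>m m - dag s = 1\<^sub>m m + s" unfolding s(2) by (rule eq_matI) auto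
    finally show ?thesis unfolding ks by simp
  qed
  have kdk: "k + dag k = 2 \<cdot>\<^sub>m (k * dag k)"
  proof -
    have "k + dag k = k * ((1\<^sub>m m + s) * dag k) + k * (1\<^sub>m m - s) * dag k" unfolding dk ks by simp
    also have "\<dots> = (k * dag k + k * s * dag k) + (k * dag k - k * s * dag k)"
      by (simp add: mat_alg)
    also have "\<dots> = 2 \<cdot>\<^sub>m (k * dag k)"
      by (rule mat_sum_diff) auto
    finally show ?thesis .
  qed
  have kmdk: "k - dag k = 2 \<cdot>\<^sub>m (k * s * dag k)"
  proof -
    have "k - dag k = k * ((1\<^sub>m m + s) * dag k) - k * (1\<^sub>m m - s) * dag k" unfolding dk ks by simp
    also have "\<dots> = (k * dag k + k * s * dag k) - (k * dag k - k * s * dag k)"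
      by (simp add: mat_alg)
    also have "\<dots> = 2 \<cdot>\<^sub>m (k * s * dag k)"
      by (rule mat_sum_diff) auto
    finally show ?thesis .
  qed
  have dx: "dag x = 2 \<cdot>\<^sub>m dag k - 1\<^sub>m m" unfolding x by (simp add: dag_minus dag_smult)
  have "x * dag x = 2 \<cdot>\<^sub>m (2 \<cdot>\<^sub>m (k * dag k) - dag k) - (2 \<cdot>\<^sub>m k - 1\<^sub>m m)"
    unfolding dx unfolding x by (simp add: mat_alg)
  also have "\<dots> = 2 \<cdot>\<^sub>m (2 \<cdot>\<^sub>m (k * dag k)) - 2 \<cdot>\<^sub>m (k + dag k) + 1\<^sub>m m"
    by (rule eq_matI) (simp_all add: algebra_simps del: index_mult_mat(1))
  also have "\<dots> = 1\<^sub>m m" unfolding kdk by (rule eq_matI) (simp_all del: index_mult_mat(1))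
  finally have "x * dag x = 1\<^sub>m m" .
  moreover have "x \<in> V" unfolding V_def x
    using V_entries[OF k] by (intro unitriI) auto
  ultimately show "x \<in> U" by (intro UI)
  have "x - 1\<^sub>m m = 2 \<cdot>\<^sub>m (k - 1\<^sub>m m)" unfolding x by (rule eq_matI) auto
  also have "k - 1\<^sub>m m = s * k"
    unfolding k1[symmetric] by (rule eq_matI) (auto simp del: index_mult_mat(1))
  finally show "x - 1\<^sub>m m = 2 \<cdot>\<^sub>m (s * k)" .
  have "S x = k - dag k"
    unfolding S_def dx unfolding x using two_neq_0 by (intro eq_matI) (auto simp: field_simps)
  thus "S x = 2 \<cdot>\<^sub>m (k * s * dag k)" unfolding kmdk .
qed

lemma cayley_unique:
  assumes "cayley x s k" "cayley x s' k'"
  shows "s = s'"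
proof -
  note c = assms[unfolded cayley_def]
  have [simp]: "dim_row s = m" "dim_col s = m" "dim_row k = m" "dim_col k = m"
    "dim_row s' = m" "dim_col s' = m" "dim_row k' = m" "dim_col k' = m"
    using c by auto
  have "k $$ (i, j) = k' $$ (i, j)" if "i < m" "j < m" for i j
  proof -
    have "(2 \<cdot>\<^sub>m k - 1\<^sub>m m) $$ (i, j) = (2 \<cdot>\<^sub>m k' - 1\<^sub>m m) $$ (i, j)" using c by metis
    thus ?thesis using that two_neq_0 by simp
  qed
  hence kk: "k = k'" by (intro eq_matI) auto
  have "1\<^sub>m m - s = (1\<^sub>m m - s) * (k * (1\<^sub>m m - s'))" using c unfolding kk by simp
  also have "\<dots> = 1\<^sub>m m - s'"
    by (rule mat_inverse_mult) (use c in auto)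
  finally have e: "1\<^sub>m m - s = 1\<^sub>m m - s'" .
  show "s = s'"
  proof (rule eq_matI)
    fix i j assume "i < dim_row s'" "j < dim_col s'"
    hence ij: "i < m" "j < m" by auto
    have "(1\<^sub>m m - s) $$ (i, j) = (1\<^sub>m m - s') $$ (i, j)" unfolding e ..
    thus "s $$ (i, j) = s' $$ (i, j)" using ij by simp
  qed auto
qed

text \<open>Solve \<open>x = 2 k - 1\<close> and \<open>k (1 - s) = 1\<close> for \<open>s\<close>.
  Skewness: \<open>dag x + 1 = dag x * (x + 1)\<close> gives \<open>dag k = dag x * k\<close>, so
  the inverse \<open>p\<close> of \<open>k\<close> satisfies \<open>dag p = p * x = 2 - p\<close>,
  and \<open>s = 1 - p\<close> changes its sign under \<open>dag\<close>.\<close>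

lemma cayley_ex_s:
  assumes x: "x \<in> U"
  obtains s k where "cayley x s k"
proof -
  note xU = UD[OF x]
  define k where "k = (1/2) \<cdot>\<^sub>m (x + 1\<^sub>m m)"
  have kV: "k \<in> V" unfolding k_def V_def by (rule unitri_half_sum[OF two_neq_0]) (use xU V_def in auto)
  obtain p where p: "p \<in> V" "k * p = 1\<^sub>m m" "p * k = 1\<^sub>m m" using V_inverse[OF kV] .
  define s where "s = 1\<^sub>m m - p"
  have [simp]: "dim_row x = m" "dim_col x = m" "dim_row k = m" "dim_col k = m" "dim_row p = m" "dim_col p = m"
    using xU kV p by auto
  have sp: "1\<^sub>m m - s = p" unfolding s_def by (rule eq_matI) auto
  have x2k: "x = 2 \<cdot>\<^sub>m k - 1\<^sub>m m" unfolding k_def using two_neq_0 by (intro eq_matI) (auto simp: field_simps)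
  have dk: "dag k = dag x * k"
  proof -
    have "dag k = (1/2) \<cdot>\<^sub>m (dag x + 1\<^sub>m m)" unfolding k_def by (simp add: dag_smult dag_add)
    also have "dag x + 1\<^sub>m m = dag x * (x + 1\<^sub>m m)" unfolding xU(3)[symmetric]
      by (rule eq_matI) (auto simp: mat_alg xU(3) simp del: index_mult_mat(1))
    finally show ?thesis unfolding k_def by (simp add: mat_alg)
  qed
  have dp: "dag p = p * x"
  proof -
    have 1: "dag p * dag k = 1\<^sub>m m" using p(2) by (simp flip: dag_mult)
    have "p * x = dag p * dag k * (p * x)" unfolding 1 by simp
    also have "\<dots> = dag p * (dag x * (k * (p * x)))" unfolding dk by (simp add: mat_assoc)
    also have "k * (p * x) = x" by (rule mat_inverse_mult[OF p(2)]) auto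
    finally show ?thesis by (simp add: xU(3))
  qed
  have "dag s = 1\<^sub>m m - p * x" unfolding s_def by (simp add: dag_minus dp)
  also have "p * x = 2 \<cdot>\<^sub>m 1\<^sub>m m - p"
    unfolding x2k by (simp add: mat_alg p(3))
  also have "1\<^sub>m m - (2 \<cdot>\<^sub>m 1\<^sub>m m - p) = - s" unfolding s_def by (rule eq_matI) auto
  finally have "dag s = - s" .
  moreover have "s \<in> carrier_mat m m" by (simp add: s_def)
  moreover have "\<forall>i<m. \<forall>j\<le>i. s $$ (i, j) = 0"
  proof (intro allI impI)
    fix i j assume "i < m" "j \<le> i"
    thus "s $$ (i, j) = 0"
      using V_entries(1)[OF p(1), of j i] V_entries(2)[OF p(1), of i]
      by (cases "i = j") (auto simp: s_def)
  qed
  ultimately have "s \<in> skew" unfolding skew_def by blast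
  hence "cayley x s k" using kV p x2k by (simp add: cayley_def sp)
  with that show ?thesis .
qed

definition cay :: "'a mat \<Rightarrow> 'a mat" where
  "cay x = (SOME s. \<exists>k. cayley x s k)"

lemma cay:
  assumes "x \<in> U"
  obtains k where "cayley x (cay x) k"
proof -
  have "\<exists>s k. cayley x s k" using cayley_ex_s[OF assms] by metis
  from someI_ex[OF this] that show ?thesis unfolding cay_def by blast
qed

lemma cay_bij: "bij_betw cay U skew"
proof (rule bij_betwI')
  fix x y assume xy: "x \<in> U" "y \<in> U"
  show "cay x = cay y \<longleftrightarrow> x = y"
  proof
    assume e: "cay x = cay y"
    obtain k where k: "cayley x (cay x) k" using cay[OF xy(1)] .
    obtain k' where k': "cayley y (cay y) k'" using cay[OF xy(2)] .
    note c = k[unfolded cayley_def] k'[unfolded cayley_def, folded e]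
    have d: "dim_row (cay x) = m" "dim_col (cay x) = m" "dim_row k = m" "dim_col k = m" "dim_row k' = m" "dim_col k' = m"
      using c by auto
    have "k = k * ((1\<^sub>m m - cay x) * k')" using c d by simp
    also have "\<dots> = k'" by (rule mat_inverse_mult) (use c d in auto)
    finally show "x = y" using c by metis
  qed simp
next
  fix x assume "x \<in> U"
  from cay[OF this] show "cay x \<in> skew" unfolding cayley_def by metis
next
  fix s assume s: "s \<in> skew"
  obtain k where k: "k \<in> V" "(1\<^sub>m m - s) * k = 1\<^sub>m m" "k * (1\<^sub>m m - s) = 1\<^sub>m m"
    using V_inverse[OF skew_V[OF s]] .
  define x where "x = 2 \<cdot>\<^sub>m k - 1\<^sub>m m"
  have c: "cayley x s k" using s k by (simp add: cayley_def x_def)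
  have xU: "x \<in> U" by (rule cayley_facts(1)[OF c])
  obtain k' where "cayley x (cay x) k'" using cay[OF xU] .
  hence "s = cay x" using cayley_unique[OF c] by blast
  with xU show "\<exists>x\<in>U. s = cay x" by blast
qed

section \<open>Supercharacters on superclasses\<close>

lemma sum_V_shift:
  assumes "g \<in> V" "h \<in> V"
  shows "(\<Sum>(a, b)\<in>V \<times> V. F (a * g) (h * b) :: complex) = (\<Sum>(a, b)\<in>V \<times> V. F a b)"
proof -
  obtain g' where g': "g' \<in> V" "g * g' = 1\<^sub>m m" "g' * g = 1\<^sub>m m" using V_inverse[OF assms(1)] .
  obtain h' where h': "h' \<in> V" "h * h' = 1\<^sub>m m" "h' * h = 1\<^sub>m m" using V_inverse[OF assms(2)] .
  have 1: "a * g * g' = a" "a * g' * g = a" if "a \<in> V" for a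
    using that g' assms by (simp_all add: mat_assoc)
  have 2: "h' * (h * b) = b" "h * (h' * b) = b" if "b \<in> V" for b
    using that mat_inverse_mult[OF h'(3), of b] mat_inverse_mult[OF h'(2), of b] h' assms by simp_all
  show ?thesis
    by (rule sum.reindex_bij_witness[of _ "\<lambda>(a, b). (a * g', h' * b)" "\<lambda>(a, b). (a * g, h * b)"])
      (use 1 2 g' h' assms in auto)
qed

definition wt :: "root \<Rightarrow> 'a mat \<Rightarrow> 'a mat \<Rightarrow> 'a mat \<Rightarrow> 'a" where
  "wt \<alpha> s a b = (a * s * (if mir (rp \<alpha>) = rp \<alpha> then dag a else b)) $$ rp \<alpha>"

text \<open>The choice \<open>b = dag a\<close> is stable under the shift because
  \<open>dag (a * g) = dag g * dag a\<close>, so one substitution serves both kinds of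
  roots.\<close>

lemma wt_conj:
  assumes "s \<in> carrier_mat m m" "g \<in> V" "a \<in> V" "b \<in> V"
  shows "wt \<alpha> (g * s * dag g) a b = wt \<alpha> s (a * g) (dag g * b)"
proof -
  have [simp]: "dim_row s = m" "dim_col s = m" using assms(1) by auto
  have "a * (g * s * dag g) * dag a = a * g * s * dag (a * g)"
    "a * (g * s * dag g) * b = a * g * s * (dag g * b)"
    using assms(2-4) by (simp_all add: mat_assoc dag_mult)
  thus ?thesis by (simp add: wt_def)
qed

lemma rp_less:
  assumes "\<alpha> \<in> roots c n"
  shows "fst (rp \<alpha>) < m" "snd (rp \<alpha>) < m" "fst (rp \<alpha>) < snd (rp \<alpha>)"
  using RP_bounds[OF rp_in_RP[OF assms]] by auto

lemma smult_rp:
  assumes "\<alpha> \<in> roots c n" "A \<in> carrier_mat m m"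
  shows "(k \<cdot>\<^sub>m A) $$ rp \<alpha> = k * A $$ rp \<alpha>"
  using rp_less[OF assms(1)] assms(2) by (cases "rp \<alpha>") auto

text \<open>The factor \<open>k\<close> is absorbed by a translation of the summation:
  \<open>S x = 2 k s (dag k)\<close> sends \<open>a\<close> to \<open>a * k\<close> for
  self-mirrored roots, and \<open>x - 1 = 2 s k\<close> sends \<open>b\<close> to
  \<open>k * b\<close> for the others.\<close>

lemma elem_char_cay:
  assumes \<alpha>: "\<alpha> \<in> roots c n" and r: "r \<noteq> 0"
  shows "\<exists>C. \<forall>x\<in>U. elem_char c n \<theta> \<alpha> r x = C * (\<Sum>(a, b)\<in>V \<times> V. \<theta> (2 * (r * wt \<alpha> (cay x) a b)))"
proof -
  obtain C where C: "\<forall>x\<in>U. elem_char c n \<theta> \<alpha> r x = C * (\<Sum>(a, b)\<in>V \<times> V. \<theta> (r * moment \<alpha> x a b))"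
    using elem_char_moment[OF assms] by blast
  show ?thesis
  proof (intro exI[of _ C] ballI)
    fix x assume x: "x \<in> U"
    obtain k where k: "cayley x (cay x) k" using cay[OF x] .
    define s where "s = cay x"
    have s: "s \<in> skew" and kV: "k \<in> V" using k unfolding cayley_def s_def by blast+
    note facts = cayley_facts[OF k, folded s_def]
    have [simp]: "dim_row s = m" "dim_col s = m" using s by auto
    have "(\<Sum>(a, b)\<in>V \<times> V. \<theta> (r * moment \<alpha> x a b)) = (\<Sum>(a, b)\<in>V \<times> V. \<theta> (2 * (r * wt \<alpha> s a b)))"
    proof (cases "mir (rp \<alpha>) = rp \<alpha>")
      case True
      have "moment \<alpha> x a b = 2 * wt \<alpha> s (a * k) (1\<^sub>m m * b)" if "a \<in> V" for a b
      proof -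
        have "a * S x * dag a = 2 \<cdot>\<^sub>m (a * k * s * dag (a * k))"
          unfolding facts(3) using that kV by (simp add: mat_alg dag_mult)
        thus ?thesis using smult_rp[OF \<alpha>, of "a * k * s * dag (a * k)" 2] True that kV
          by (simp add: moment_def wt_def)
      qed
      hence "(\<Sum>(a, b)\<in>V \<times> V. \<theta> (r * moment \<alpha> x a b)) = (\<Sum>(a, b)\<in>V \<times> V. \<theta> (2 * (r * wt \<alpha> s (a * k) (1\<^sub>m m * b))))"
        by (intro sum.cong) (auto simp: mult_ac)
      also have "\<dots> = (\<Sum>(a, b)\<in>V \<times> V. \<theta> (2 * (r * wt \<alpha> s a b)))"
        by (rule sum_V_shift[OF kV V_one])
      finally show ?thesis .
    next
      case False
      have "moment \<alpha> x a b = 2 * wt \<alpha> s (a * 1\<^sub>m m) (k * b)" if "a \<in> V" "b \<in> V" for a b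
      proof -
        have "a * (x - 1\<^sub>m m) * b = 2 \<cdot>\<^sub>m (a * s * (k * b))"
          unfolding facts(2) using that kV by (simp add: mat_alg)
        thus ?thesis using smult_rp[OF \<alpha>, of "a * s * (k * b)" 2] False that kV
          by (simp add: moment_def wt_def)
      qed
      hence "(\<Sum>(a, b)\<in>V \<times> V. \<theta> (r * moment \<alpha> x a b)) = (\<Sum>(a, b)\<in>V \<times> V. \<theta> (2 * (r * wt \<alpha> s (a * 1\<^sub>m m) (k * b))))"
        by (intro sum.cong) (auto simp: mult_ac)
      also have "\<dots> = (\<Sum>(a, b)\<in>V \<times> V. \<theta> (2 * (r * wt \<alpha> s a b)))"
        by (rule sum_V_shift[OF V_one kV])
      finally show ?thesis .
    qed
    thus "elem_char c n \<theta> \<alpha> r x = C * (\<Sum>(a, b)\<in>V \<times> V. \<theta> (2 * (r * wt \<alpha> (cay x) a b)))"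
      unfolding bspec[OF C x] s_def by simp
  qed
qed

text \<open>Skew elements in the same two-sided orbit are congruent: if \<open>P s R\<close> is skew, then
  \<open>h = (R\<^sup>\<dagger>)\<^sup>-\<^sup>1 P\<close> satisfies \<open>h s = s h\<^sup>\<dagger>\<close>, and so does its square root.\<close>

lemma skew_congruent:
  assumes s: "s \<in> skew" "s' \<in> skew" and eq: "s' = P * s * R" and PQ: "P \<in> V" "R \<in> V"
  obtains g where "g \<in> V" "s' = g * s * dag g"
proof -
  have ds: "dag s = - s" "dag s' = - s'" using s unfolding skew_def by blast+
  have sc: "s \<in> carrier_mat m m" using s(1) unfolding skew_def by blast
  have [simp]: "dim_row s = m" "dim_col s = m" "dim_row s' = m" "dim_col s' = m" using s by auto
  have "- s' = dag R * (- s) * dag P"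
    unfolding ds[symmetric] unfolding eq using PQ sc by (simp add: dag_mult mat_assoc)
  hence "- s' = - (dag R * s * dag P)" using PQ by simp
  hence e: "P * s * R = dag R * s * dag P" unfolding eq[symmetric] uminus_eq_mat .
  obtain d where d: "d \<in> V" "dag R * d = 1\<^sub>m m" "d * dag R = 1\<^sub>m m" using V_inverse[OF V_dag[OF PQ(2)]] .
  define h where "h = d * P"
  have hV: "h \<in> V" using d PQ by (simp add: h_def)
  have dd: "R * dag d = 1\<^sub>m m" using arg_cong[OF d(3), of dag] d(1) PQ by (simp add: dag_mult)
  have hs: "h * s = s * dag h"
  proof -
    have "h * s = d * (P * s * R) * dag d"
      using d(1) PQ dd by (simp add: h_def mat_assoc)
    also have "\<dots> = d * (dag R * (s * (dag P * dag d)))"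
      unfolding e using d(1) PQ by (simp add: mat_assoc)
    also have "\<dots> = s * (dag P * dag d)"
      by (rule mat_inverse_mult[OF d(3)]) (use d PQ in auto)
    finally show ?thesis unfolding h_def using d PQ by (simp add: dag_mult)
  qed
  obtain i where i: "h ^\<^sub>m i * h ^\<^sub>m i = h" "h ^\<^sub>m i \<in> V"
    using unitri_sqrt[OF two_neq_0 hV[unfolded V_def]] unfolding V_def by metis
  have pc: "dim_row (h ^\<^sub>m l) = m" "dim_col (h ^\<^sub>m l) = m" for l
    using pow_carrier_mat[OF V_carrier[OF hV], of l] by auto
  have comm: "h * h ^\<^sub>m l = h ^\<^sub>m l * h" for l
  proof (induction l)
    case (Suc l)
    have "h * (h ^\<^sub>m l * h) = h * h ^\<^sub>m l * h" by (rule mat_assoc[symmetric]) (simp_all add: hV pc)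
    also have "\<dots> = h ^\<^sub>m l * h * h" unfolding Suc ..
    finally show ?case by simp
  qed (use hV in simp)
  have pow: "h ^\<^sub>m l * s = s * dag (h ^\<^sub>m l)" for l
  proof (induction l)
    case (Suc l)
    have hl: "h \<in> carrier_mat m m" "h ^\<^sub>m l \<in> carrier_mat m m" using V_carrier[OF hV] pc by simp_all
    have "h ^\<^sub>m l * h * s = h ^\<^sub>m l * (h * s)" by (rule mat_assoc) (simp_all add: hV pc)
    also have "\<dots> = h ^\<^sub>m l * s * dag h" unfolding hs by (rule mat_assoc[symmetric]) (simp_all add: hV pc)
    also have "\<dots> = s * (dag (h ^\<^sub>m l) * dag h)" unfolding Suc by (rule mat_assoc) simp_all
    also have "dag (h ^\<^sub>m l) * dag h = dag (h ^\<^sub>m l * h)" using dag_mult[OF hl] unfolding comm ..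
    finally show ?case by simp
  qed (use hV in simp)
  define k where "k = h ^\<^sub>m i"
  have k: "k \<in> V" "k * k = h" "k * s = s * dag k" using i pow by (simp_all add: k_def)
  \<comment> \<open>\<open>P = dag R * h\<close> contains two factors \<open>k\<close>; moving one
    of them past \<open>s\<close>, where it becomes \<open>dag k\<close>, makes
    \<open>P * s * R\<close> a congruence by \<open>dag R * k\<close>.\<close>
  have Pe: "P = dag R * (k * k)"
    unfolding k(2) using mat_inverse_mult[OF d(2), of P] d(1) PQ by (simp add: h_def)
  have "s' = dag R * (k * k) * s * R" unfolding eq by (subst Pe) (rule refl)
  also have "\<dots> = dag R * (k * (k * s)) * R" using k(1) PQ(2) by (simp add: mat_assoc)
  also have "\<dots> = (dag R * k) * s * dag (dag R * k)"
    unfolding k(3) using k(1) PQ by (simp add: mat_assoc dag_mult)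
  finally have "s' = (dag R * k) * s * dag (dag R * k)" .
  with that[of "dag R * k"] k PQ show ?thesis by simp
qed

text \<open>With \<open>s = cay z\<close>, the identity \<open>z - 1 = 2 s k\<close> turns into
  \<open>s = (1/2) (z - 1) (1 - s)\<close>, so \<open>s\<close> lies in the double coset of half the
  monomial matrix of the superclass. For two elements of the superclass both transforms are skew
  matrices in one double coset, and \<open>skew_congruent\<close> applies.\<close>

lemma superclass_cay_congruent:
  fixes \<phi> :: "root \<Rightarrow> 'a"
  assumes "x \<in> superclass c n D \<phi>" "y \<in> superclass c n D \<phi>"
  obtains g where "g \<in> V" "cay y = g * cay x * dag g"
proof -
  have half: "\<exists>a\<in>V. \<exists>b\<in>V. cay z = a * ((1/2) \<cdot>\<^sub>m e_mat c n D \<phi>) * b" if z: "z \<in> superclass c n D \<phi>" for z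
  proof -
    obtain a b where ab: "z \<in> U" "a \<in> V" "b \<in> V" "z - 1\<^sub>m m = a * e_mat c n D \<phi> * b"
      using z unfolding superclass_iff by blast
    obtain k where k: "cayley z (cay z) k" using cay[OF ab(1)] .
    have c: "cay z \<in> skew" "k \<in> V" "k * (1\<^sub>m m - cay z) = 1\<^sub>m m" using k unfolding cayley_def by blast+
    have V1: "1\<^sub>m m - cay z \<in> V" by (rule skew_V[OF c(1)])
    have [simp]: "dim_row (cay z) = m" "dim_col (cay z) = m" using c(1) by auto
    have "cay z = cay z * (k * (1\<^sub>m m - cay z))" unfolding c(3) by simp
    also have "\<dots> = (cay z * k) * (1\<^sub>m m - cay z)" using c(2) by (intro mat_assoc[symmetric]) auto
    also have "cay z * k = (1/2) \<cdot>\<^sub>m (z - 1\<^sub>m m)"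
      unfolding cayley_facts(2)[OF k] using two_neq_0 by (intro eq_matI) (auto simp del: index_mult_mat(1))
    also have "\<dots> * (1\<^sub>m m - cay z) = a * ((1/2) \<cdot>\<^sub>m e_mat c n D \<phi>) * (b * (1\<^sub>m m - cay z))"
    proof -
      have "((1/2) \<cdot>\<^sub>m (a * e_mat c n D \<phi> * b)) * w = a * ((1/2) \<cdot>\<^sub>m e_mat c n D \<phi>) * (b * w)"
        if "w \<in> V" for w
        using that ab(2,3) by (simp add: mat_smult_left mat_smult_right mat_assoc)
      from this[OF V1] show ?thesis unfolding ab(4) .
    qed
    finally show ?thesis using ab V1 V_mult by blast
  qed
  obtain a b where ab: "a \<in> V" "b \<in> V" "cay x = a * ((1/2) \<cdot>\<^sub>m e_mat c n D \<phi>) * b" using half[OF assms(1)] by blast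
  obtain a' b' where ab': "a' \<in> V" "b' \<in> V" "cay y = a' * ((1/2) \<cdot>\<^sub>m e_mat c n D \<phi>) * b'" using half[OF assms(2)] by blast
  have "(1/2) \<cdot>\<^sub>m e_mat c n D \<phi> \<in> carrier_mat m m" by simp
  from V_cancel[OF ab(3)[symmetric] ab(1,2) this] obtain p q where
    pq: "p \<in> V" "q \<in> V" "(1/2) \<cdot>\<^sub>m e_mat c n D \<phi> = p * cay x * q" by metis
  have xy: "x \<in> U" "y \<in> U" using assms unfolding superclass_iff by blast+
  have sk: "cay x \<in> skew" "cay y \<in> skew" using cay_bij xy by (auto dest: bij_betwE)
  have "cay y = (a' * p) * cay x * (q * b')"
    unfolding ab'(3) pq(3) using ab'(1,2) pq(1,2) skew_dim[OF sk(1)] by (simp add: mat_assoc)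
  from skew_congruent[OF sk this] ab' pq that show ?thesis by auto
qed

lemma elem_char_superclass:
  fixes \<phi> :: "root \<Rightarrow> 'a"
  assumes xy: "x \<in> superclass c n D \<phi>" "y \<in> superclass c n D \<phi>" and \<alpha>: "\<alpha> \<in> roots c n" and r: "r \<noteq> 0"
  shows "elem_char c n \<theta> \<alpha> r x = elem_char c n \<theta> \<alpha> r y"
proof -
  obtain g where g: "g \<in> V" "cay y = g * cay x * dag g" using superclass_cay_congruent[OF xy] .
  have U: "x \<in> U" "y \<in> U" using xy unfolding superclass_iff by blast+
  have sc: "cay x \<in> carrier_mat m m" using cay_bij U(1) by (auto dest!: bij_betwE)
  obtain C where C: "\<forall>x\<in>U. elem_char c n \<theta> \<alpha> r x = C * (\<Sum>(a, b)\<in>V \<times> V. \<theta> (2 * (r * wt \<alpha> (cay x) a b)))"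
    using elem_char_cay[OF \<alpha> r] by blast
  have "(\<Sum>(a, b)\<in>V \<times> V. \<theta> (2 * (r * wt \<alpha> (cay y) a b))) =
      (\<Sum>(a, b)\<in>V \<times> V. \<theta> (2 * (r * wt \<alpha> (cay x) (a * g) (dag g * b))))"
    unfolding g(2) using wt_conj[OF sc g(1)] by (intro sum.cong) auto
  also have "\<dots> = (\<Sum>(a, b)\<in>V \<times> V. \<theta> (2 * (r * wt \<alpha> (cay x) a b)))"
    by (rule sum_V_shift[OF g(1) V_dag[OF g(1)]])
  finally show ?thesis using C U by simp
qed

lemma basic_pair_nonzero: "(D, \<phi>) \<in> basic_pairs c n \<Longrightarrow> \<alpha> \<in> D \<Longrightarrow> \<phi> \<alpha> \<noteq> 0"
  by (auto simp: basic_pairs_def PiE_def Pi_def)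

lemma superchar_superclass:
  fixes \<phi> \<phi>' :: "root \<Rightarrow> 'a"
  assumes "x \<in> superclass c n D \<phi>" "y \<in> superclass c n D \<phi>" and "(D', \<phi>') \<in> basic_pairs c n"
  shows "superchar c n \<theta> D' \<phi>' x = superchar c n \<theta> D' \<phi>' y"
  unfolding superchar_def
  by (intro prod.cong refl elem_char_superclass[OF assms(1,2)] basic_pair_nonzero[OF assms(3)])
    (use basic_pairsD(2)[OF assms(3)] in auto)

section \<open>Orthogonality\<close>

definition unitm :: "nat \<Rightarrow> nat \<Rightarrow> 'a mat" where
  "unitm k l = mat m m (\<lambda>(x, y). if x = k \<and> y = l then 1 else 0)"

lemma unitm_dim [simp]: "dim_row (unitm k l) = m" "dim_col (unitm k l) = m"
  by (simp_all add: unitm_def)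

lemma mult_unitm_mult:
  assumes "a \<in> carrier_mat m m" "b \<in> carrier_mat m m" "k < m" "l < m" "i < m" "j < m"
  shows "(a * unitm k l * b) $$ (i, j) = a $$ (i, k) * b $$ (l, j)"
proof -
  have [simp]: "dim_row a = m" "dim_col a = m" "dim_row b = m" "dim_col b = m" using assms by auto
  have "(a * unitm k l) $$ (i, y) = (if y = l then a $$ (i, k) else 0)" if "y < m" for y
    using mult_entry_single[of a "unitm k l" i y k] assms that by (auto simp: unitm_def)
  moreover from this have "(a * unitm k l * b) $$ (i, j) = (a * unitm k l) $$ (i, l) * b $$ (l, j)"
    by (intro mult_entry_single) (use assms in auto)
  ultimately show ?thesis using assms by simp
qed

text \<open>A spanning set of \<open>skew\<close>, on which functionals are compared. At a
  self-mirrored position the two terms add up to twice a matrix unit for \<open>Sp\<close> and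
  cancel for the orthogonal groups.\<close>

definition skew_unit :: "nat \<Rightarrow> nat \<Rightarrow> 'a mat" where
  "skew_unit k l = unitm k l - dag (unitm k l)"

lemma skew_unit_skew:
  assumes "k < l" "l < m"
  shows "skew_unit k l \<in> skew"
proof -
  have "dag (skew_unit k l) = - skew_unit k l"
    unfolding skew_unit_def by (simp add: dag_minus) (rule eq_matI; simp)
  moreover have "\<forall>i<m. \<forall>j\<le>i. skew_unit k l $$ (i, j) = 0"
    using assms by (auto simp: skew_unit_def dag_index unitm_def)
  moreover have "skew_unit k l \<in> carrier_mat m m" by (simp add: skew_unit_def)
  ultimately show ?thesis unfolding skew_def by blast
qed

section \<open>Functionals on skew matrices and the matrices representing them\<close>

definition bt :: "root \<Rightarrow> 'a mat \<times> 'a mat \<Rightarrow> 'a mat" where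
  "bt \<alpha> p = (if mir (rp \<alpha>) = rp \<alpha> then dag (fst p) else snd p)"

definition wtp :: "root \<Rightarrow> 'a mat \<Rightarrow> 'a mat \<times> 'a mat \<Rightarrow> 'a" where
  "wtp \<alpha> s p = wt \<alpha> s (fst p) (snd p)"

lemma bt_V: "p \<in> V \<times> V \<Longrightarrow> bt \<alpha> p \<in> V"
  by (auto simp: bt_def)

text \<open>The adjoint half of the skew unit contributes like the unit itself, with
  \<open>(a, b)\<close> replaced by \<open>(dag b, dag a)\<close> and the position by its mirror
  image. So each root claims a row and a column for each of its entries.\<close>

lemma wtp_skew_unit:
  assumes kl: "k < l" "l < m" and p: "p \<in> V \<times> V" and \<alpha>: "\<alpha> \<in> roots c n" and ij: "rp \<alpha> = (i, j)"
  shows "wtp \<alpha> (skew_unit k l) p = fst p $$ (i, k) * bt \<alpha> p $$ (l, j) -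
    eps i * eps j * (dag (bt \<alpha> p) $$ (m - 1 - j, k) * dag (fst p) $$ (l, m - 1 - i))"
proof -
  define a b where "a = fst p" and "b = bt \<alpha> p"
  have ab: "a \<in> V" "b \<in> V" using p bt_V by (auto simp: a_def b_def)
  have lt: "i < m" "j < m" "m - 1 - j < m" "m - 1 - i < m" using rp_less[OF \<alpha>] by (auto simp: ij)
  have "wtp \<alpha> (skew_unit k l) p = (a * skew_unit k l * b) $$ (i, j)"
    by (simp add: wtp_def wt_def a_def b_def bt_def ij)
  also have "a * skew_unit k l * b = a * unitm k l * b - dag (dag b * unitm k l * dag a)"
    using ab by (simp add: skew_unit_def mat_alg dag_mult)
  also have "\<dots> $$ (i, j) = (a * unitm k l * b) $$ (i, j) - eps i * eps j * (dag b * unitm k l * dag a) $$ (m - 1 - j, m - 1 - i)"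
    using lt ab by (simp add: dag_index del: index_mult_mat(1))
  also have "(a * unitm k l * b) $$ (i, j) = a $$ (i, k) * b $$ (l, j)"
    by (rule mult_unitm_mult) (use ab kl lt in auto)
  also have "(dag b * unitm k l * dag a) $$ (m - 1 - j, m - 1 - i) = dag b $$ (m - 1 - j, k) * dag a $$ (l, m - 1 - i)"
    by (rule mult_unitm_mult) (use ab kl lt in auto)
  finally show ?thesis by (simp add: a_def b_def)
qed

lemma e_mat_nonzero:
  fixes \<phi> :: "root \<Rightarrow> 'a"
  assumes D: "D \<subseteq> roots c n" and \<alpha>: "\<alpha> \<in> D" "\<phi> \<alpha> \<noteq> 0" and e: "e \<in> {rp \<alpha>, mir (rp \<alpha>)}"
  shows "e_mat c n D \<phi> $$ e \<noteq> 0"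
proof -
  have r: "\<alpha> \<in> roots c n" using D \<alpha> by auto
  have 1: "e_mat c n D \<phi> $$ rp \<alpha> \<noteq> 0" using e_mat_rp[OF D r, of \<phi>] \<alpha> by simp
  obtain p q where pq: "mir (rp \<alpha>) = (p, q)" by force
  have lt: "p < m" "q < m" using rp_less[OF r] pq unfolding mir_def by auto
  have mm: "mir (p, q) = rp \<alpha>" using mir_mir[of "rp \<alpha>"] rp_less[OF r] pq by simp
  have "- e_mat c n D \<phi> $$ (p, q) = eps p * eps q * e_mat c n D \<phi> $$ rp \<alpha>"
    using dag_index_mir[of "(p, q)" "e_mat c n D \<phi>"] lt dag_e_mat[OF D, of \<phi>] by (simp add: mm)
  hence "e_mat c n D \<phi> $$ (p, q) \<noteq> 0" using 1 by (auto simp: eps_def split: if_splits)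
  thus ?thesis using 1 e pq by auto
qed

text \<open>For \<open>\<alpha> = 2\<epsilon>\<^sub>i\<close> the two mirrored contributions of a skew matrix unit coincide, whence the factor 2.\<close>

definition phit :: "root set \<Rightarrow> (root \<Rightarrow> 'a) \<Rightarrow> root \<Rightarrow> 'a" where
  "phit D \<phi> = restrict (\<lambda>\<alpha>. if mir (rp \<alpha>) = rp \<alpha> then 2 * \<phi> \<alpha> else \<phi> \<alpha>) D"

lemma phit_basic_pairs:
  assumes "(D, \<phi>) \<in> basic_pairs c n"
  shows "(D, phit D \<phi>) \<in> basic_pairs c n"
  using assms basic_pair_nonzero[OF assms] two_neq_0 by (auto simp: basic_pairs_def phit_def)

lemma phit_inj:
  assumes "(D, \<phi>) \<in> basic_pairs c n" "(D, \<phi>') \<in> basic_pairs c n" "phit D \<phi> = phit D \<phi>'"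
  shows "\<phi> = \<phi>'"
proof
  fix \<alpha>
  have "phit D \<phi> \<alpha> = phit D \<phi>' \<alpha>" using assms(3) by simp
  thus "\<phi> \<alpha> = \<phi>' \<alpha>"
    using assms(1,2) two_neq_0 by (cases "\<alpha> \<in> D") (auto simp: phit_def basic_pairs_def PiE_def extensional_def split: if_splits)
qed

lemma sum_root_entries:
  assumes \<alpha>: "\<alpha> \<in> roots c n" and ij: "rp \<alpha> = (i, j)"
  shows "(\<Sum>(p, q)\<in>{..<m} \<times> {..<m}. (if (p, q) = rp \<alpha> then 1 else if mir (p, q) = rp \<alpha> then - (eps p * eps q) else 0) * G (p, q) :: 'a) =
    G (i, j) - (if mir (i, j) = (i, j) then 0 else eps i * eps j * G (mir (i, j)))"
proof -
  have lt: "i < m" "j < m" using rp_less[OF \<alpha>] by (auto simp: ij)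
  obtain p' q' where pq: "mir (i, j) = (p', q')" by force
  have p'q': "p' = m - 1 - j" "q' = m - 1 - i" using pq unfolding mir_def by auto
  hence lt': "p' < m" "q' < m" using lt by auto
  have ee: "eps p' * eps q' = eps i * eps j"
    unfolding p'q' using eps_flip[OF lt(2,1)] by (simp add: mult.commute)
  have mm: "mir (p', q') = (i, j)" using mir_mir[of "(i, j)"] lt pq by simp
  let ?R = "\<lambda>e. (if e = (i, j) then 1 else if mir e = (i, j) then - (eps (fst e) * eps (snd e)) else 0) * G e :: 'a"
  have "(\<Sum>e\<in>{..<m} \<times> {..<m}. ?R e) = (\<Sum>e\<in>{(i, j), (p', q')}. ?R e)"
  proof (rule sum.mono_neutral_right)
    show "\<forall>e\<in>{..<m} \<times> {..<m} - {(i, j), (p', q')}. ?R e = 0"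
    proof
      fix e assume e: "e \<in> {..<m} \<times> {..<m} - {(i, j), (p', q')}"
      have "mir e \<noteq> (i, j)"
      proof
        assume "mir e = (i, j)"
        hence "mir (mir e) = (p', q')" using pq by simp
        thus False using mir_mir[of e] e by auto
      qed
      thus "?R e = 0" using e by auto
    qed
  qed (use lt lt' in auto)
  also have "\<dots> = G (i, j) - (if (p', q') = (i, j) then 0 else eps i * eps j * G (p', q'))"
  proof (cases "(p', q') = (i, j)")
    case False
    hence "(\<Sum>e\<in>{(i, j), (p', q')}. ?R e) = ?R (i, j) + ?R (p', q')" by (subst sum.insert) auto
    also have "?R (p', q') = - (eps i * eps j) * G (p', q')" using False mm ee by (simp del: prod.inject)
    finally show ?thesis using False by (simp del: prod.inject)
  qed simp
  finally show ?thesis unfolding ij pq case_prod_unfold prod.collapse .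
qed

text \<open>Unitriangularity constrains each row separately, so the rows may be taken from different
  members of \<open>V\<close>.\<close>

lemma V_from_rows:
  assumes "\<And>p. p < m \<Longrightarrow> F p \<in> V"
  shows "mat m m (\<lambda>(p, k). F p $$ (p, k)) \<in> V"
  unfolding V_def using V_entries[OF assms] by (intro unitriI) auto

lemma V_from_cols:
  assumes "\<And>q. q < m \<Longrightarrow> F q \<in> V"
  shows "mat m m (\<lambda>(k, q). F q $$ (k, q)) \<in> V"
  unfolding V_def
proof (rule unitriI)
  fix i j assume "j < i" "i < m"
  thus "mat m m (\<lambda>(k, q). F q $$ (k, q)) $$ (i, j) = 0" using V_entries(1)[OF assms[of j], of j i] by simp
next
  fix i assume "i < m"
  thus "mat m m (\<lambda>(k, q). F q $$ (k, q)) $$ (i, i) = 1" using V_entries(2)[OF assms[of i], of i] by simp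
qed simp

text \<open>Distinct roots of a basic set have entries in distinct rows and columns, so the rows and columns
  occurring in the functionals \<open>wtp \<alpha>\<close> fit together into a single pair of unitriangular matrices.\<close>

lemma assemble:
  assumes P: "(D, \<phi>) \<in> basic_pairs c n" and f: "\<And>\<alpha>. \<alpha> \<in> D \<Longrightarrow> f \<alpha> \<in> V \<times> V"
  obtains A B where "A \<in> V" "B \<in> V"
    "\<And>k l. k < l \<Longrightarrow> l < m \<Longrightarrow> (\<Sum>\<alpha>\<in>D. \<phi> \<alpha> * wtp \<alpha> (skew_unit k l) (f \<alpha>)) =
      (B * transpose_mat (e_mat c n D (phit D \<phi>)) * A) $$ (l, k)"
proof -
  define M where "M = e_mat c n D (phit D \<phi>)"
  note P' = phit_basic_pairs[OF P]
  have D: "D \<subseteq> roots c n" using basic_pairsD(2)[OF P] .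
  have finD: "finite D" using D finite_roots finite_subset by blast
  have mon: "monomial m M" unfolding M_def by (rule basic_monomial[OF basic_pairsD(1)[OF P]])
  \<comment> \<open>As \<open>D\<close> is basic, an element of \<open>X\<close> is determined by
    the row of its position, and also by the column; this makes the choices in \<open>A\<close> and
    \<open>B\<close> below unambiguous.\<close>
  define X where "X = (SIGMA \<alpha>:D. {rp \<alpha>, mir (rp \<alpha>)})"
  have XD: "\<alpha> \<in> D" "\<alpha> \<in> roots c n" "M $$ e \<noteq> 0" "fst e < m" "snd e < m" if "(\<alpha>, e) \<in> X" for \<alpha> e
  proof -
    show \<alpha>: "\<alpha> \<in> D" and r: "\<alpha> \<in> roots c n" using that D by (auto simp: X_def)
    show "M $$ e \<noteq> 0" unfolding M_def
      by (rule e_mat_nonzero[of D \<alpha> "phit D \<phi>", OF D \<alpha> basic_pair_nonzero[OF P' \<alpha>]]) (use that in \<open>auto simp: X_def\<close>)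
    show "fst e < m" "snd e < m" using that rp_less[OF r] unfolding X_def mir_def by auto
  qed
  have same: "\<alpha> = \<beta>" if "(\<alpha>, e) \<in> X" "(\<beta>, e) \<in> X" for \<alpha> \<beta> e
  proof -
    note r = XD(2)[OF that(1)] XD(2)[OF that(2)]
    have mm: "mir (mir (rp \<gamma>)) = rp \<gamma>" if "\<gamma> \<in> roots c n" for \<gamma>
      using mir_mir[of "rp \<gamma>"] rp_less[OF that] by simp
    have "e = rp \<alpha> \<or> e = mir (rp \<alpha>)" "e = rp \<beta> \<or> e = mir (rp \<beta>)" using that by (auto simp: X_def)
    hence "rp \<alpha> = rp \<beta> \<or> mir (rp \<alpha>) = rp \<beta> \<or> mir (rp \<beta>) = rp \<alpha>" using mm r by metis
    thus ?thesis using rp_inj rp_mir_eq r by metis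
  qed
  have row: "x = y" if xy: "x \<in> X" "y \<in> X" "fst (snd x) = fst (snd y)" for x y
  proof -
    obtain \<alpha> i j where x: "x = (\<alpha>, (i, j))" by (metis prod.collapse)
    obtain \<beta> j' where y: "y = (\<beta>, (i, j'))" using xy(3) x by (metis fst_conv prod.collapse snd_conv)
    have "j = j'" using monomial_rowD[OF mon, of i j j'] XD[of \<alpha> "(i, j)"] XD[of \<beta> "(i, j')"] xy x y by auto
    thus ?thesis using same xy x y by blast
  qed
  have column: "x = y" if xy: "x \<in> X" "y \<in> X" "snd (snd x) = snd (snd y)" for x y
  proof -
    obtain \<alpha> i j where x: "x = (\<alpha>, (i, j))" by (metis prod.collapse)
    obtain \<beta> i' where y: "y = (\<beta>, (i', j))" using xy(3) x by (metis prod.collapse snd_conv)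
    have "i = i'" using monomial_colD[OF mon, of i j i'] XD[of \<alpha> "(i, j)"] XD[of \<beta> "(i', j)"] xy x y by auto
    thus ?thesis using same xy x y by blast
  qed
  \<comment> \<open>At the mirrored entry the two matrices exchange their roles through
    \<open>dag\<close>, in accordance with the second term of \<open>wtp_skew_unit\<close>.\<close>
  define rowm where "rowm = (\<lambda>(\<alpha>, e). if e = rp \<alpha> then fst (f \<alpha>) else dag (bt \<alpha> (f \<alpha>)))"
  define colm where "colm = (\<lambda>(\<alpha>, e). if e = rp \<alpha> then bt \<alpha> (f \<alpha>) else dag (fst (f \<alpha>)))"
  have rcV: "rowm x \<in> V" "colm x \<in> V" if xX: "x \<in> X" for x
  proof -
    obtain \<alpha> e where x: "x = (\<alpha>, e)" by (cases x)
    have "f \<alpha> \<in> V \<times> V" using f XD(1) xX x by auto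
    thus "rowm x \<in> V" "colm x \<in> V" using bt_V[of "f \<alpha>" \<alpha>] by (auto simp: rowm_def colm_def x)
  qed
  \<comment> \<open>A row of \<open>A\<close> that belongs to no entry meets a zero row of
    \<open>M\<close> and has no effect; the identity is the default that keeps \<open>A\<close>
    unitriangular. The same holds for the columns of \<open>B\<close>.\<close>
  define A where "A = mat m m (\<lambda>(p, k). (if \<exists>x\<in>X. fst (snd x) = p then rowm (SOME x. x \<in> X \<and> fst (snd x) = p) else 1\<^sub>m m) $$ (p, k))"
  define B where "B = mat m m (\<lambda>(k, q). (if \<exists>x\<in>X. snd (snd x) = q then colm (SOME x. x \<in> X \<and> snd (snd x) = q) else 1\<^sub>m m) $$ (k, q))"
  have A_row: "A $$ (fst (snd x), k) = rowm x $$ (fst (snd x), k)" if "x \<in> X" "fst (snd x) < m" "k < m" for x k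
  proof -
    have "(SOME y. y \<in> X \<and> fst (snd y) = fst (snd x)) = x"
      by (rule some_equality) (use that row in auto)
    thus ?thesis using that by (auto simp: A_def)
  qed
  have B_col: "B $$ (k, snd (snd x)) = colm x $$ (k, snd (snd x))" if "x \<in> X" "snd (snd x) < m" "k < m" for x k
  proof -
    have "(SOME y. y \<in> X \<and> snd (snd y) = snd (snd x)) = x"
      by (rule some_equality) (use that column in auto)
    thus ?thesis using that by (auto simp: B_def)
  qed
  have AV: "A \<in> V" unfolding A_def
  proof (rule V_from_rows)
    fix p
    have "rowm (SOME x. x \<in> X \<and> fst (snd x) = p) \<in> V" if "\<exists>x\<in>X. fst (snd x) = p"
      using someI_ex[of "\<lambda>x. x \<in> X \<and> fst (snd x) = p"] that rcV(1) by blast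
    thus "(if \<exists>x\<in>X. fst (snd x) = p then rowm (SOME x. x \<in> X \<and> fst (snd x) = p) else 1\<^sub>m m) \<in> V" by simp
  qed
  have BV: "B \<in> V" unfolding B_def
  proof (rule V_from_cols)
    fix q
    have "colm (SOME x. x \<in> X \<and> snd (snd x) = q) \<in> V" if "\<exists>x\<in>X. snd (snd x) = q"
      using someI_ex[of "\<lambda>x. x \<in> X \<and> snd (snd x) = q"] that rcV(2) by blast
    thus "(if \<exists>x\<in>X. snd (snd x) = q then colm (SOME x. x \<in> X \<and> snd (snd x) = q) else 1\<^sub>m m) \<in> V" by simp
  qed
  have main: "(\<Sum>\<alpha>\<in>D. \<phi> \<alpha> * wtp \<alpha> (skew_unit k l) (f \<alpha>)) = (B * transpose_mat M * A) $$ (l, k)"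
    if kl: "k < l" "l < m" for k l
  proof -
    let ?R = "\<lambda>\<alpha> p q. (if (p, q) = rp \<alpha> then 1 else if mir (p, q) = rp \<alpha> then - (eps p * eps q) else 0) :: 'a"
    have Md [simp]: "dim_row M = m" "dim_col M = m" by (simp_all add: M_def)
    have "(B * transpose_mat M * A) $$ (l, k) = (\<Sum>p<m. (B * transpose_mat M) $$ (l, p) * A $$ (p, k))"
      by (rule mult_mat_entry[of _ m m _ m]) (use AV BV kl in auto)
    also have "\<dots> = (\<Sum>p<m. (\<Sum>q<m. B $$ (l, q) * M $$ (p, q)) * A $$ (p, k))"
    proof (rule sum.cong[OF refl])
      fix p assume "p \<in> {..<m}"
      hence "(B * transpose_mat M) $$ (l, p) = (\<Sum>q<m. B $$ (l, q) * transpose_mat M $$ (q, p))"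
        by (intro mult_mat_entry[of _ m m _ m]) (use BV kl in auto)
      also have "\<dots> = (\<Sum>q<m. B $$ (l, q) * M $$ (p, q))"
        by (rule sum.cong) (use \<open>p \<in> {..<m}\<close> in auto)
      finally show "(B * transpose_mat M) $$ (l, p) * A $$ (p, k) = (\<Sum>q<m. B $$ (l, q) * M $$ (p, q)) * A $$ (p, k)" by simp
    qed
    also have "\<dots> = (\<Sum>p<m. \<Sum>q<m. \<Sum>\<alpha>\<in>D. phit D \<phi> \<alpha> * (?R \<alpha> p q * (B $$ (l, q) * A $$ (p, k))))"
      unfolding sum_distrib_right
      by (intro sum.cong refl) (simp add: M_def e_mat_index[OF D] sum_distrib_left sum_distrib_right mult_ac)
    also have "\<dots> = (\<Sum>(p, q)\<in>{..<m} \<times> {..<m}. \<Sum>\<alpha>\<in>D. phit D \<phi> \<alpha> * (?R \<alpha> p q * (B $$ (l, q) * A $$ (p, k))))"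
      by (rule sum.cartesian_product)
    also have "\<dots> = (\<Sum>\<alpha>\<in>D. \<Sum>(p, q)\<in>{..<m} \<times> {..<m}. phit D \<phi> \<alpha> * (?R \<alpha> p q * (B $$ (l, q) * A $$ (p, k))))"
      unfolding case_prod_unfold by (rule sum.swap)
    also have "\<dots> = (\<Sum>\<alpha>\<in>D. \<phi> \<alpha> * wtp \<alpha> (skew_unit k l) (f \<alpha>))"
    proof (rule sum.cong[OF refl])
      fix \<alpha> assume \<alpha>: "\<alpha> \<in> D"
      hence r: "\<alpha> \<in> roots c n" using D by auto
      obtain i j where ij: "rp \<alpha> = (i, j)" by force
      have lt: "i < m" "j < m" "k < m" using rp_less[OF r] kl by (auto simp: ij)
      have mir: "mir (i, j) = (m - 1 - j, m - 1 - i)" by (simp add: mir_def)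
      have X: "(\<alpha>, (i, j)) \<in> X" "(\<alpha>, (m - 1 - j, m - 1 - i)) \<in> X" using \<alpha> ij mir by (auto simp: X_def)
      define a b where "a = fst (f \<alpha>)" and "b = bt \<alpha> (f \<alpha>)"
      have G1: "B $$ (l, j) * A $$ (i, k) = a $$ (i, k) * b $$ (l, j)"
        using A_row[OF X(1), of k] B_col[OF X(1), of l] lt kl by (simp add: rowm_def colm_def ij a_def b_def)
      have w: "wtp \<alpha> (skew_unit k l) (f \<alpha>) = a $$ (i, k) * b $$ (l, j) -
          eps i * eps j * (dag b $$ (m - 1 - j, k) * dag a $$ (l, m - 1 - i))"
        unfolding a_def b_def by (rule wtp_skew_unit[OF kl f[OF \<alpha>] r ij])
      have "(\<Sum>(p, q)\<in>{..<m} \<times> {..<m}. phit D \<phi> \<alpha> * (?R \<alpha> p q * (B $$ (l, q) * A $$ (p, k)))) =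
          phit D \<phi> \<alpha> * (\<Sum>(p, q)\<in>{..<m} \<times> {..<m}. ?R \<alpha> p q * (B $$ (l, snd (p, q)) * A $$ (fst (p, q), k)))"
        by (simp add: sum_distrib_left case_prod_unfold)
      also have "\<dots> = phit D \<phi> \<alpha> * (B $$ (l, j) * A $$ (i, k) -
          (if mir (i, j) = (i, j) then 0 else eps i * eps j * (B $$ (l, m - 1 - i) * A $$ (m - 1 - j, k))))"
        using sum_root_entries[OF r ij, of "\<lambda>e. B $$ (l, snd e) * A $$ (fst e, k)"] unfolding mir by simp
      also have "\<dots> = \<phi> \<alpha> * wtp \<alpha> (skew_unit k l) (f \<alpha>)"
      proof (cases "mir (i, j) = (i, j)")
        case True
        hence m': "m - 1 - j = i" "m - 1 - i = j" using mir by auto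
        have b: "b = dag a" using True by (simp add: b_def bt_def ij a_def)
        have aV: "a \<in> V" using f[OF \<alpha>] by (auto simp: a_def)
        have e: "eps i * eps j = - 1" using RP_self_mir[OF rp_in_RP[OF r]] True by (simp add: ij)
        have "wtp \<alpha> (skew_unit k l) (f \<alpha>) = 2 * (a $$ (i, k) * b $$ (l, j))"
          unfolding w m' e b dag_dag[OF V_carrier[OF aV]] by simp
        thus ?thesis using True \<alpha> by (simp add: G1 phit_def ij)
      next
        case False
        have "(m - 1 - j, m - 1 - i) \<noteq> rp \<alpha>" using False mir ij by simp
        hence G2: "B $$ (l, m - 1 - i) * A $$ (m - 1 - j, k) = dag b $$ (m - 1 - j, k) * dag a $$ (l, m - 1 - i)"
          using A_row[OF X(2), of k] B_col[OF X(2), of l] lt kl by (simp add: rowm_def colm_def a_def b_def)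
        show ?thesis unfolding w G1 G2 using False \<alpha> by (simp add: phit_def ij)
      qed
      finally show "(\<Sum>(p, q)\<in>{..<m} \<times> {..<m}. phit D \<phi> \<alpha> * (?R \<alpha> p q * (B $$ (l, q) * A $$ (p, k)))) =
          \<phi> \<alpha> * wtp \<alpha> (skew_unit k l) (f \<alpha>)" .
    qed
    finally show ?thesis by simp
  qed
  show ?thesis by (rule that[OF AV BV main[unfolded M_def]])
qed

lemma transpose_monomial:
  assumes "M \<in> carrier_mat m m" "monomial m M"
  shows "monomial m (transpose_mat M)"
proof (rule monomial_fromI)
  fix i j l assume "i < m" "j < m" "l < m" "transpose_mat M $$ (i, j) \<noteq> 0" "transpose_mat M $$ (i, l) \<noteq> 0"
  thus "j = l" using monomial_colD[OF assms(2), of j i l] assms(1) by auto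
next
  fix i i' j assume "i < m" "i' < m" "j < m" "transpose_mat M $$ (i, j) \<noteq> 0" "transpose_mat M $$ (i', j) \<noteq> 0"
  thus "i = i'" using monomial_rowD[OF assms(2), of j i i'] assms(1) by auto
qed

text \<open>A functional on strictly upper triangular matrices sees only the part of its matrix
  strictly below the diagonal. That region is lower closed, so \<open>A'\<close> and
  \<open>B'\<close> can be moved to the other side without knowing the rest of the products.\<close>

lemma lower_monomial_unique:
  assumes M: "M \<in> carrier_mat m m" "M' \<in> carrier_mat m m" "monomial m M" "monomial m M'"
    and V: "A \<in> V" "B \<in> V" "A' \<in> V" "B' \<in> V"
    and eq: "\<And>k l. k < l \<Longrightarrow> l < m \<Longrightarrow> (B * M * A) $$ (l, k) = (B' * M' * A') $$ (l, k)"
    and kl: "k < l" "l < m"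
  shows "M $$ (l, k) = M' $$ (l, k)"
proof -
  have low: "lower_closed (\<lambda>l k. k < l)" by (auto simp: lower_closed_def)
  obtain a where a: "a \<in> V" "A' * a = 1\<^sub>m m" "a * A' = 1\<^sub>m m" using V_inverse[OF V(3)] .
  obtain b where b: "b \<in> V" "B' * b = 1\<^sub>m m" "b * B' = 1\<^sub>m m" using V_inverse[OF V(4)] .
  have [simp]: "dim_row M = m" "dim_col M = m" "dim_row M' = m" "dim_col M' = m" using M by auto
  define N where "N = B * M * A - B' * M' * A'"
  have N: "N \<in> carrier_mat m m" using V by (simp add: N_def)
  have N0: "N $$ (l, k) = 0" if "l < m" "k < m" "k < l" for l k
    using eq[OF that(3,1)] that V by (simp add: N_def del: index_mult_mat(1))
  have Na: "(N * a) $$ (l, k) = 0" if "l < m" "k < m" "k < l" for l k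
    by (rule lower_closed_mult_right[OF low N a(1)[unfolded V_def] N0 that])
  have Nac: "N * a \<in> carrier_mat m m" using N a by simp
  have bNa: "(b * (N * a)) $$ (l, k) = 0" if "l < m" "k < m" "k < l" for l k
    by (rule lower_closed_mult_left[OF low Nac b(1)[unfolded V_def] Na that])
  have "N * a = B * M * (A * a) - B' * M'"
    using V a by (simp add: N_def mat_diff_distrib_right mat_assoc)
  hence "b * (N * a) = (b * B) * M * (A * a) - b * (B' * M')"
    using V a(1) b(1) by (simp add: mat_diff_distrib_left mat_assoc)
  also have "b * (B' * M') = M'" by (rule mat_inverse_mult[OF b(3)]) (use V b in auto)
  finally have e: "b * (N * a) = (b * B) * M * (A * a) - M'" .
  show ?thesis
  proof (rule monomial_unique[OF low M])
    show "b * B \<in> unitri m" "A * a \<in> unitri m" using V a b V_mult unfolding V_def by auto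
    fix i j assume ij: "i < m" "j < m" "j < i"
    have "((b * B) * M * (A * a) - M') $$ (i, j) = 0" using bNa[OF ij] unfolding e .
    thus "(b * B * M * (A * a)) $$ (i, j) = M' $$ (i, j)"
      using ij by (simp del: index_mult_mat(1) assoc_mult_mat)
  qed (use kl in auto)
qed

definition functional :: "root set \<Rightarrow> (root \<Rightarrow> 'a) \<Rightarrow> (root \<Rightarrow> 'a mat \<times> 'a mat) \<Rightarrow> 'a mat \<Rightarrow> 'a" where
  "functional D \<phi> f s = (\<Sum>\<alpha>\<in>D. \<phi> \<alpha> * wtp \<alpha> s (f \<alpha>))"

lemma functional_separates:
  assumes P: "(D, \<phi>) \<in> basic_pairs c n" "(D', \<phi>') \<in> basic_pairs c n"
    and f: "f \<in> D \<rightarrow>\<^sub>E V \<times> V" "f' \<in> D' \<rightarrow>\<^sub>E V \<times> V"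
    and eq: "\<And>s. s \<in> skew \<Longrightarrow> functional D \<phi> f s = functional D' \<phi>' f' s"
  shows "D = D' \<and> \<phi> = \<phi>'"
proof -
  let ?M = "e_mat c n D (phit D \<phi>)" and ?M' = "e_mat c n D' (phit D' \<phi>')"
  note P' = phit_basic_pairs[OF P(1)] phit_basic_pairs[OF P(2)]
  obtain A B where AB: "A \<in> V" "B \<in> V" "\<And>k l. k < l \<Longrightarrow> l < m \<Longrightarrow>
      (\<Sum>\<alpha>\<in>D. \<phi> \<alpha> * wtp \<alpha> (skew_unit k l) (f \<alpha>)) = (B * transpose_mat ?M * A) $$ (l, k)"
    by (rule assemble[OF P(1), of f]) (use PiE_mem[OF f(1)] in blast)+
  obtain A' B' where AB': "A' \<in> V" "B' \<in> V" "\<And>k l. k < l \<Longrightarrow> l < m \<Longrightarrow>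
      (\<Sum>\<alpha>\<in>D'. \<phi>' \<alpha> * wtp \<alpha> (skew_unit k l) (f' \<alpha>)) = (B' * transpose_mat ?M' * A') $$ (l, k)"
    by (rule assemble[OF P(2), of f']) (use PiE_mem[OF f(2)] in blast)+
  have eqs: "(B * transpose_mat ?M * A) $$ (l, k) = (B' * transpose_mat ?M' * A') $$ (l, k)" if "k < l" "l < m" for k l
    using eq[OF skew_unit_skew[OF that]] unfolding functional_def AB(3)[OF that] AB'(3)[OF that] .
  have "?M $$ rp \<alpha> = ?M' $$ rp \<alpha>" if \<alpha>: "\<alpha> \<in> roots c n" for \<alpha>
  proof -
    obtain i j where ij: "rp \<alpha> = (i, j)" by force
    have lt: "i < j" "j < m" "i < m" using rp_less[OF \<alpha>] by (auto simp: ij)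
    have "transpose_mat ?M $$ (j, i) = transpose_mat ?M' $$ (j, i)"
      by (rule lower_monomial_unique[OF _ _ _ _ AB(1,2) AB'(1,2) eqs lt(1,2)])
        (simp_all add: transpose_monomial basic_monomial basic_pairsD[OF P(1)] basic_pairsD[OF P(2)])
    thus ?thesis using lt by (simp add: ij)
  qed
  from e_mat_inj[OF P' this] have D: "D = D'" "phit D \<phi> = phit D' \<phi>'" by auto
  with phit_inj[of D \<phi> \<phi>'] P show ?thesis by simp
qed

lemma wtp_add:
  assumes \<alpha>: "\<alpha> \<in> roots c n" and s: "s \<in> carrier_mat m m" "s' \<in> carrier_mat m m" and p: "p \<in> V \<times> V"
  shows "wtp \<alpha> (s + k \<cdot>\<^sub>m s') p = wtp \<alpha> s p + k * wtp \<alpha> s' p"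
proof -
  obtain i j where ij: "rp \<alpha> = (i, j)" by force
  have lt: "i < m" "j < m" using rp_less[OF \<alpha>] by (auto simp: ij)
  define a b where "a = fst p" and "b = bt \<alpha> p"
  have ab: "a \<in> V" "b \<in> V" using p bt_V by (auto simp: a_def b_def)
  have [simp]: "dim_row s = m" "dim_col s = m" "dim_row s' = m" "dim_col s' = m" using s by auto
  have w: "wtp \<alpha> t p = (a * t * b) $$ (i, j)" for t by (simp add: wtp_def wt_def a_def b_def bt_def ij)
  have "a * (s + k \<cdot>\<^sub>m s') * b = a * s * b + k \<cdot>\<^sub>m (a * s' * b)" using ab by (simp add: mat_alg)
  thus ?thesis unfolding w using ab lt by (simp del: index_mult_mat(1))
qed

lemma functional_add:
  assumes "D \<subseteq> roots c n" "s \<in> skew" "s' \<in> skew" "f \<in> D \<rightarrow>\<^sub>E V \<times> V"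
  shows "functional D \<phi> f (s + k \<cdot>\<^sub>m s') = functional D \<phi> f s + k * functional D \<phi> f s'"
proof -
  have "functional D \<phi> f (s + k \<cdot>\<^sub>m s') = (\<Sum>\<alpha>\<in>D. \<phi> \<alpha> * wtp \<alpha> s (f \<alpha>) + k * (\<phi> \<alpha> * wtp \<alpha> s' (f \<alpha>)))"
    unfolding functional_def
  proof (rule sum.cong[OF refl])
    fix \<alpha> assume \<alpha>: "\<alpha> \<in> D"
    have "wtp \<alpha> (s + k \<cdot>\<^sub>m s') (f \<alpha>) = wtp \<alpha> s (f \<alpha>) + k * wtp \<alpha> s' (f \<alpha>)"
      by (rule wtp_add) (use \<alpha> assms(1-3) PiE_mem[OF assms(4) \<alpha>] in auto)
    thus "\<phi> \<alpha> * wtp \<alpha> (s + k \<cdot>\<^sub>m s') (f \<alpha>) = \<phi> \<alpha> * wtp \<alpha> s (f \<alpha>) + k * (\<phi> \<alpha> * wtp \<alpha> s' (f \<alpha>))"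
      by (simp add: algebra_simps)
  qed
  thus ?thesis by (simp add: functional_def sum.distrib sum_distrib_left)
qed

lemma skew_add:
  assumes "s \<in> skew" "s' \<in> skew"
  shows "s + k \<cdot>\<^sub>m s' \<in> skew"
proof -
  have d: "dag s = - s" "dag s' = - s'" "s \<in> carrier_mat m m" "s' \<in> carrier_mat m m"
    "\<forall>i<m. \<forall>j\<le>i. s $$ (i, j) = 0" "\<forall>i<m. \<forall>j\<le>i. s' $$ (i, j) = 0"
    using assms unfolding skew_def by blast+
  have [simp]: "dim_row s = m" "dim_col s = m" "dim_row s' = m" "dim_col s' = m" using d(3,4) by auto
  have "dag (s + k \<cdot>\<^sub>m s') = - s + k \<cdot>\<^sub>m (- s')" using d(1-4) by (simp add: dag_add dag_smult)
  also have "\<dots> = - (s + k \<cdot>\<^sub>m s')" by (rule eq_matI) auto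
  finally show ?thesis using d(5,6) unfolding skew_def by auto
qed

text \<open>The difference of the two functionals is linear and, by
  \<open>functional_separates\<close>, nonzero at some \<open>s0\<close>; translating by a suitable
  multiple of \<open>s0\<close> multiplies the sum by a value of \<open>\<theta>\<close> other than
  1.\<close>

lemma sum_skew_vanishes:
  assumes P: "(D, \<phi>) \<in> basic_pairs c n" "(D', \<phi>') \<in> basic_pairs c n" "(D, \<phi>) \<noteq> (D', \<phi>')"
    and f: "f \<in> D \<rightarrow>\<^sub>E V \<times> V" "f' \<in> D' \<rightarrow>\<^sub>E V \<times> V"
  shows "(\<Sum>s\<in>skew. \<theta> (2 * (functional D \<phi> f s - functional D' \<phi>' f' s))) = 0"
proof -
  define \<nu> where "\<nu> = (\<lambda>s. functional D \<phi> f s - functional D' \<phi>' f' s)"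
  obtain s0 where s0: "s0 \<in> skew" "\<nu> s0 \<noteq> 0"
    using functional_separates[OF P(1,2) f] P(3) unfolding \<nu>_def by fastforce
  have add: "\<nu> (s + k \<cdot>\<^sub>m s0) = \<nu> s + k * \<nu> s0" if "s \<in> skew" for s k
    unfolding \<nu>_def functional_add[OF basic_pairsD(2)[OF P(1)] that s0(1) f(1)]
      functional_add[OF basic_pairsD(2)[OF P(2)] that s0(1) f(2)] by (simp add: algebra_simps)
  have "2 * \<nu> s0 \<noteq> 0" using s0(2) two_neq_0 by simp
  then obtain k where k: "\<theta> (k * (2 * \<nu> s0)) \<noteq> 1" using theta_scale_nontrivial by metis
  have inv: "s + k \<cdot>\<^sub>m s0 + (- k) \<cdot>\<^sub>m s0 = s" "s + (- k) \<cdot>\<^sub>m s0 + k \<cdot>\<^sub>m s0 = s" if s: "s \<in> skew" for s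
    by (rule eq_matI; simp add: skew_dim[OF s] skew_dim[OF s0(1)])+
  have "(\<Sum>s\<in>skew. \<theta> (2 * \<nu> s)) = 0"
  proof (rule theta_sum_vanishes[of "\<lambda>s. s + k \<cdot>\<^sub>m s0"])
    show "bij_betw (\<lambda>s. s + k \<cdot>\<^sub>m s0) skew skew"
      by (rule bij_betw_byWitness[of _ "\<lambda>s. s + (- k) \<cdot>\<^sub>m s0"])
        (use inv skew_add[OF _ s0(1)] in auto)
    fix s assume "s \<in> skew"
    thus "2 * \<nu> (s + k \<cdot>\<^sub>m s0) = 2 * \<nu> s + k * (2 * \<nu> s0)" by (simp add: add algebra_simps)
  qed (rule k)
  thus ?thesis unfolding \<nu>_def .
qed

section \<open>Supercharacters as sums over functionals\<close>

lemma superchar_expansion: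
  assumes P: "(D, \<phi>) \<in> basic_pairs c n"
  shows "\<exists>C. \<forall>x\<in>U. superchar c n \<theta> D \<phi> x = C * (\<Sum>f\<in>D \<rightarrow>\<^sub>E V \<times> V. \<theta> (2 * functional D \<phi> f (cay x)))"
proof -
  note D = basic_pairsD(2)[OF P]
  have finD: "finite D" using D finite_roots finite_subset by blast
  have "\<forall>\<alpha>\<in>D. \<exists>C. \<forall>x\<in>U. elem_char c n \<theta> \<alpha> (\<phi> \<alpha>) x = C * (\<Sum>p\<in>V \<times> V. \<theta> (2 * (\<phi> \<alpha> * wtp \<alpha> (cay x) p)))"
    using elem_char_cay[OF _ basic_pair_nonzero[OF P]] D unfolding wtp_def case_prod_unfold by blast
  then obtain C where C: "\<forall>\<alpha>\<in>D. \<forall>x\<in>U. elem_char c n \<theta> \<alpha> (\<phi> \<alpha>) x = C \<alpha> * (\<Sum>p\<in>V \<times> V. \<theta> (2 * (\<phi> \<alpha> * wtp \<alpha> (cay x) p)))"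
    by metis
  show ?thesis
  proof (intro exI ballI)
    fix x assume x: "x \<in> U"
    have "superchar c n \<theta> D \<phi> x = (\<Prod>\<alpha>\<in>D. C \<alpha> * (\<Sum>p\<in>V \<times> V. \<theta> (2 * (\<phi> \<alpha> * wtp \<alpha> (cay x) p))))"
      unfolding superchar_def using C x by (intro prod.cong) auto
    also have "\<dots> = (\<Prod>\<alpha>\<in>D. C \<alpha>) * (\<Prod>\<alpha>\<in>D. \<Sum>p\<in>V \<times> V. \<theta> (2 * (\<phi> \<alpha> * wtp \<alpha> (cay x) p)))"
      by (rule prod.distrib)
    also have "(\<Prod>\<alpha>\<in>D. \<Sum>p\<in>V \<times> V. \<theta> (2 * (\<phi> \<alpha> * wtp \<alpha> (cay x) p))) =
        (\<Sum>f\<in>D \<rightarrow>\<^sub>E V \<times> V. \<Prod>\<alpha>\<in>D. \<theta> (2 * (\<phi> \<alpha> * wtp \<alpha> (cay x) (f \<alpha>))))"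
      by (rule prod_sum_PiE[OF finD]) simp
    also have "\<dots> = (\<Sum>f\<in>D \<rightarrow>\<^sub>E V \<times> V. \<theta> (2 * functional D \<phi> f (cay x)))"
      unfolding functional_def sum_distrib_left theta_sum[OF finD] ..
    finally show "superchar c n \<theta> D \<phi> x = (\<Prod>\<alpha>\<in>D. C \<alpha>) * (\<Sum>f\<in>D \<rightarrow>\<^sub>E V \<times> V. \<theta> (2 * functional D \<phi> f (cay x)))" .
  qed
qed

text \<open>Translation by \<open>a\<close> permutes the field, so comparing the product of all
  values with itself gives \<open>\<theta> a ^ CARD('a) = 1\<close>. Hence the values have modulus
  1, and the inverse \<open>\<theta> (- a)\<close> is the conjugate.\<close>

lemma cnj_theta: "cnj (\<theta> a) = \<theta> (- a)"
proof -
  have nz: "\<theta> x \<noteq> 0" for x using additive by (simp add: additive_char_def)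
  have "(\<Prod>x\<in>UNIV. \<theta> x) = (\<Prod>x\<in>UNIV. \<theta> (x + a))"
    by (rule prod.reindex_bij_witness[of _ "\<lambda>x. x + a" "\<lambda>x. x - a"]) auto
  also have "\<dots> = (\<Prod>x\<in>UNIV. \<theta> x) * \<theta> a ^ CARD('a)" by (simp add: theta_add prod.distrib)
  finally have "\<theta> a ^ CARD('a) = 1" using nz by simp
  hence "norm (\<theta> a) ^ CARD('a) = 1 ^ CARD('a)" by (metis norm_one norm_power power_one)
  hence "norm (\<theta> a) = 1" by (rule power_eq_imp_eq_base) auto
  hence "\<theta> a * cnj (\<theta> a) = 1" by (simp flip: complex_norm_square)
  moreover have "\<theta> a * \<theta> (- a) = 1" by (simp flip: theta_add)
  ultimately show ?thesis using nz[of a] by (metis mult_left_cancel)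
qed

lemma superchar_orthogonal:
  assumes P: "(D, \<phi>) \<in> basic_pairs c n" "(D', \<phi>') \<in> basic_pairs c n" "(D, \<phi>) \<noteq> (D', \<phi>')"
  shows "frobenius (U_grp c n) (superchar c n \<theta> D \<phi>) (superchar c n \<theta> D' \<phi>') = 0"
proof -
  obtain C where C: "\<forall>x\<in>U. superchar c n \<theta> D \<phi> x = C * (\<Sum>f\<in>D \<rightarrow>\<^sub>E V \<times> V. \<theta> (2 * functional D \<phi> f (cay x)))"
    using superchar_expansion[OF P(1)] by blast
  obtain C' where C': "\<forall>x\<in>U. superchar c n \<theta> D' \<phi>' x = C' * (\<Sum>f\<in>D' \<rightarrow>\<^sub>E V \<times> V. \<theta> (2 * functional D' \<phi>' f (cay x)))"
    using superchar_expansion[OF P(2)] by blast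
  let ?\<nu> = "\<lambda>f f' s. \<theta> (2 * (functional D \<phi> f s - functional D' \<phi>' f' s))"
  have "(\<Sum>x\<in>U. superchar c n \<theta> D \<phi> x * cnj (superchar c n \<theta> D' \<phi>' x)) =
      (\<Sum>x\<in>U. C * cnj C' * (\<Sum>f\<in>D \<rightarrow>\<^sub>E V \<times> V. \<Sum>f'\<in>D' \<rightarrow>\<^sub>E V \<times> V. ?\<nu> f f' (cay x)))"
  proof (rule sum.cong[OF refl])
    fix x assume x: "x \<in> U"
    have "superchar c n \<theta> D \<phi> x * cnj (superchar c n \<theta> D' \<phi>' x) = C * cnj C' *
        ((\<Sum>f\<in>D \<rightarrow>\<^sub>E V \<times> V. \<theta> (2 * functional D \<phi> f (cay x))) * (\<Sum>f\<in>D' \<rightarrow>\<^sub>E V \<times> V. \<theta> (- (2 * functional D' \<phi>' f (cay x)))))"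
      using C C' x by (simp add: cnj_sum cnj_theta)
    also have "(\<Sum>f\<in>D \<rightarrow>\<^sub>E V \<times> V. \<theta> (2 * functional D \<phi> f (cay x))) * (\<Sum>f\<in>D' \<rightarrow>\<^sub>E V \<times> V. \<theta> (- (2 * functional D' \<phi>' f (cay x)))) =
        (\<Sum>f\<in>D \<rightarrow>\<^sub>E V \<times> V. \<Sum>f'\<in>D' \<rightarrow>\<^sub>E V \<times> V. ?\<nu> f f' (cay x))"
      unfolding sum_product by (simp add: right_diff_distrib flip: theta_add)
    finally show "superchar c n \<theta> D \<phi> x * cnj (superchar c n \<theta> D' \<phi>' x) =
        C * cnj C' * (\<Sum>f\<in>D \<rightarrow>\<^sub>E V \<times> V. \<Sum>f'\<in>D' \<rightarrow>\<^sub>E V \<times> V. ?\<nu> f f' (cay x))" .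
  qed
  also have "\<dots> = C * cnj C' * (\<Sum>f\<in>D \<rightarrow>\<^sub>E V \<times> V. \<Sum>f'\<in>D' \<rightarrow>\<^sub>E V \<times> V. \<Sum>x\<in>U. ?\<nu> f f' (cay x))"
    unfolding sum_distrib_left[symmetric] by (subst sum.swap, subst sum.swap) (rule refl)
  also have "(\<Sum>f\<in>D \<rightarrow>\<^sub>E V \<times> V. \<Sum>f'\<in>D' \<rightarrow>\<^sub>E V \<times> V. \<Sum>x\<in>U. ?\<nu> f f' (cay x)) = 0"
  proof (rule sum.neutral, rule ballI, rule sum.neutral, rule ballI)
    fix f f' assume f: "f \<in> D \<rightarrow>\<^sub>E V \<times> V" "f' \<in> D' \<rightarrow>\<^sub>E V \<times> V"
    \<comment> \<open>The Cayley bijection moves the sum from the group to a linear space, where it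
      can be translated.\<close>
    have "(\<Sum>x\<in>U. ?\<nu> f f' (cay x)) = (\<Sum>s\<in>skew. ?\<nu> f f' s)"
      by (rule sum.reindex_bij_betw[OF cay_bij])
    thus "(\<Sum>x\<in>U. ?\<nu> f f' (cay x)) = 0" using sum_skew_vanishes[OF P f] by simp
  qed
  finally show ?thesis by (simp add: frobenius_def U_grp_simps)
qed

lemma finite_basic_pairs: "finite (basic_pairs c n :: (root set \<times> (root \<Rightarrow> 'a)) set)"
proof -
  have "(basic_pairs c n :: (root set \<times> (root \<Rightarrow> 'a)) set) \<subseteq> (SIGMA D:Pow (roots c n). D \<rightarrow>\<^sub>E UNIV)"
    by (auto simp: basic_pairs_def basic_def)
  moreover have "finite (SIGMA D:Pow (roots c n). D \<rightarrow>\<^sub>E (UNIV :: 'a set))"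
    using finite_roots by (intro finite_SigmaI finite_PiE) (auto intro: finite_subset)
  ultimately show ?thesis by (rule finite_subset)
qed

lemma sum_superclasses:
  assumes P: "(D', \<phi>') \<in> basic_pairs c n" "(D'', \<phi>'') \<in> basic_pairs c n"
  shows "(\<Sum>(D, \<phi>) \<in> (basic_pairs c n :: (root set \<times> (root \<Rightarrow> 'a)) set).
      of_nat (card (superclass c n D \<phi>)) / of_nat (card (U_set c n :: 'a mat set)) *
      superchar c n \<theta> D' \<phi>' (z_rep c n D \<phi>) * cnj (superchar c n \<theta> D'' \<phi>'' (z_rep c n D \<phi>))) =
    frobenius (U_grp c n) (superchar c n \<theta> D' \<phi>') (superchar c n \<theta> D'' \<phi>'')"
proof -
  let ?g = "\<lambda>x. superchar c n \<theta> D' \<phi>' x * cnj (superchar c n \<theta> D'' \<phi>'' x)"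
  let ?K = "\<lambda>P. superclass c n (fst P) (snd P) :: 'a mat set"
  let ?B = "basic_pairs c n :: (root set \<times> (root \<Rightarrow> 'a)) set"
  have KU: "?K P \<subseteq> U" for P by (auto simp: superclass_iff)
  have finK: "finite (?K P)" for P using KU finite_U finite_subset by blast
  have cover: "U = (\<Union>P\<in>?B. ?K P)"
  proof
    show "U \<subseteq> (\<Union>P\<in>?B. ?K P)"
    proof
      fix x assume "x \<in> U"
      from superclass_exists[OF this] obtain D and \<phi> :: "root \<Rightarrow> 'a"
        where "(D, \<phi>) \<in> ?B" "x \<in> superclass c n D \<phi>" by metis
      thus "x \<in> (\<Union>P\<in>?B. ?K P)" by force
    qed
  qed (use KU in blast)
  have disj: "?K P \<inter> ?K P' = {}" if "P \<in> ?B" "P' \<in> ?B" "P \<noteq> P'" for P P'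
    using superclass_unique[of "fst P" "snd P" "fst P'" "snd P'"] that by (auto simp: prod_eq_iff)
  have "(\<Sum>x\<in>U. ?g x) = (\<Sum>P\<in>?B. \<Sum>x\<in>?K P. ?g x)"
    unfolding cover using finite_basic_pairs finK disj by (intro sum.UNION_disjoint) auto
  also have "\<dots> = (\<Sum>P\<in>?B. of_nat (card (?K P)) * ?g (z_rep c n (fst P) (snd P)))"
  proof (rule sum.cong[OF refl])
    fix P assume "P \<in> ?B"
    hence PB: "(fst P, snd P) \<in> ?B" by simp
    have "?g x = ?g (z_rep c n (fst P) (snd P))" if "x \<in> ?K P" for x
      using superchar_superclass[OF that z_rep_superclass[OF PB]] P by metis
    thus "(\<Sum>x\<in>?K P. ?g x) = of_nat (card (?K P)) * ?g (z_rep c n (fst P) (snd P))" by simp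
  qed
  finally show ?thesis
    unfolding frobenius_def U_grp_simps U_def case_prod_unfold
    by (simp add: sum_distrib_left mult_ac)
qed

end

text \<open>Adding 1 permutes the field, so the sum of all elements shows that
  \<open>CARD('a)\<close> is 0 in it; but an odd number equals 1 as soon as 2 is 0.\<close>

lemma two_neq_0_finite_field:
  assumes "odd CARD('a::{field,finite})"
  shows "(2 :: 'a) \<noteq> 0"
proof
  assume two: "(2 :: 'a) = 0"
  have "(\<Sum>x\<in>UNIV. x) = (\<Sum>x\<in>UNIV. x + (1 :: 'a))"
    by (rule sum.reindex_bij_witness[of _ "\<lambda>x. x + 1" "\<lambda>x. x - 1"]) auto
  hence "(of_nat CARD('a) :: 'a) = 0" by (simp add: sum.distrib)
  moreover obtain k where "CARD('a) = 2 * k + 1" using assms by (elim oddE)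
  ultimately show False using two by simp
qed

theorem theorem6p2:
  fixes c :: group_type and n p e :: nat
    and \<theta> :: "'a::{field,finite} \<Rightarrow> complex"
    and D' D'' :: "root set" and \<phi>' \<phi>'' :: "root \<Rightarrow> 'a"
  assumes "prime p" and "odd p" and "e \<ge> 1" and "CARD('a) = p ^ e" and "n \<ge> 1"
    and "additive_char \<theta>" and "\<exists>a. \<theta> a \<noteq> 1"
    and "(D', \<phi>') \<in> basic_pairs c n" and "(D'', \<phi>'') \<in> basic_pairs c n"
  shows "(\<Sum>(D, \<phi>) \<in> (basic_pairs c n :: (root set \<times> (root \<Rightarrow> 'a)) set).
            of_nat (card (superclass c n D \<phi>)) / of_nat (card (U_set c n :: 'a mat set)) *
            superchar c n \<theta> D' \<phi>' (z_rep c n D \<phi>) *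
            cnj (superchar c n \<theta> D'' \<phi>'' (z_rep c n D \<phi>)))
         = of_bool (D' = D'') * of_bool (\<phi>' = \<phi>'') *
           frobenius (U_grp c n) (superchar c n \<theta> D' \<phi>') (superchar c n \<theta> D' \<phi>')"
proof -
  have "odd CARD('a)" using assms(2,4) by simp
  from two_neq_0_finite_field[OF this] interpret unipotent_classical c n "msize c n" \<theta>
    using assms(6,7) by unfold_locales auto
  note sum_eq = sum_superclasses[OF assms(8,9)]
  show ?thesis
  proof (cases "D' = D'' \<and> \<phi>' = \<phi>''")
    case True
    thus ?thesis using sum_eq by simp
  next
    case False
    thus ?thesis using sum_eq superchar_orthogonal[OF assms(8,9)] by auto
  qed
qed

end
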